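(* Let $E$ be a UCP space with the $\varepsilon$-Hahn-Jordan decomposition property and such that $I_3(e_1,e_2,e_3)=0$ for all mutually orthogonal events $e_1,e_2,e_3\in E$. Let $A$ be the order-unit space generated by $E$, equipped with the multiplication $\square$. Assume that $(A,\square)$ is power-associative and that $x^2=x\,\square\,x\ge 0$ for all $x\in A$. Then the multiplication $\square$ is commutative and $A$ with $\square$ is a Jordan algebra, i.e. $x\,\square\,y=y\,\square\,x$ and $x\,\square\,(x^2\,\square\,y)=x^2\,\square\,(x\,\square\,y)$ for all $x,y\in A$. Moreover, $E$ is a $\sigma(A,V)$-dense subset of $\{e\in A: e^2=e\}$.
   Context: Quantum logic: a set $E$ with distinguished elements $0,\mathbb{1}$, a relation $\perp$ (orthogonality) and a partial binary operation $+$ such that for $e,f,g\in E$: (OS1) $e\perp f$ implies $f\perp e$; (OS2) $e+f$ is defined for $e\perp f$, and then $e+f=f+e$; (OS3) if $g\perp e$, $g\perp f$, $e\perp f$, then $g\perp e+f$, $f\perp g+e$ and $g+(e+f)=(g+e)+f$; (OS4) $0\perp e$ and $e+0=e$ for all $e$; (OS5) for every $e$ there is a unique $e'\in E$ with $e\perp e'$ and $e+e'=\mathbb{1}$; (OS6) there exists $d\in E$ with $e\perp d$ and $e+d=f$ if and only if $e\perp f'$. A state is a map $\mu:E\to[0,1]$ with $\mu(\mathbb{1})=1$ and $\mu(e+f)=\mu(e)+\mu(f)$ whenever $e\perp f$; $S$ is the set of all states. If $\mu\in S$ and $\mu(e)>0$, a state $\nu$ is a conditional probability of $\mu$ under $e$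 if $\nu(f)=\mu(f)/\mu(e)$ for all $f\in E$ with $f\perp e'$. UCP space: such an $E$ satisfying (UC1) if $\mu(e)=\mu(f)$ for all $\mu\in S$, then $e=f$; (UC2) if $\mu\in S$ and $\mu(e)>0$, there is exactly one conditional probability of $\mu$ under $e$, denoted $\mu_e$. Elements of $E$ are called events. Order-unit space generated by $E$: $V:=\{s\mu-t\nu:\mu,\nu\in S,\ 0\le s,t\in\mathbb{R}\}$, a linear space of real functions on $E$, with norm $\|\rho\|=\inf\{r\ge 0:\rho\in r\,\mathrm{conv}(S\cup -S)\}$. $A:=V^*$ is the dual Banach space. For $\rho\in V$ and $x\in A$ put $\hat\rho(x):=x(\rho)$. Order: $x\ge 0$ iff $\hat\mu(x)\ge0$ for all $\mu\in S$. Each $e\in E$ is identified with the element $\rho\mapsto\rho(e)$ of $A$ (an injective identification by (UC1)); $\mathbb{1}$ is the order unit, $e'=\mathbb{1}-e$, and $\|x\|=\sup\{|\hat\mu(x)|:\mu\in S\}$. $\sigma(A,V)$ is the weak-$*$ topology on $A$. For $e\in E$, $U_e:A\to A$ is the (well-defined) linear map with $(U_ex)(s\mu-t\nu)=s\mu(e)\hat\mu_e(x)-t\nu(e)\hat\nu_e(x)$ for $\mu,\nu\in S$, $s,t\ge0$, where $\mu(e)\hat\mu_e(x):=0$ if $\mu(e)=0$ (similarly for $\nu$). Further, $T_ex:=\frac12(x+U_ex-U_{e'}x)$ for $x\in A$. For mutually orthogonal $e_1,e_2,e_3\in E$, $$I_3(e_1,e_2,e_3):=U_{e_1+e_2+e_3}-U_{e_1+e_2}-U_{e_2+e_3}-U_{e_1+e_3}+U_{e_1}+U_{e_2}+U_{e_3}.$$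 $\varepsilon$-Hahn-Jordan decomposition property of $E$: for each bounded function $\rho:E\to\mathbb{R}$ that is orthogonally additive ($\rho(e+f)=\rho(e)+\rho(f)$ for $e\perp f$) and every $\varepsilon>0$ there are $\mu,\nu\in S$, real $s,t\ge0$ and $e\in E$ with $\rho=s\mu-t\nu$, $\mu(e)<\varepsilon$ and $\nu(e')<\varepsilon$. Product: under the $\varepsilon$-Hahn-Jordan decomposition property and $I_3=0$ for all mutually orthogonal triples, for each $x\in A$ the map $E\to A$, $e\mapsto T_ex$, has a unique $\sigma(A,V)$-continuous linear extension $A\to A$, written $y\mapsto T_yx$. Define $y\,\square\,x:=T_yx$ for $x,y\in A$ (a bilinear product). Powers: $x^1:=x$, $x^{n+1}:=x\,\square\,x^n$. $(A,\square)$ is power-associative if $x^n\,\square\,x^m=x^{n+m}$ for all $x\in A$ and all natural numbers $n,m\geq 1$. *)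

theory Defs
  imports "HOL-Analysis.Analysis" "HOL-Library.Function_Algebras"
begin

text \<open>Real functions on a set form a real vector space under the pointwise operations.\<close>

instantiation "fun" :: (type, real_vector) real_vector
begin

definition scaleR_fun :: "real \<Rightarrow> ('a \<Rightarrow> 'b) \<Rightarrow> 'a \<Rightarrow> 'b"
  where "scaleR_fun c f = (\<lambda>x. c *\<^sub>R f x)"

instance
  by standard (simp_all add: scaleR_fun_def fun_eq_iff scaleR_add_right scaleR_add_left)

end

lemma scaleR_fun_apply [simp]: "(c *\<^sub>R f) x = c *\<^sub>R f x"
  by (simp add: scaleR_fun_def)

definition linear_on :: "'a::real_vector set \<Rightarrow> ('a \<Rightarrow> 'b::real_vector) \<Rightarrow> bool"
  where "linear_on X f \<longleftrightarrow>
    (\<forall>x\<in>X. \<forall>y\<in>X. f (x + y) = f x + f y) \<and> (\<forall>c. \<forall>x\<in>X. f (c *\<^sub>R x) = c *\<^sub>R f x)"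

text \<open>The underlying set of a quantum logic is the type \<open>'e\<close>. The partial sum is given by a total
  function \<open>osum\<close> whose value is used only for orthogonal arguments.\<close>

record 'e qlogic =
  qzero :: 'e
  qone :: 'e
  orth :: "'e \<Rightarrow> 'e \<Rightarrow> bool"
  osum :: "'e \<Rightarrow> 'e \<Rightarrow> 'e"

definition compl :: "'e qlogic \<Rightarrow> 'e \<Rightarrow> 'e"
  where "compl E e = (THE d. orth E e d \<and> osum E e d = qone E)"

definition quantum_logic :: "'e qlogic \<Rightarrow> bool"
  where "quantum_logic E \<longleftrightarrow>
    (\<forall>e f. orth E e f \<longrightarrow> orth E f e) \<and>
    (\<forall>e f. orth E e f \<longrightarrow> osum E e f = osum E f e) \<and>
    (\<forall>e f g. orth E g e \<and> orth E g f \<and> orth E e f \<longrightarrow>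
       orth E g (osum E e f) \<and> orth E f (osum E g e) \<and>
       osum E g (osum E e f) = osum E (osum E g e) f) \<and>
    (\<forall>e. orth E (qzero E) e \<and> osum E e (qzero E) = e) \<and>
    (\<forall>e. \<exists>!d. orth E e d \<and> osum E e d = qone E) \<and>
    (\<forall>e f. (\<exists>d. orth E e d \<and> osum E e d = f) \<longleftrightarrow> orth E e (compl E f))"

definition orth_additive :: "'e qlogic \<Rightarrow> ('e \<Rightarrow> real) \<Rightarrow> bool"
  where "orth_additive E \<rho> \<longleftrightarrow> (\<forall>e f. orth E e f \<longrightarrow> \<rho> (osum E e f) = \<rho> e + \<rho> f)"

definition states :: "'e qlogic \<Rightarrow> ('e \<Rightarrow> real) set"
  where "states E = {\<mu>. (\<forall>e. 0 \<le> \<mu> e \<and> \<mu> e \<le> 1) \<and> \<mu> (qone E) = 1 \<and> orth_additive E \<mu>}"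

definition is_cond_prob :: "'e qlogic \<Rightarrow> ('e \<Rightarrow> real) \<Rightarrow> 'e \<Rightarrow> ('e \<Rightarrow> real) \<Rightarrow> bool"
  where "is_cond_prob E \<mu> e \<nu> \<longleftrightarrow>
    \<nu> \<in> states E \<and> (\<forall>f. orth E f (compl E e) \<longrightarrow> \<nu> f = \<mu> f / \<mu> e)"

definition cond_prob :: "'e qlogic \<Rightarrow> ('e \<Rightarrow> real) \<Rightarrow> 'e \<Rightarrow> 'e \<Rightarrow> real"
  where "cond_prob E \<mu> e = (THE \<nu>. is_cond_prob E \<mu> e \<nu>)"

definition ucp_space :: "'e qlogic \<Rightarrow> bool"
  where "ucp_space E \<longleftrightarrow> quantum_logic E \<and>
    (\<forall>e f. (\<forall>\<mu>\<in>states E. \<mu> e = \<mu> f) \<longrightarrow> e = f) \<and>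
    (\<forall>\<mu>\<in>states E. \<forall>e. 0 < \<mu> e \<longrightarrow> (\<exists>!\<nu>. is_cond_prob E \<mu> e \<nu>))"

definition eps_hahn_jordan :: "'e qlogic \<Rightarrow> bool"
  where "eps_hahn_jordan E \<longleftrightarrow>
    (\<forall>\<rho>. bounded (range \<rho>) \<and> orth_additive E \<rho> \<longrightarrow>
      (\<forall>\<epsilon>>0. \<exists>\<mu>\<in>states E. \<exists>\<nu>\<in>states E. \<exists>s t e. 0 \<le> s \<and> 0 \<le> t \<and>
         \<rho> = s *\<^sub>R \<mu> - t *\<^sub>R \<nu> \<and> \<mu> e < \<epsilon> \<and> \<nu> (compl E e) < \<epsilon>))"

definition Vspace :: "'e qlogic \<Rightarrow> ('e \<Rightarrow> real) set"
  where "Vspace E = {s *\<^sub>R \<mu> - t *\<^sub>R \<nu> |s t \<mu> \<nu>. \<mu> \<in> states E \<and> \<nu> \<in> states E \<and> 0 \<le> s \<and> 0 \<le> t}"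

definition Vnorm :: "'e qlogic \<Rightarrow> ('e \<Rightarrow> real) \<Rightarrow> real"
  where "Vnorm E \<rho> =
    Inf {r. 0 \<le> r \<and> \<rho> \<in> (\<lambda>\<sigma>. r *\<^sub>R \<sigma>) ` (convex hull (states E \<union> uminus ` states E))}"

type_synonym 'e functional = "('e \<Rightarrow> real) \<Rightarrow> real"

text \<open>The dual space of \<open>Vspace E\<close>. Its elements are total functions that vanish outside of
  \<open>Vspace E\<close>, so that two elements are equal iff they agree on \<open>Vspace E\<close>.\<close>

definition Aspace :: "'e qlogic \<Rightarrow> 'e functional set"
  where "Aspace E = {x. linear_on (Vspace E) x \<and>
    (\<exists>K. \<forall>\<rho>\<in>Vspace E. \<bar>x \<rho>\<bar> \<le> K * Vnorm E \<rho>) \<and> (\<forall>\<rho>. \<rho> \<notin> Vspace E \<longrightarrow> x \<rho> = 0)}"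

definition nonneg :: "'e qlogic \<Rightarrow> 'e functional \<Rightarrow> bool"
  where "nonneg E x \<longleftrightarrow> (\<forall>\<mu>\<in>states E. 0 \<le> x \<mu>)"

definition emb :: "'e qlogic \<Rightarrow> 'e \<Rightarrow> 'e functional"
  where "emb E e = (\<lambda>\<rho>. if \<rho> \<in> Vspace E then \<rho> e else 0)"

definition weak_star :: "'e qlogic \<Rightarrow> 'e functional topology"
  where "weak_star E =
    topology_generated_by {{x \<in> Aspace E. x \<rho> \<in> G} |\<rho> G. \<rho> \<in> Vspace E \<and> open G}"

definition weighted_cond :: "'e qlogic \<Rightarrow> ('e \<Rightarrow> real) \<Rightarrow> 'e \<Rightarrow> 'e functional \<Rightarrow> real"
  where "weighted_cond E \<mu> e x = (if \<mu> e = 0 then 0 else \<mu> e * x (cond_prob E \<mu> e))"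

definition Uop :: "'e qlogic \<Rightarrow> 'e \<Rightarrow> 'e functional \<Rightarrow> 'e functional"
  where "Uop E e x = (THE y. y \<in> Aspace E \<and>
    (\<forall>\<mu>\<in>states E. \<forall>\<nu>\<in>states E. \<forall>s\<ge>0. \<forall>t\<ge>0.
       y (s *\<^sub>R \<mu> - t *\<^sub>R \<nu>) = s * weighted_cond E \<mu> e x - t * weighted_cond E \<nu> e x))"

definition Top :: "'e qlogic \<Rightarrow> 'e \<Rightarrow> 'e functional \<Rightarrow> 'e functional"
  where "Top E e x = (1/2) *\<^sub>R (x + Uop E e x - Uop E (compl E e) x)"

definition I3 :: "'e qlogic \<Rightarrow> 'e \<Rightarrow> 'e \<Rightarrow> 'e \<Rightarrow> 'e functional \<Rightarrow> 'e functional"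
  where "I3 E e1 e2 e3 x =
    Uop E (osum E (osum E e1 e2) e3) x
    - Uop E (osum E e1 e2) x - Uop E (osum E e2 e3) x - Uop E (osum E e1 e3) x
    + Uop E e1 x + Uop E e2 x + Uop E e3 x"

text \<open>\<open>Text E x\<close> is the map \<open>y \<mapsto> T\<^sub>y x\<close>, the unique \<open>\<sigma>(A,V)\<close>-continuous linear extension
  of \<open>e \<mapsto> T\<^sub>e x\<close>. Membership in the extensional function space \<open>\<rightarrow>\<^sub>E\<close> only fixes the
  irrelevant values outside of \<open>Aspace E\<close>, as \<open>THE\<close> needs uniqueness of a total function.\<close>

definition Text :: "'e qlogic \<Rightarrow> 'e functional \<Rightarrow> 'e functional \<Rightarrow> 'e functional"
  where "Text E x = (THE L. L \<in> Aspace E \<rightarrow>\<^sub>E Aspace E \<and> linear_on (Aspace E) L \<and>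
    continuous_map (weak_star E) (weak_star E) L \<and> (\<forall>e. L (emb E e) = Top E e x))"

definition sqprod :: "'e qlogic \<Rightarrow> 'e functional \<Rightarrow> 'e functional \<Rightarrow> 'e functional"
  where "sqprod E y x = Text E x y"

text \<open>Only the powers with exponent at least 1 are used; exponent 0 is set to the unit.\<close>

fun sqpow :: "'e qlogic \<Rightarrow> 'e functional \<Rightarrow> nat \<Rightarrow> 'e functional"
  where
    "sqpow E x 0 = emb E (qone E)"
  | "sqpow E x (Suc 0) = x"
  | "sqpow E x (Suc (Suc n)) = sqprod E x (sqpow E x (Suc n))"

definition power_associative :: "'e qlogic \<Rightarrow> bool"
  where "power_associative E \<longleftrightarrow>
    (\<forall>x\<in>Aspace E. \<forall>n\<ge>1. \<forall>m\<ge>1. sqprod E (sqpow E x n) (sqpow E x m) = sqpow E x (n + m))"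

definition jordan_algebra_on :: "'a::real_vector set \<Rightarrow> ('a \<Rightarrow> 'a \<Rightarrow> 'a) \<Rightarrow> bool"
  where "jordan_algebra_on A p \<longleftrightarrow> subspace A \<and>
    (\<forall>x\<in>A. \<forall>y\<in>A. p x y \<in> A) \<and>
    (\<forall>x\<in>A. linear_on A (p x)) \<and> (\<forall>y\<in>A. linear_on A (\<lambda>x. p x y)) \<and>
    (\<forall>x\<in>A. \<forall>y\<in>A. p x y = p y x) \<and>
    (\<forall>x\<in>A. \<forall>y\<in>A. p x (p (p x x) y) = p (p x x) (p x y))"

end

theory Submission
  imports Defs
begin

text \<open>Idea. Consider the symmetrisation of the product. It is commutative and power-associative with
  positive squares, so for an idempotent \<open>p\<close> with multiplication operator \<open>T\<close> one has
  \<open>T (2 T - 1) (T - 1) = 0\<close>, and the Cauchy-Schwarz inequality makes the resolvents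
  \<open>(1 - \<epsilon> T)\<^sup>-\<^sup>1\<close> with \<open>\<epsilon> < 1\<close> positive; letting \<open>\<epsilon>\<close> tend to \<open>1\<close>, the Peirce projection
  \<open>2 T\<^sup>2 - T\<close> is positive. For an event \<open>e\<close> it therefore defines conditional probabilities, whose
  uniqueness identifies it with \<open>U\<^sub>e\<close>. Hence the events commute with each other and then with all of
  \<open>A\<close>. Since every element of \<open>A\<close> is approximated by linear combinations of events in the
  seminorms \<open>x \<mapsto> \<mu> (x\<^sup>2)\<^sup>1\<^sup>/\<^sup>2\<close>, the product is commutative.

  Positivity of the Peirce projections also yields the Peirce multiplication rules, which are the
  linearised Jordan identity at an idempotent. The general case follows because \<open>x\<close> is a norm limit
  of linear combinations of commuting idempotents from the closed subalgebra that it generates.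
  Finally, a Hahn-Jordan decomposition of \<open>\<sigma> \<circ> (U\<^sub>p - U\<^sub>1\<^sub>-\<^sub>p)\<close> yields an event \<open>f\<close> with
  \<open>\<sigma> ((f - p)\<^sup>2)\<close> small.\<close>

section \<open>Power-associative algebras with positive squares\<close>

text \<open>Two obstacles fix the order of the argument. The extension defining the product is
  weak-star continuous in the left factor only, so limits in the right factor become available only
  once commutativity is proved. The Peirce theory therefore has to use just the order, bounds over
  the states and the identity \<open>(x^2)^2 = x (x (x x))\<close>; completeness and limits enter in
  a second locale. Moreover, the spectral idempotents of an element are not known to be events, so
  the Peirce rules are proved for every idempotent of \<open>A\<close>.

  The Hahn-Jordan property acts in three ways. It puts every bounded orthogonally additive function
  into \<open>V\<close>, which constructs the product. It provides, for each element of
  \<open>V\<close>, an event whose symmetry nearly attains its norm; hence the product is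
  submultiplicative with constant 1, and an element of \<open>V\<close> that is small on events is
  small on bounded subsets of \<open>A\<close>. Finally it supplies the events close to a given
  idempotent.

  Symmetrising keeps the hypotheses intact: squares do not change, and the powers of one element
  commute already.\<close>

lemma quartic_coeffs_eq_0:
  fixes c1 c2 c3 c4 :: "'a::real_vector"
  assumes "\<And>t::real. t *\<^sub>R c1 + t^2 *\<^sub>R c2 + t^3 *\<^sub>R c3 + t^4 *\<^sub>R c4 = 0"
  shows "c1 = 0" "c2 = 0"
proof -
  have a: "c1 + c2 + c3 + c4 = 0" using assms[of 1] by simp
  have b: "- c1 + c2 - c3 + c4 = 0" using assms[of "-1"] by simp
  have c: "2 *\<^sub>R c1 + 4 *\<^sub>R c2 + 8 *\<^sub>R c3 + 16 *\<^sub>R c4 = 0" using assms[of 2] by simp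
  have d: "- (2 *\<^sub>R c1) + 4 *\<^sub>R c2 - 8 *\<^sub>R c3 + 16 *\<^sub>R c4 = 0" using assms[of "-2"] by simp
  \<comment> \<open>The odd parts at 1 and 2 eliminate \<open>c3\<close>; below, the even parts
    eliminate \<open>c4\<close>.\<close>
  have "12 *\<^sub>R c1 = 8 *\<^sub>R (c1 + c2 + c3 + c4) - 8 *\<^sub>R (- c1 + c2 - c3 + c4)
     - (2 *\<^sub>R c1 + 4 *\<^sub>R c2 + 8 *\<^sub>R c3 + 16 *\<^sub>R c4) + (- (2 *\<^sub>R c1) + 4 *\<^sub>R c2 - 8 *\<^sub>R c3 + 16 *\<^sub>R c4)"
    by (simp add: algebra_simps flip: scaleR_left.add)
  then show "c1 = 0" unfolding a b c d by simp
  have "24 *\<^sub>R c2 = 16 *\<^sub>R (c1 + c2 + c3 + c4) + 16 *\<^sub>R (- c1 + c2 - c3 + c4)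
     - (2 *\<^sub>R c1 + 4 *\<^sub>R c2 + 8 *\<^sub>R c3 + 16 *\<^sub>R c4) - (- (2 *\<^sub>R c1) + 4 *\<^sub>R c2 - 8 *\<^sub>R c3 + 16 *\<^sub>R c4)"
    by (simp add: algebra_simps flip: scaleR_left.add)
  then show "c2 = 0" unfolding a b c d by simp
qed

text \<open>The norm is present only through bounds over the states, and \<open>submult\<close> is
  its submultiplicativity; the constant 1 there matters in \<open>pos_square_le\<close>. The product
  is total with values in \<open>A\<close>, so that bilinearity carries no membership
  premises.\<close>

locale power_assoc_algebra =
  fixes A :: "'a::real_vector set" and S :: "('a \<Rightarrow> real) set"
    and prd :: "'a \<Rightarrow> 'a \<Rightarrow> 'a" (infixl "\<odot>" 70) and u :: 'a
  assumes subspace_A: "subspace A"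
    and linear_state: "\<phi> \<in> S \<Longrightarrow> linear \<phi>"
    and prd_mem [simp]: "x \<odot> y \<in> A"
    and add_left: "(x + y) \<odot> z = x \<odot> z + y \<odot> z"
    and scale_left: "(c *\<^sub>R x) \<odot> z = c *\<^sub>R (x \<odot> z)"
    and comm: "x \<odot> y = y \<odot> x"
    and unit_mem [simp]: "u \<in> A"
    and unit_left [simp]: "x \<in> A \<Longrightarrow> u \<odot> x = x"
    and state_unit [simp]: "\<phi> \<in> S \<Longrightarrow> \<phi> u = 1"
    and separating: "\<lbrakk>x \<in> A; \<And>\<phi>. \<phi> \<in> S \<Longrightarrow> \<phi> x = 0\<rbrakk> \<Longrightarrow> x = 0"
    and bounded_on_states: "x \<in> A \<Longrightarrow> \<exists>k. \<forall>\<phi>\<in>S. \<bar>\<phi> x\<bar> \<le> k"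
    and submult: "\<lbrakk>x \<in> A; y \<in> A; \<And>\<phi>. \<phi> \<in> S \<Longrightarrow> \<bar>\<phi> x\<bar> \<le> a; \<And>\<phi>. \<phi> \<in> S \<Longrightarrow> \<bar>\<phi> y\<bar> \<le> b; \<phi> \<in> S\<rbrakk>
          \<Longrightarrow> \<bar>\<phi> (x \<odot> y)\<bar> \<le> a * b"
    and square_nonneg: "\<phi> \<in> S \<Longrightarrow> 0 \<le> \<phi> (x \<odot> x)"
    and power_assoc: "x \<in> A \<Longrightarrow>
          (((\<odot>) x ^^ n) u) \<odot> (((\<odot>) x ^^ m) u) = ((\<odot>) x ^^ (n + m)) u"
begin

lemma unit_right [simp]: "x \<in> A \<Longrightarrow> x \<odot> u = x"
  by (simp add: comm)

lemma add_right: "z \<odot> (x + y) = z \<odot> x + z \<odot> y"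
  by (simp add: comm[of z] add_left)

lemma scale_right: "z \<odot> (c *\<^sub>R x) = c *\<^sub>R (z \<odot> x)"
  by (simp add: comm[of z] scale_left)

lemma minus_left: "(- x) \<odot> z = - (x \<odot> z)"
  using scale_left[of "-1" x z] by simp

lemma minus_right: "z \<odot> (- x) = - (z \<odot> x)"
  using scale_right[of z "-1" x] by simp

lemma diff_left: "(x - y) \<odot> z = x \<odot> z - y \<odot> z"
  using add_left[of x "- y" z] by (simp add: minus_left)

lemma diff_right: "z \<odot> (x - y) = z \<odot> x - z \<odot> y"
  by (simp add: comm[of z] diff_left)

lemma zero_left [simp]: "0 \<odot> z = 0"
  using scale_left[of 0 0 z] by simp

lemma zero_right [simp]: "z \<odot> 0 = 0"
  by (simp add: comm[of z])

lemmas bilin = add_left add_right scale_left scale_right minus_left minus_right diff_left diff_right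

lemma linear_mult: "linear ((\<odot>) x)"
  by (rule linearI) (simp_all add: bilin)

lemma A_add [simp, intro]: "x \<in> A \<Longrightarrow> y \<in> A \<Longrightarrow> x + y \<in> A"
  and A_diff [simp, intro]: "x \<in> A \<Longrightarrow> y \<in> A \<Longrightarrow> x - y \<in> A"
  and A_scale [simp, intro]: "x \<in> A \<Longrightarrow> c *\<^sub>R x \<in> A"
  and A_minus [simp, intro]: "x \<in> A \<Longrightarrow> - x \<in> A"
  and A_zero [simp, intro]: "0 \<in> A"
  using subspace_A by (auto simp: subspace_add subspace_diff subspace_scale subspace_neg subspace_0)

lemma state_add: "\<phi> \<in> S \<Longrightarrow> \<phi> (x + y) = \<phi> x + \<phi> y"
  and state_diff: "\<phi> \<in> S \<Longrightarrow> \<phi> (x - y) = \<phi> x - \<phi> y"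
  and state_scale: "\<phi> \<in> S \<Longrightarrow> \<phi> (c *\<^sub>R x) = c * \<phi> x"
  and state_minus: "\<phi> \<in> S \<Longrightarrow> \<phi> (- x) = - \<phi> x"
  and state_zero [simp]: "\<phi> \<in> S \<Longrightarrow> \<phi> 0 = 0"
  using linear_state
  by (simp_all add: linear_add linear_diff linear_cmul linear_neg linear_0)

lemmas state_lin = state_add state_diff state_scale state_minus

lemma bounded_on_states_pos:
  assumes "x \<in> A"
  obtains k where "0 < k" "\<And>\<phi>. \<phi> \<in> S \<Longrightarrow> \<bar>\<phi> x\<bar> \<le> k"
proof -
  obtain k where k: "\<forall>\<phi>\<in>S. \<bar>\<phi> x\<bar> \<le> k"
    using bounded_on_states[OF assms] by blast
  show thesis
    by (rule that[of "max k 1"]) (use k in \<open>auto simp: max_def intro: order_trans\<close>)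
qed

section \<open>Positivity and the Cauchy-Schwarz inequality\<close>

definition pos :: "'a \<Rightarrow> bool"
  where "pos x \<longleftrightarrow> (\<forall>\<phi>\<in>S. 0 \<le> \<phi> x)"

lemma pos_square [simp]: "pos (x \<odot> x)"
  by (simp add: pos_def square_nonneg)

text \<open>Stated for all linear functionals that are nonnegative on squares, because it is also
  applied to a state composed with a Peirce projection.\<close>

lemma cauchy_schwarz_general:
  fixes \<psi> :: "'a \<Rightarrow> real"
  assumes lin: "linear \<psi>" and nonneg: "\<And>x. 0 \<le> \<psi> (x \<odot> x)"
  shows "(\<psi> (x \<odot> y))\<^sup>2 \<le> \<psi> (x \<odot> x) * \<psi> (y \<odot> y)"
proof -
  let ?a = "\<psi> (x \<odot> x)" and ?b = "\<psi> (x \<odot> y)" and ?c = "\<psi> (y \<odot> y)"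
  have q: "0 \<le> ?a + 2 * t * ?b + t\<^sup>2 * ?c" for t
    using nonneg[of "x + t *\<^sub>R y"]
    by (simp add: bilin lin linear_add linear_cmul comm[of y x] power2_eq_square algebra_simps)
  show ?thesis
  proof (cases "?c = 0")
    case True
    have "?b = 0"
    proof (rule ccontr)
      assume "?b \<noteq> 0"
      then show False
        \<comment> \<open>The quadratic is affine here, and this \<open>t\<close> gives it the value
          -1.\<close>
        using q[of "- (?a + 1) / (2 * ?b)"] True by (simp add: field_simps)
    qed
    then show ?thesis by (simp add: nonneg True)
  next
    case False
    then have c: "0 < ?c" using nonneg[of y] by simp
    \<comment> \<open>The quadratic is taken at its minimiser \<open>t = - ?b / ?c\<close>.\<close>
    have "0 \<le> ?c * (?a + 2 * (- ?b / ?c) * ?b + (- ?b / ?c)\<^sup>2 * ?c)"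
      using q c by (simp only: zero_le_mult_iff) simp
    also have "\<dots> = ?a * ?c - ?b\<^sup>2"
      using c by (simp add: field_simps power2_eq_square)
    finally show ?thesis by simp
  qed
qed

lemma cauchy_schwarz: "\<phi> \<in> S \<Longrightarrow> (\<phi> (x \<odot> y))\<^sup>2 \<le> \<phi> (x \<odot> x) * \<phi> (y \<odot> y)"
  by (rule cauchy_schwarz_general) (simp_all add: linear_state square_nonneg)

lemma state_square_le: "\<phi> \<in> S \<Longrightarrow> x \<in> A \<Longrightarrow> (\<phi> x)\<^sup>2 \<le> \<phi> (x \<odot> x)"
  using cauchy_schwarz[of \<phi> x u] by simp

lemma square_eq_0: "x \<in> A \<Longrightarrow> x \<odot> x = 0 \<Longrightarrow> x = 0"
  by (rule separating) (use state_square_le in fastforce)+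

text \<open>Since \<open>0 \<le> a \<le> k\<close>, the element \<open>2 a - k\<close> has norm at
  most \<open>k\<close>, so its square is at most \<open>k^2\<close>; expanding gives
  \<open>4 a^2 - 4 k a \<le> 0\<close>.\<close>

lemma pos_square_le:
  assumes "a \<in> A" "pos a" "\<And>\<phi>. \<phi> \<in> S \<Longrightarrow> \<phi> a \<le> k" "\<phi> \<in> S"
  shows "\<phi> (a \<odot> a) \<le> k * \<phi> a"
proof -
  let ?x = "2 *\<^sub>R a - k *\<^sub>R u"
  have "\<bar>\<psi> ?x\<bar> \<le> k" if "\<psi> \<in> S" for \<psi>
    using assms(2) assms(3)[OF that] that by (auto simp: state_lin pos_def abs_le_iff)
  then have "\<bar>\<phi> (?x \<odot> ?x)\<bar> \<le> k * k"
    by (intro submult) (use assms in auto)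
  moreover have "\<phi> (?x \<odot> ?x) = 4 * \<phi> (a \<odot> a) - 4 * k * \<phi> a + k * k"
    using assms by (simp add: bilin state_lin right_diff_distrib)
  ultimately show ?thesis by (simp add: abs_le_iff)
qed

text \<open>This instance of power-associativity drives the Peirce theory: linearised at an
  idempotent, it gives both the eigenvalues of the multiplication operator and the multiplication
  rules.\<close>

lemma power4_eq: "x \<in> A \<Longrightarrow> (x \<odot> x) \<odot> (x \<odot> x) = x \<odot> (x \<odot> (x \<odot> x))"
  using power_assoc[of x 2 2] power_assoc[of x 1 3] by (simp add: numeral_eq_Suc)

section \<open>Idempotents and their Peirce decomposition\<close>

definition idem :: "'a \<Rightarrow> bool"
  where "idem p \<longleftrightarrow> p \<in> A \<and> p \<odot> p = p"

lemma idem_mem [simp]: "idem p \<Longrightarrow> p \<in> A"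
  by (simp add: idem_def)

lemma idem_compl: "idem p \<Longrightarrow> idem (u - p)"
  by (simp add: idem_def bilin)

lemma idem_pos: "idem p \<Longrightarrow> pos p"
  using pos_square[of p] by (simp add: idem_def)

lemma idem_state: "idem p \<Longrightarrow> \<phi> \<in> S \<Longrightarrow> 0 \<le> \<phi> p \<and> \<phi> p \<le> 1"
  using idem_pos[of p] idem_pos[OF idem_compl[of p]] by (auto simp: pos_def state_lin)

text \<open>These are the coefficients of \<open>t\<close> and \<open>t^2\<close> in the
  fourth-power identity at \<open>p + t y\<close>. The first is a cubic equation for multiplication
  by \<open>p\<close>; the second is quadratic in \<open>y\<close> and is polarised below.\<close>

lemma
  assumes p: "idem p" and y: "y \<in> A"
  shows idem_linearised1: "4 *\<^sub>R (p \<odot> (p \<odot> y)) = p \<odot> y + p \<odot> (p \<odot> y) + 2 *\<^sub>R (p \<odot> (p \<odot> (p \<odot> y)))" (is ?A)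
    and idem_linearised2: "2 *\<^sub>R (p \<odot> (y \<odot> y)) + 4 *\<^sub>R ((p \<odot> y) \<odot> (p \<odot> y))
      = p \<odot> (p \<odot> (y \<odot> y)) + 2 *\<^sub>R (p \<odot> (y \<odot> (p \<odot> y))) + 2 *\<^sub>R (y \<odot> (p \<odot> (p \<odot> y))) + y \<odot> (p \<odot> y)" (is ?B)
proof -
  have pp: "p \<odot> p = p" and pA: "p \<in> A" using p by (auto simp: idem_def)
  define s where "s = y \<odot> y"
  define q where "q = p \<odot> y"
  define c1 where "c1 = 4 *\<^sub>R (p \<odot> q) - (q + p \<odot> q + 2 *\<^sub>R (p \<odot> (p \<odot> q)))"
  define c2 where "c2 = 2 *\<^sub>R (p \<odot> s) + 4 *\<^sub>R (q \<odot> q)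
      - (p \<odot> (p \<odot> s) + 2 *\<^sub>R (p \<odot> (y \<odot> q)) + 2 *\<^sub>R (y \<odot> (p \<odot> q)) + y \<odot> q)"
  define c3 where "c3 = 4 *\<^sub>R (q \<odot> s) - (p \<odot> (y \<odot> s) + y \<odot> (p \<odot> s) + 2 *\<^sub>R (y \<odot> (y \<odot> q)))"
  define c4 where "c4 = s \<odot> s - y \<odot> (y \<odot> s)"
  have "t *\<^sub>R c1 + t^2 *\<^sub>R c2 + t^3 *\<^sub>R c3 + t^4 *\<^sub>R c4 = 0" for t :: real
  proof -
    let ?x = "p + t *\<^sub>R y"
    have x2: "?x \<odot> ?x = p + (2 * t) *\<^sub>R q + t^2 *\<^sub>R s"
      by (simp add: bilin pp q_def s_def comm[of y p] power2_eq_square algebra_simps flip: scaleR_left.add)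
    have x3: "?x \<odot> (p + (2 * t) *\<^sub>R q + t^2 *\<^sub>R s) = p + (2 * t) *\<^sub>R (p \<odot> q) + t^2 *\<^sub>R (p \<odot> s)
        + t *\<^sub>R q + (2 * t^2) *\<^sub>R (y \<odot> q) + t^3 *\<^sub>R (y \<odot> s)"
      by (simp add: bilin pp q_def[symmetric] comm[of y p] power2_eq_square power3_eq_cube algebra_simps)
    have x4: "?x \<odot> (p + (2 * t) *\<^sub>R (p \<odot> q) + t^2 *\<^sub>R (p \<odot> s)
        + t *\<^sub>R q + (2 * t^2) *\<^sub>R (y \<odot> q) + t^3 *\<^sub>R (y \<odot> s))
       = p + (2 * t) *\<^sub>R (p \<odot> (p \<odot> q)) + t^2 *\<^sub>R (p \<odot> (p \<odot> s))
        + t *\<^sub>R (p \<odot> q) + (2 * t^2) *\<^sub>R (p \<odot> (y \<odot> q)) + t^3 *\<^sub>R (p \<odot> (y \<odot> s))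
        + t *\<^sub>R q + (2 * t^2) *\<^sub>R (y \<odot> (p \<odot> q)) + t^3 *\<^sub>R (y \<odot> (p \<odot> s))
        + t^2 *\<^sub>R (y \<odot> q) + (2 * t^3) *\<^sub>R (y \<odot> (y \<odot> q)) + t^4 *\<^sub>R (y \<odot> (y \<odot> s))"
      by (simp add: bilin pp q_def[symmetric] comm[of y p] power2_eq_square power3_eq_cube power4_eq_xxxx algebra_simps)
    have x22: "(p + (2 * t) *\<^sub>R q + t^2 *\<^sub>R s) \<odot> (p + (2 * t) *\<^sub>R q + t^2 *\<^sub>R s)
       = p + (4 * t) *\<^sub>R (p \<odot> q) + (2 * t^2) *\<^sub>R (p \<odot> s) + (4 * t^2) *\<^sub>R (q \<odot> q)
        + (4 * t^3) *\<^sub>R (q \<odot> s) + t^4 *\<^sub>R (s \<odot> s)"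
      by (simp add: bilin pp comm[of q p] comm[of s p] comm[of s q] power2_eq_square power3_eq_cube
          power4_eq_xxxx algebra_simps flip: scaleR_left.add)
    have "?x \<in> A" using pA y by simp
    from power4_eq[OF this] have "p + (4 * t) *\<^sub>R (p \<odot> q) + (2 * t^2) *\<^sub>R (p \<odot> s) + (4 * t^2) *\<^sub>R (q \<odot> q)
        + (4 * t^3) *\<^sub>R (q \<odot> s) + t^4 *\<^sub>R (s \<odot> s) = p + (2 * t) *\<^sub>R (p \<odot> (p \<odot> q)) + t^2 *\<^sub>R (p \<odot> (p \<odot> s))
        + t *\<^sub>R (p \<odot> q) + (2 * t^2) *\<^sub>R (p \<odot> (y \<odot> q)) + t^3 *\<^sub>R (p \<odot> (y \<odot> s))
        + t *\<^sub>R q + (2 * t^2) *\<^sub>R (y \<odot> (p \<odot> q)) + t^3 *\<^sub>R (y \<odot> (p \<odot> s))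
        + t^2 *\<^sub>R (y \<odot> q) + (2 * t^3) *\<^sub>R (y \<odot> (y \<odot> q)) + t^4 *\<^sub>R (y \<odot> (y \<odot> s))"
      unfolding x2 x3 x4 x22 .
    then show ?thesis
      by (simp add: c1_def c2_def c3_def c4_def algebra_simps)
  qed
  then have "c1 = 0" "c2 = 0" by (rule quartic_coeffs_eq_0)+
  then show ?A ?B by (auto simp: c1_def c2_def q_def s_def)
qed

text \<open>Linear identities in \<open>A\<close> are checked after evaluation at a state, where
  they become linear arithmetic over the reals.\<close>

lemma A_eqI:
  assumes "x \<in> A" "y \<in> A" "\<And>\<phi>. \<phi> \<in> S \<Longrightarrow> \<phi> x = \<phi> y"
  shows "x = y"
proof -
  have "x - y = 0" by (rule separating) (use assms in \<open>auto simp: state_lin\<close>)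
  then show ?thesis by simp
qed

lemma idem_cubic:
  assumes "idem p" "y \<in> A"
  shows "2 *\<^sub>R (p \<odot> (p \<odot> (p \<odot> y))) = 3 *\<^sub>R (p \<odot> (p \<odot> y)) - p \<odot> y"
proof (rule A_eqI)
  fix \<phi> assume "\<phi> \<in> S"
  then show "\<phi> (2 *\<^sub>R (p \<odot> (p \<odot> (p \<odot> y)))) = \<phi> (3 *\<^sub>R (p \<odot> (p \<odot> y)) - p \<odot> y)"
    using arg_cong[OF idem_linearised1[OF assms], of \<phi>] by (simp add: state_lin)
qed auto

text \<open>This and the next two are the Lagrange interpolation polynomials, in multiplication by
  \<open>p\<close>, for the roots 1, 1/2 and 0 of the cubic
  \<open>t (2 t - 1) (t - 1)\<close>.\<close>

definition peirce1 :: "'a \<Rightarrow> 'a \<Rightarrow> 'a"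
  where "peirce1 p x = 2 *\<^sub>R (p \<odot> (p \<odot> x)) - p \<odot> x"

definition peirce_half :: "'a \<Rightarrow> 'a \<Rightarrow> 'a"
  where "peirce_half p x = 4 *\<^sub>R (p \<odot> x - p \<odot> (p \<odot> x))"

definition peirce0 :: "'a \<Rightarrow> 'a \<Rightarrow> 'a"
  where "peirce0 p x = x - 3 *\<^sub>R (p \<odot> x) + 2 *\<^sub>R (p \<odot> (p \<odot> x))"

lemma peirce_mem [simp]:
  "peirce1 p x \<in> A" "peirce_half p x \<in> A" "x \<in> A \<Longrightarrow> peirce0 p x \<in> A"
  by (auto simp: peirce1_def peirce_half_def peirce0_def)

lemma linear_peirce1: "linear (peirce1 p)"
  by (rule linearI) (simp_all add: peirce1_def bilin algebra_simps)

lemma linear_peirce0: "linear (peirce0 p)"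
  by (rule linearI) (simp_all add: peirce0_def bilin algebra_simps)

lemma peirce_sum: "x \<in> A \<Longrightarrow> x = peirce1 p x + peirce_half p x + peirce0 p x"
  by (rule A_eqI) (auto simp: peirce1_def peirce_half_def peirce0_def state_lin)

lemma
  assumes "idem p" "x \<in> A"
  shows peirce1_eigen: "p \<odot> peirce1 p x = peirce1 p x"
    and peirce_half_eigen: "p \<odot> peirce_half p x = (1/2) *\<^sub>R peirce_half p x"
    and peirce0_eigen: "p \<odot> peirce0 p x = 0"
proof -
  have *: "\<phi> (p \<odot> (p \<odot> (p \<odot> x))) = (3 * \<phi> (p \<odot> (p \<odot> x)) - \<phi> (p \<odot> x)) / 2" if "\<phi> \<in> S" for \<phi>
    using arg_cong[OF idem_cubic[OF assms], of \<phi>] that by (simp add: state_lin)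
  show "p \<odot> peirce1 p x = peirce1 p x"
    by (rule A_eqI) (use assms in \<open>auto simp: * peirce1_def state_lin bilin\<close>)
  show "p \<odot> peirce_half p x = (1/2) *\<^sub>R peirce_half p x"
    by (rule A_eqI) (use assms in \<open>auto simp: * peirce_half_def state_lin bilin field_simps\<close>)
  show "p \<odot> peirce0 p x = 0"
    by (rule A_eqI) (use assms in \<open>auto simp: * peirce0_def state_lin bilin field_simps\<close>)
qed

text \<open>Multiplication by \<open>u - p\<close> is the identity minus multiplication by
  \<open>p\<close>, which swaps the eigenvalues 1 and 0.\<close>

lemma peirce1_compl: "x \<in> A \<Longrightarrow> p \<in> A \<Longrightarrow> peirce1 (u - p) x = peirce0 p x"
  by (rule A_eqI) (auto simp: peirce1_def peirce0_def state_lin bilin)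

text \<open>If \<open>I < 0\<close> is the infimum of \<open>b\<close> over the states, then at a state \<open>\<phi>\<close> nearly attaining it
  \<open>\<phi> ((b - I)\<^sup>2)\<close> is nearly \<open>0\<close>, so by Cauchy-Schwarz \<open>p \<odot> b\<close> has nearly the value \<open>I \<cdot> \<phi> p\<close> there.\<close>

lemma pos_resolvent:
  assumes p: "idem p" and b: "b \<in> A" and e: "0 < \<epsilon>" "\<epsilon> < 1"
    and pos: "pos (b - \<epsilon> *\<^sub>R (p \<odot> b))"
  shows "pos b"
proof (rule ccontr)
  assume "\<not> pos b"
  then obtain \<psi> where \<psi>: "\<psi> \<in> S" "\<psi> b < 0" by (auto simp: pos_def not_le)
  obtain k0 where k0: "\<And>\<phi>. \<phi> \<in> S \<Longrightarrow> \<bar>\<phi> b\<bar> \<le> k0" using bounded_on_states_pos[OF b] by metis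
  define I where "I = (INF \<phi>\<in>S. \<phi> b)"
  have bdd: "bdd_below ((\<lambda>\<phi>. \<phi> b) ` S)"
    by (rule bdd_belowI2[of _ "- k0"]) (use k0 in fastforce)
  have I_le: "I \<le> \<phi> b" if "\<phi> \<in> S" for \<phi>
    unfolding I_def by (rule cINF_lower[OF bdd that])
  have I: "I < 0" using I_le[OF \<psi>(1)] \<psi>(2) by linarith
  define c where "c = b - I *\<^sub>R u"
  define k where "k = k0 - I"
  have k0_nn: "0 \<le> k0" using k0[OF \<psi>(1)] by linarith
  have k: "k > 0" using I k0_nn by (simp add: k_def)
  have cA: "c \<in> A" and c: "pos c" "\<And>\<phi>. \<phi> \<in> S \<Longrightarrow> \<phi> c \<le> k"
    using b I_le k0 by (auto simp: c_def k_def pos_def state_lin abs_le_iff)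
  define g where "g = - (1 - \<epsilon>) * I"
  have g: "g > 0" using I e mult_pos_neg[of "1 - \<epsilon>" I] by (simp add: g_def algebra_simps)
  \<comment> \<open>With this choice both errors, \<open>\<delta>\<close> itself and the
    Cauchy-Schwarz bound \<open>sqrt (k * \<delta>)\<close> for \<open>p \<odot> c\<close>, are at
    most \<open>g / 3\<close>; together they cannot compensate the gap \<open>g\<close>.\<close>
  define \<delta> where "\<delta> = min (g / 3) (g\<^sup>2 / (9 * k))"
  have \<delta>: "0 < \<delta>" "\<delta> \<le> g / 3" "k * \<delta> \<le> (g / 3)\<^sup>2"
  proof -
    show "0 < \<delta>" "\<delta> \<le> g / 3" using g k by (auto simp: \<delta>_def)
    have "\<delta> \<le> g\<^sup>2 / (9 * k)" by (simp add: \<delta>_def)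
    then have "k * \<delta> \<le> k * (g\<^sup>2 / (9 * k))" using k by (intro mult_left_mono) auto
    then show "k * \<delta> \<le> (g / 3)\<^sup>2" using k by (simp add: power2_eq_square field_simps)
  qed
  have "\<exists>\<phi>\<in>S. \<phi> b < I + \<delta>"
    using cInf_lessD[of "(\<lambda>\<phi>. \<phi> b) ` S" "I + \<delta>"] \<psi>(1) \<delta>(1) by (auto simp: I_def)
  then obtain \<phi> where \<phi>: "\<phi> \<in> S" "\<phi> b < I + \<delta>" by blast
  have pc: "(\<phi> (p \<odot> c))\<^sup>2 \<le> (g / 3)\<^sup>2"
  proof -
    have "(\<phi> (p \<odot> c))\<^sup>2 \<le> \<phi> (p \<odot> p) * \<phi> (c \<odot> c)" by (rule cauchy_schwarz[OF \<phi>(1)])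
    also have "\<dots> \<le> 1 * \<phi> (c \<odot> c)"
      using idem_state[OF p \<phi>(1)] p square_nonneg[OF \<phi>(1)] by (intro mult_right_mono) (auto simp: idem_def)
    also have "\<dots> \<le> k * \<phi> c" using pos_square_le[OF cA c(1) _ \<phi>(1), of k] c(2) by simp
    also have "\<dots> \<le> k * \<delta>" using \<phi> k by (intro mult_left_mono) (auto simp: c_def state_lin)
    finally show ?thesis using \<delta>(3) by linarith
  qed
  then have pc: "\<bar>\<phi> (p \<odot> c)\<bar> \<le> g / 3" using g by (simp add: power2_le_iff_abs_le)
  have "p \<odot> b = p \<odot> c + I *\<^sub>R p" using p by (simp add: c_def bilin)
  then have "\<phi> (b - \<epsilon> *\<^sub>R (p \<odot> b)) = \<phi> b - \<epsilon> * \<phi> (p \<odot> c) - \<epsilon> * I * \<phi> p"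
    using \<phi>(1) by (simp add: state_lin algebra_simps)
  moreover have "\<epsilon> * \<phi> (p \<odot> c) \<ge> - (g / 3)"
  proof -
    have "\<bar>\<epsilon> * \<phi> (p \<odot> c)\<bar> \<le> 1 * (g / 3)" unfolding abs_mult using e pc by (intro mult_mono) auto
    then show ?thesis by linarith
  qed
  moreover have "\<epsilon> * I * \<phi> p \<ge> \<epsilon> * I * 1"
    using idem_state[OF p \<phi>(1)] e I by (intro mult_left_mono_neg) (auto intro: mult_nonneg_nonpos)
  moreover have "0 \<le> \<phi> (b - \<epsilon> *\<^sub>R (p \<odot> b))" using pos \<phi>(1) by (simp add: pos_def)
  ultimately have "0 \<le> (1 - \<epsilon>) * I + \<delta> + g / 3"
    using \<phi>(2) by (simp add: algebra_simps)
  moreover have "(1 - \<epsilon>) * I = - g" by (simp add: g_def algebra_simps)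
  ultimately show False using \<delta>(2) g by linarith
qed

lemma peirce1_pos:
  assumes p: "idem p" and a: "a \<in> A" "pos a"
  shows "pos (peirce1 p a)"
  unfolding pos_def
proof
  fix \<phi> assume \<phi>: "\<phi> \<in> S"
  let ?m = "2 * \<bar>\<phi> (peirce_half p a)\<bar> + \<bar>\<phi> (peirce0 p a)\<bar>"
  have *: "0 \<le> \<phi> (peirce1 p a) + \<eta> * ?m" if \<eta>: "0 < \<eta>" "\<eta> < 1" for \<eta> :: real
  proof -
    define \<epsilon> where "\<epsilon> = 1 - \<eta>"
    define r where "r = 1 / (1 - \<epsilon> / 2)"
    have e: "0 < \<epsilon>" "\<epsilon> < 1" using \<eta> by (auto simp: \<epsilon>_def)
    have r: "0 \<le> r" "r \<le> 2" using e by (auto simp: r_def field_simps)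
    have "(1 - \<epsilon> / 2) * r = 1" using e by (simp add: r_def)
    then have r3: "r - \<epsilon> / 2 * r = 1" by (simp add: algebra_simps)
    \<comment> \<open>This is the resolvent of multiplication by \<open>p\<close> applied to
      \<open>a\<close>: its factors on the Peirce spaces for 1, 1/2 and 0 are
      \<open>1 / (1 - \<epsilon>)\<close>, \<open>1 / (1 - \<epsilon> / 2)\<close> and 1. Only the
      first blows up, so multiplication by \<open>\<eta>\<close> isolates \<open>peirce1 p a\<close>
      for small \<open>\<eta>\<close>.\<close>
    define b where "b = (1 / \<eta>) *\<^sub>R peirce1 p a + r *\<^sub>R peirce_half p a + peirce0 p a"
    have bA: "b \<in> A" using a by (simp add: b_def)
    have pb: "p \<odot> b = (1 / \<eta>) *\<^sub>R peirce1 p a + (r / 2) *\<^sub>R peirce_half p a"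
      using p a by (simp add: b_def bilin peirce1_eigen peirce_half_eigen peirce0_eigen)
    have "b - \<epsilon> *\<^sub>R (p \<odot> b) = a"
    proof (rule A_eqI)
      fix \<psi> assume \<psi>: "\<psi> \<in> S"
      have "\<psi> a = \<psi> (peirce1 p a) + \<psi> (peirce_half p a) + \<psi> (peirce0 p a)"
        using peirce_sum[OF a(1), of p] \<psi> by (metis state_add)
      moreover have "t * (1 / \<eta>) - \<epsilon> * (t * (1 / \<eta>)) = t" for t
      proof -
        have "t * (1 / \<eta>) - \<epsilon> * (t * (1 / \<eta>)) = \<eta> * (t * (1 / \<eta>))"
          unfolding \<epsilon>_def by (simp only: left_diff_distrib mult_1_left)
        then show ?thesis using \<eta> by simp
      qed
      note this[of "\<psi> (peirce1 p a)"]
      moreover have "\<psi> (peirce_half p a) * r - \<epsilon> * (\<psi> (peirce_half p a) * (r / 2)) = \<psi> (peirce_half p a)"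
        using arg_cong[OF r3, of "\<lambda>t. t * \<psi> (peirce_half p a)"] by (simp add: algebra_simps)
      ultimately show "\<psi> (b - \<epsilon> *\<^sub>R (p \<odot> b)) = \<psi> a"
        unfolding pb using \<psi> by (simp add: b_def state_lin algebra_simps)
    qed (use a bA in auto)
    then have "pos b" using pos_resolvent[OF p bA e] a by simp
    then have "0 \<le> \<eta> * \<phi> b" using \<phi> \<eta> by (simp add: pos_def)
    also have "\<eta> * \<phi> b = \<phi> (peirce1 p a) + \<eta> * (r * \<phi> (peirce_half p a)) + \<eta> * \<phi> (peirce0 p a)"
      using \<phi> \<eta> by (simp add: b_def state_lin field_simps)
    also have "\<dots> \<le> \<phi> (peirce1 p a) + \<eta> * (2 * \<bar>\<phi> (peirce_half p a)\<bar>) + \<eta> * \<bar>\<phi> (peirce0 p a)\<bar>"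
    proof (intro add_mono mult_left_mono order.refl)
      have "r * \<phi> (peirce_half p a) \<le> r * \<bar>\<phi> (peirce_half p a)\<bar>" using r by (intro mult_left_mono) auto
      also have "\<dots> \<le> 2 * \<bar>\<phi> (peirce_half p a)\<bar>" using r by (intro mult_right_mono) auto
      finally show "r * \<phi> (peirce_half p a) \<le> 2 * \<bar>\<phi> (peirce_half p a)\<bar>" .
    qed (use \<eta> in auto)
    finally show ?thesis by (simp add: algebra_simps)
  qed
  show "0 \<le> \<phi> (peirce1 p a)"
  proof (rule ccontr)
    assume n: "\<not> 0 \<le> \<phi> (peirce1 p a)"
    let ?x = "\<phi> (peirce1 p a)"
    \<comment> \<open>Chosen so that the error \<open>\<eta> * ?m\<close> is at most
      \<open>- ?x / 2\<close>; the summand 1 keeps the denominator positive.\<close>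
    define \<eta> where "\<eta> = min (1/2) (- ?x / (2 * (?m + 1)))"
    have m: "?m \<ge> 0" by simp
    have "\<eta> > 0" using n m by (auto simp: \<eta>_def intro!: divide_neg_pos)
    moreover have "\<eta> < 1" by (simp add: \<eta>_def)
    ultimately have "0 \<le> ?x + \<eta> * ?m" by (rule *)
    also have "\<eta> * ?m \<le> (- ?x / (2 * (?m + 1))) * (?m + 1)"
      using m n \<open>\<eta> > 0\<close> by (intro mult_mono) (auto simp: \<eta>_def intro!: divide_nonpos_pos)
    also have "\<dots> = - ?x / 2" using m by (simp add: field_simps)
    finally show False using n by simp
  qed
qed

lemma peirce0_pos: "idem p \<Longrightarrow> a \<in> A \<Longrightarrow> pos a \<Longrightarrow> pos (peirce0 p a)"
  using peirce1_pos[OF idem_compl, of p a] by (simp add: peirce1_compl)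

section \<open>Peirce multiplication rules\<close>

lemma idem_polarised:
  assumes p: "idem p" and yz: "y \<in> A" "z \<in> A"
  shows "4 *\<^sub>R (p \<odot> (y \<odot> z)) + 8 *\<^sub>R ((p \<odot> y) \<odot> (p \<odot> z))
    = 2 *\<^sub>R (p \<odot> (p \<odot> (y \<odot> z))) + 2 *\<^sub>R (p \<odot> (y \<odot> (p \<odot> z) + z \<odot> (p \<odot> y)))
      + 2 *\<^sub>R (y \<odot> (p \<odot> (p \<odot> z))) + 2 *\<^sub>R (z \<odot> (p \<odot> (p \<odot> y))) + y \<odot> (p \<odot> z) + z \<odot> (p \<odot> y)"
    (is "?l = ?r")
proof (rule A_eqI)
  fix \<phi> assume \<phi>: "\<phi> \<in> S"
  have yz': "y + z \<in> A" using yz by simp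
  note * = arg_cong[OF idem_linearised2[OF p yz(1)], of \<phi>] arg_cong[OF idem_linearised2[OF p yz(2)], of \<phi>]
    arg_cong[OF idem_linearised2[OF p yz'], of \<phi>]
  show "\<phi> ?l = \<phi> ?r"
    using * \<phi> by (simp add: state_lin bilin comm[of z y] comm[of "p \<odot> z" "p \<odot> y"])
qed (use yz in auto)

text \<open>Write \<open>T\<close> for multiplication by \<open>p\<close> and
  \<open>v = a \<odot> b\<close>. The polarised identity collapses to \<open>T (T v) = v\<close>,
  and the cubic equation then leaves only \<open>T v = v\<close>.\<close>

lemma peirce_11:
  assumes p: "idem p" and ab: "a \<in> A" "b \<in> A" "p \<odot> a = a" "p \<odot> b = b"
  shows "p \<odot> (a \<odot> b) = a \<odot> b"
proof (rule A_eqI)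
  fix \<phi> assume \<phi>: "\<phi> \<in> S"
  have "\<psi> (p \<odot> (p \<odot> (a \<odot> b))) = \<psi> (a \<odot> b)" if "\<psi> \<in> S" for \<psi>
    using arg_cong[OF idem_polarised[OF p ab(1,2)], of \<psi>] that ab by (simp add: state_lin bilin comm[of b a])
  then have "p \<odot> (p \<odot> (a \<odot> b)) = a \<odot> b"
    by (rule A_eqI[rotated 2]) auto
  then show "\<phi> (p \<odot> (a \<odot> b)) = \<phi> (a \<odot> b)"
    using arg_cong[OF idem_cubic[OF p prd_mem[of a b]], of \<phi>] \<phi> by (simp add: state_lin)
qed auto

text \<open>With \<open>T\<close> and \<open>v = a \<odot> b\<close> as before, the polarised
  identity reads \<open>2 T (T v) - 2 T v + 3 v = 0\<close>. The polynomial
  \<open>2 t^2 - 2 t + 3\<close> has no root among 0, 1/2, 1, so the cubic equation forces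
  \<open>v = 0\<close>; the steps carry out the elimination.\<close>

lemma peirce_10:
  assumes p: "idem p" and ab: "a \<in> A" "b \<in> A" "p \<odot> a = a" "p \<odot> b = 0"
  shows "a \<odot> b = 0"
proof (rule separating)
  let ?v = "a \<odot> b"
  have 1: "2 * \<psi> (p \<odot> (p \<odot> ?v)) = 2 * \<psi> (p \<odot> ?v) - 3 * \<psi> ?v" if "\<psi> \<in> S" for \<psi>
    using arg_cong[OF idem_polarised[OF p ab(1,2)], of \<psi>] that ab by (simp add: state_lin bilin comm[of b a])
  have v: "2 *\<^sub>R (p \<odot> (p \<odot> ?v)) = 2 *\<^sub>R (p \<odot> ?v) - 3 *\<^sub>R ?v"
    by (rule A_eqI) (auto simp: state_lin 1)
  fix \<phi> assume \<phi>: "\<phi> \<in> S"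
  have 3: "2 * \<psi> (p \<odot> ?v) = \<psi> ?v" if \<psi>: "\<psi> \<in> S" for \<psi>
  proof -
    have "\<psi> (p \<odot> (2 *\<^sub>R (p \<odot> (p \<odot> ?v)))) = \<psi> (p \<odot> (2 *\<^sub>R (p \<odot> ?v) - 3 *\<^sub>R ?v))"
      by (simp only: v)
    then have "2 * \<psi> (p \<odot> (p \<odot> (p \<odot> ?v))) = 2 * \<psi> (p \<odot> (p \<odot> ?v)) - 3 * \<psi> (p \<odot> ?v)"
      using \<psi> by (simp add: bilin state_lin)
    moreover have "2 * \<psi> (p \<odot> (p \<odot> (p \<odot> ?v))) = 3 * \<psi> (p \<odot> (p \<odot> ?v)) - \<psi> (p \<odot> ?v)"
      using arg_cong[OF idem_cubic[OF p prd_mem[of a b]], of \<psi>] \<psi> by (simp add: state_lin)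
    ultimately show ?thesis using 1[OF \<psi>] by linarith
  qed
  have "2 *\<^sub>R (p \<odot> ?v) = ?v" by (rule A_eqI) (auto simp: state_lin 3)
  then have "2 *\<^sub>R (p \<odot> (p \<odot> ?v)) = p \<odot> ?v" by (metis scale_right)
  then have "2 * \<phi> (p \<odot> (p \<odot> ?v)) = \<phi> (p \<odot> ?v)" using \<phi> by (metis state_scale)
  then show "\<phi> ?v = 0" using 1[OF \<phi>] 3[OF \<phi>] by linarith
qed auto

text \<open>The algebra alone leaves a component of \<open>a \<odot> v\<close> in the zero space; it is killed by the
  Cauchy-Schwarz inequality for the functionals \<open>\<phi> \<circ> peirce0 p\<close>, which vanish on \<open>p\<close>.\<close>

lemma peirce0_mult_eq_0:
  assumes p: "idem p" and a: "a \<in> A" "p \<odot> a = a" and w: "w \<in> A"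
  shows "peirce0 p (a \<odot> w) = 0"
proof (rule separating)
  fix \<phi> assume \<phi>: "\<phi> \<in> S"
  obtain k where k: "0 < k" "\<And>\<phi>. \<phi> \<in> S \<Longrightarrow> \<bar>\<phi> a\<bar> \<le> k" using bounded_on_states_pos[OF a(1)] by metis
  define \<psi> where "\<psi> x = \<phi> (peirce0 p x)" for x
  have lin: "linear \<psi>"
    using linear_compose[OF linear_peirce0 linear_state[OF \<phi>], of p] by (simp add: o_def \<psi>_def[abs_def])
  have psi_pos: "0 \<le> \<psi> x" if "x \<in> A" "pos x" for x
    using peirce0_pos[OF p that] \<phi> by (simp add: \<psi>_def pos_def)
  \<comment> \<open>The element \<open>a\<close> need not be positive. Projecting
    \<open>k u + a\<close> gives the positive element \<open>k p + a\<close> of the same Peirce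
    space, and the shift is harmless because \<open>\<psi>\<close> vanishes on all products with
    \<open>p\<close>.\<close>
  have "pos (k *\<^sub>R u + a)" using k by (force simp: pos_def state_lin abs_le_iff)
  from peirce1_pos[OF p _ this] have "pos (peirce1 p (k *\<^sub>R u + a))" using a by simp
  moreover have pp: "p \<odot> p = p" using p by (simp add: idem_def)
  have "peirce1 p (k *\<^sub>R u + a) = k *\<^sub>R p + a"
    by (rule A_eqI) (use a p pp in \<open>auto simp: peirce1_def bilin state_lin\<close>)
  moreover define b where "b = k *\<^sub>R p + a"
  ultimately have b: "pos b" "b \<in> A" "p \<odot> b = b" using a p pp by (auto simp: bilin)
  have bk: "\<theta> b \<le> 2 * k" if "\<theta> \<in> S" for \<theta>
  proof -
    have "k * \<theta> p \<le> k * 1" using idem_state[OF p that] k(1) by (intro mult_left_mono) auto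
    then show ?thesis using k(2)[OF that] that by (auto simp: b_def state_lin)
  qed
  have pb0: "\<psi> (p \<odot> x) = 0" if "x \<in> A" for x
    using arg_cong[OF idem_cubic[OF p that], of \<phi>] \<phi> by (simp add: \<psi>_def peirce0_def state_lin bilin)
  have "pos ((2 * k) *\<^sub>R b - b \<odot> b)"
    using pos_square_le[OF b(2) b(1), of "2 * k"] bk by (simp add: pos_def state_lin)
  from psi_pos[OF _ this] have "\<psi> (b \<odot> b) \<le> 2 * k * \<psi> b"
    using b lin by (simp add: linear_diff linear_cmul)
  also have "\<psi> b = 0" using pb0[OF b(2)] b by simp
  finally have "\<psi> (b \<odot> b) \<le> 0" by simp
  then have bb: "\<psi> (b \<odot> b) = 0" using psi_pos[of "b \<odot> b"] by simp
  have "(\<psi> (b \<odot> w))\<^sup>2 \<le> \<psi> (b \<odot> b) * \<psi> (w \<odot> w)"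
    by (rule cauchy_schwarz_general[OF lin]) (simp add: psi_pos)
  then have "\<psi> (b \<odot> w) = 0" using bb by simp
  moreover have "\<psi> (b \<odot> w) = k * \<psi> (p \<odot> w) + \<psi> (a \<odot> w)"
    using lin by (simp add: b_def bilin linear_add linear_cmul)
  ultimately show "\<phi> (peirce0 p (a \<odot> w)) = 0" using pb0[OF w] by (simp add: \<psi>_def)
qed auto

text \<open>The polarised identity rules out a component of \<open>a \<odot> v\<close> for the
  eigenvalue 1, and \<open>peirce0_mult_eq_0\<close> rules out one for 0.\<close>

lemma peirce_1_half:
  assumes p: "idem p" and a: "a \<in> A" "p \<odot> a = a" and v: "v \<in> A" "p \<odot> v = (1/2) *\<^sub>R v"
  shows "p \<odot> (a \<odot> v) = (1/2) *\<^sub>R (a \<odot> v)"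
proof (rule A_eqI)
  fix \<phi> assume \<phi>: "\<phi> \<in> S"
  have "2 * \<phi> (p \<odot> (p \<odot> (a \<odot> v))) = \<phi> (p \<odot> (a \<odot> v))"
    using arg_cong[OF idem_polarised[OF p a(1) v(1)], of \<phi>] \<phi> a v by (simp add: state_lin bilin comm[of v a])
  moreover have "\<phi> (peirce0 p (a \<odot> v)) = 0" using peirce0_mult_eq_0[OF p a v(1)] \<phi> by simp
  ultimately show "\<phi> (p \<odot> (a \<odot> v)) = \<phi> ((1/2) *\<^sub>R (a \<odot> v))"
    using \<phi> by (simp add: peirce0_def state_lin)
qed auto

text \<open>Multiplication by \<open>a\<close> maps each Peirce space of \<open>p\<close> into
  itself (the zero space to 0), and multiplication by \<open>p\<close> is a scalar on each.\<close>

lemma idem_commutes_peirce1: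
  assumes p: "idem p" and a: "a \<in> A" "p \<odot> a = a" and x: "x \<in> A"
  shows "p \<odot> (a \<odot> x) = a \<odot> (p \<odot> x)"
proof -
  let ?x1 = "peirce1 p x" and ?xh = "peirce_half p x" and ?x0 = "peirce0 p x"
  have *: "x = ?x1 + ?xh + ?x0" by (rule peirce_sum[OF x])
  note e = peirce1_eigen[OF p x] peirce_half_eigen[OF p x] peirce0_eigen[OF p x]
  have "p \<odot> (a \<odot> ?x1) = a \<odot> (p \<odot> ?x1)" using peirce_11[OF p a(1) _ a(2) e(1)] by (simp add: e)
  moreover have "p \<odot> (a \<odot> ?xh) = a \<odot> (p \<odot> ?xh)" using peirce_1_half[OF p a _ e(2)] by (simp add: e bilin)
  moreover have "p \<odot> (a \<odot> ?x0) = a \<odot> (p \<odot> ?x0)" using peirce_10[OF p a(1) _ a(2) e(3)] x by (simp add: e)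
  ultimately have "p \<odot> (a \<odot> (?x1 + ?xh + ?x0)) = a \<odot> (p \<odot> (?x1 + ?xh + ?x0))"
    by (simp only: bilin)
  then show ?thesis using * by simp
qed

lemma idem_commutes_peirce0:
  assumes p: "idem p" and a: "a \<in> A" "p \<odot> a = 0" and x: "x \<in> A"
  shows "p \<odot> (a \<odot> x) = a \<odot> (p \<odot> x)"
  using idem_commutes_peirce1[OF idem_compl[OF p] a(1) _ x] a x by (simp add: bilin)

text \<open>The full linearisation of the Jordan identity: the sum of the commutators of the
  multiplications by \<open>x\<close> and \<open>y \<odot> z\<close> over the three cyclic choices,
  applied to \<open>w\<close>. It is symmetric in \<open>x\<close>, \<open>y\<close>,
  \<open>z\<close>, and at \<open>x = y = z\<close> it is three times the Jordan defect. Linearity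
  in \<open>x\<close> and \<open>y\<close> separately is what lets identities at idempotents extend
  to their linear combinations.\<close>

definition jordan_form :: "'a \<Rightarrow> 'a \<Rightarrow> 'a \<Rightarrow> 'a \<Rightarrow> 'a"
  where "jordan_form x y z w = (x \<odot> ((y \<odot> z) \<odot> w) - (y \<odot> z) \<odot> (x \<odot> w))
    + (y \<odot> ((x \<odot> z) \<odot> w) - (x \<odot> z) \<odot> (y \<odot> w)) + (z \<odot> ((x \<odot> y) \<odot> w) - (x \<odot> y) \<odot> (z \<odot> w))"

lemma jordan_form_mem [simp]: "jordan_form x y z w \<in> A"
  by (simp add: jordan_form_def)

lemma jordan_form_sym: "jordan_form x y z w = jordan_form y x z w"
  by (simp add: jordan_form_def comm[of y x])

lemma jordan_form_lin:
  "jordan_form (x + x') y z w = jordan_form x y z w + jordan_form x' y z w"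
  "jordan_form (x - x') y z w = jordan_form x y z w - jordan_form x' y z w"
  "jordan_form (c *\<^sub>R x) y z w = c *\<^sub>R jordan_form x y z w"
  "jordan_form y (x + x') z w = jordan_form y x z w + jordan_form y x' z w"
  "jordan_form y (x - x') z w = jordan_form y x z w - jordan_form y x' z w"
  "jordan_form y (c *\<^sub>R x) z w = c *\<^sub>R jordan_form y x z w"
  by (simp_all add: jordan_form_def bilin algebra_simps)

text \<open>Since \<open>p \<odot> z = (z1 - z0 + z) / 2\<close> with the outer Peirce components
  \<open>z1\<close> and \<open>z0\<close> of \<open>z\<close>, which commute with \<open>p\<close>
  as operators, twice the commutator of \<open>p\<close> and \<open>p \<odot> z\<close> is that of
  \<open>p\<close> and \<open>z\<close>, and it cancels against the third term.\<close>

lemma jordan_form_idem: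
  assumes p: "idem p" and z: "z \<in> A" and w: "w \<in> A"
  shows "jordan_form p p z w = 0"
proof -
  let ?z1 = "peirce1 p z" and ?z0 = "peirce0 p z"
  have m: "?z1 \<in> A" "?z0 \<in> A" using z by auto
  note e = peirce1_eigen[OF p z] peirce0_eigen[OF p z]
  have pp: "p \<odot> p = p" using p by (simp add: idem_def)
  have pz: "p \<odot> z = (1/2) *\<^sub>R (?z1 - ?z0 + z)"
    by (rule A_eqI) (use z in \<open>auto simp: peirce1_def peirce0_def state_lin\<close>)
  have "p \<odot> (?z1 \<odot> w) = ?z1 \<odot> (p \<odot> w)" "p \<odot> (?z0 \<odot> w) = ?z0 \<odot> (p \<odot> w)"
    using idem_commutes_peirce1[OF p m(1) e(1) w] idem_commutes_peirce0[OF p m(2) e(2) w] by auto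
  then show ?thesis unfolding jordan_form_def pp pz
    by (intro A_eqI) (auto simp: bilin state_lin)
qed

lemma jordan_form_unit:
  assumes "x \<in> A" "z \<in> A" "w \<in> A"
  shows "jordan_form u x z w = 0"
  using assms by (simp add: jordan_form_def)

text \<open>Polarisation of \<open>jordan_form_idem\<close>. For idempotents \<open>a\<close> and
  \<open>b\<close>, idempotence of \<open>a + b\<close> is the form in which orthogonality
  \<open>a \<odot> b = 0\<close> is used.\<close>

lemma jordan_form_orthogonal:
  assumes "idem a" "idem b" "idem (a + b)" and z: "z \<in> A" and w: "w \<in> A"
  shows "jordan_form a b z w = 0"
proof (rule separating)
  fix \<phi> assume \<phi>: "\<phi> \<in> S"
  show "\<phi> (jordan_form a b z w) = 0"
    using arg_cong[OF jordan_form_idem[OF assms(3) z w], of \<phi>] jordan_form_idem[OF assms(1) z w]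
      jordan_form_idem[OF assms(2) z w] \<phi>
    by (simp add: jordan_form_lin state_lin jordan_form_sym[of b a])
qed simp

lemma jordan_form_bound:
  assumes "x \<in> A" "y \<in> A" "z \<in> A" "w \<in> A"
    and "\<And>\<phi>. \<phi> \<in> S \<Longrightarrow> \<bar>\<phi> x\<bar> \<le> a" "\<And>\<phi>. \<phi> \<in> S \<Longrightarrow> \<bar>\<phi> y\<bar> \<le> b"
    "\<And>\<phi>. \<phi> \<in> S \<Longrightarrow> \<bar>\<phi> z\<bar> \<le> c" "\<And>\<phi>. \<phi> \<in> S \<Longrightarrow> \<bar>\<phi> w\<bar> \<le> d" and \<phi>: "\<phi> \<in> S"
  shows "\<bar>\<phi> (jordan_form x y z w)\<bar> \<le> 6 * (a * b * c * d)"
proof -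
  have t1: "\<bar>\<phi> (x \<odot> ((y \<odot> z) \<odot> w))\<bar> \<le> a * ((b * c) * d)"
   and t2: "\<bar>\<phi> ((y \<odot> z) \<odot> (x \<odot> w))\<bar> \<le> (b * c) * (a * d)"
   and t3: "\<bar>\<phi> (y \<odot> ((x \<odot> z) \<odot> w))\<bar> \<le> b * ((a * c) * d)"
   and t4: "\<bar>\<phi> ((x \<odot> z) \<odot> (y \<odot> w))\<bar> \<le> (a * c) * (b * d)"
   and t5: "\<bar>\<phi> (z \<odot> ((x \<odot> y) \<odot> w))\<bar> \<le> c * ((a * b) * d)"
   and t6: "\<bar>\<phi> ((x \<odot> y) \<odot> (z \<odot> w))\<bar> \<le> (a * b) * (c * d)"
    by (intro submult prd_mem assms; assumption)+
  show ?thesis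
    using t1 t2 t3 t4 t5 t6 \<phi> by (simp add: jordan_form_def state_lin mult_ac)
qed

end

section \<open>Spectral approximation and the Jordan identity\<close>

text \<open>Kept apart from the previous locale because \<open>seq_continuous\<close> for the
  symmetrised product follows from commutativity, whose proof already uses the Peirce
  projections.\<close>

locale complete_power_assoc_algebra = power_assoc_algebra +
  assumes seq_complete: "\<lbrakk>\<And>n::nat. X n \<in> A; \<And>n \<phi>. \<phi> \<in> S \<Longrightarrow> \<bar>\<phi> (X n)\<bar> \<le> k;
      \<And>\<phi>. \<phi> \<in> S \<Longrightarrow> convergent (\<lambda>n. \<phi> (X n))\<rbrakk>
      \<Longrightarrow> \<exists>x\<in>A. \<forall>\<phi>\<in>S. (\<lambda>n. \<phi> (X n)) \<longlonglongrightarrow> \<phi> x"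
    and seq_continuous: "\<lbrakk>\<And>n::nat. X n \<in> A; x \<in> A; \<And>\<phi>. \<phi> \<in> S \<Longrightarrow> (\<lambda>n. \<phi> (X n)) \<longlonglongrightarrow> \<phi> x; y \<in> A; \<phi> \<in> S\<rbrakk>
      \<Longrightarrow> (\<lambda>n. \<phi> (y \<odot> X n)) \<longlonglongrightarrow> \<phi> (y \<odot> x)"
begin

section \<open>Sequentially closed subspaces and the subalgebra generated by one element\<close>

definition wlim :: "(nat \<Rightarrow> 'a) \<Rightarrow> 'a \<Rightarrow> bool"
  where "wlim X x \<longleftrightarrow> (\<forall>\<phi>\<in>S. (\<lambda>n. \<phi> (X n)) \<longlonglongrightarrow> \<phi> x)"

lemma wlim_mult:
  assumes "\<And>n. X n \<in> A" "x \<in> A" "wlim X x" "y \<in> A"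
  shows "wlim (\<lambda>n. y \<odot> X n) (y \<odot> x)"
  unfolding wlim_def by (rule ballI, rule seq_continuous) (use assms in \<open>auto simp: wlim_def\<close>)

definition closed_subspace :: "'a set \<Rightarrow> bool"
  where "closed_subspace Z \<longleftrightarrow> subspace Z \<and> Z \<subseteq> A \<and>
    (\<forall>X z. (\<forall>n::nat. X n \<in> Z) \<longrightarrow> z \<in> A \<longrightarrow> wlim X z \<longrightarrow> z \<in> Z)"

lemma closed_subspaceD:
  assumes "closed_subspace Z"
  shows "subspace Z" "Z \<subseteq> A"
    "\<lbrakk>\<And>n::nat. X n \<in> Z; z \<in> A; wlim X z\<rbrakk> \<Longrightarrow> z \<in> Z"
  using assms unfolding closed_subspace_def by blast+

lemma closed_subspaceI:
  assumes "subspace Z" "Z \<subseteq> A"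
    "\<And>X z. \<lbrakk>\<And>n::nat. X n \<in> Z; z \<in> A; wlim X z\<rbrakk> \<Longrightarrow> z \<in> Z"
  shows "closed_subspace Z"
  using assms unfolding closed_subspace_def by blast

definition powers :: "'a \<Rightarrow> 'a set"
  where "powers x = range (\<lambda>n. ((\<odot>) x ^^ n) u)"

text \<open>A hull rather than the set of limits of polynomials in \<open>x\<close>: limits of
  limits are included automatically, and facts about it are proved by minimality.\<close>

definition gen :: "'a \<Rightarrow> 'a set"
  where "gen x = closed_subspace hull powers x"

lemma power_mem: "((\<odot>) x ^^ n) u \<in> A"
  by (cases n) auto

lemma closed_subspace_A: "closed_subspace A"
  by (intro closed_subspaceI subspace_A) auto

lemma closed_subspace_gen: "closed_subspace (gen x)"
proof -
  have "closed_subspace (\<Inter>T)" if T: "\<forall>Z\<in>T. closed_subspace Z" "T \<noteq> {}" for T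
  proof (rule closed_subspaceI)
    show "subspace (\<Inter>T)" using T closed_subspaceD(1) by (intro subspace_Inter) blast
    show "\<Inter>T \<subseteq> A" using T closed_subspaceD(2) by blast
  next
    fix X z assume X: "\<And>n::nat. X n \<in> \<Inter>T" and z: "z \<in> A" "wlim X z"
    have "z \<in> Z" if Z: "Z \<in> T" for Z
      by (rule closed_subspaceD(3)[of Z X]) (use T X z Z in auto)
    then show "z \<in> \<Inter>T" by blast
  qed
  moreover have "A \<in> {Z. closed_subspace Z \<and> powers x \<subseteq> Z}"
    using closed_subspace_A power_mem by (auto simp: powers_def)
  ultimately show ?thesis unfolding gen_def hull_def
    by (metis (mono_tags, lifting) empty_iff mem_Collect_eq)
qed

lemma gen_subset: "closed_subspace Z \<Longrightarrow> powers x \<subseteq> Z \<Longrightarrow> gen x \<subseteq> Z"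
  unfolding gen_def by (rule hull_minimal)

lemma gen_power: "((\<odot>) x ^^ n) u \<in> gen x"
  unfolding gen_def by (rule hull_inc) (auto simp: powers_def)

lemma gen_mem: "y \<in> gen x \<Longrightarrow> y \<in> A"
  using closed_subspaceD(2)[OF closed_subspace_gen] by blast

lemma gen_unit: "u \<in> gen x"
  using gen_power[of 0 x] by simp

lemma gen_self: "x \<in> A \<Longrightarrow> x \<in> gen x"
  using gen_power[of 1 x] by simp

lemma gen_add: "y \<in> gen x \<Longrightarrow> z \<in> gen x \<Longrightarrow> y + z \<in> gen x"
  and gen_diff: "y \<in> gen x \<Longrightarrow> z \<in> gen x \<Longrightarrow> y - z \<in> gen x"
  and gen_scale: "y \<in> gen x \<Longrightarrow> c *\<^sub>R y \<in> gen x"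
  and gen_zero: "0 \<in> gen x"
  using closed_subspaceD(1)[OF closed_subspace_gen]
  by (auto simp: subspace_add subspace_diff subspace_scale subspace_0)

lemma gen_limit:
  "\<lbrakk>\<And>n::nat. X n \<in> gen x; z \<in> A; wlim X z\<rbrakk> \<Longrightarrow> z \<in> gen x"
  by (rule closed_subspaceD(3)[OF closed_subspace_gen])

definition seq_cont :: "('a \<Rightarrow> 'a) \<Rightarrow> bool"
  where "seq_cont f \<longleftrightarrow> linear f \<and> f ` A \<subseteq> A \<and>
    (\<forall>X x. (\<forall>n. X n \<in> A) \<longrightarrow> x \<in> A \<longrightarrow> wlim X x \<longrightarrow> wlim (\<lambda>n. f (X n)) (f x))"

lemma seq_contD:
  assumes "seq_cont f"
  shows "linear f" "x \<in> A \<Longrightarrow> f x \<in> A"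
    "\<lbrakk>\<And>n. X n \<in> A; x \<in> A; wlim X x\<rbrakk> \<Longrightarrow> wlim (\<lambda>n. f (X n)) (f x)"
  using assms unfolding seq_cont_def by auto

lemma seq_cont_mult: "y \<in> A \<Longrightarrow> seq_cont ((\<odot>) y)"
  by (auto simp: seq_cont_def linear_mult wlim_mult)

lemma seq_cont_compose:
  assumes f: "seq_cont f" and g: "seq_cont g"
  shows "seq_cont (\<lambda>x. f (g x))"
  unfolding seq_cont_def
proof (intro conjI allI impI)
  show "linear (\<lambda>x. f (g x))"
    using linear_compose[OF seq_contD(1)[OF g] seq_contD(1)[OF f]] by (simp add: o_def)
  show "(\<lambda>x. f (g x)) ` A \<subseteq> A"
    using seq_contD(2)[OF f] seq_contD(2)[OF g] by auto
  fix X x assume *: "\<forall>n. X n \<in> A" "x \<in> A" "wlim X x"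
  show "wlim (\<lambda>n. f (g (X n))) (f (g x))"
    by (rule seq_contD(3)[OF f seq_contD(2)[OF g] seq_contD(2)[OF g] seq_contD(3)[OF g]]) (use * in auto)
qed

lemma closed_subspace_vimage:
  assumes f: "seq_cont f" and Z: "closed_subspace Z"
  shows "closed_subspace {b \<in> A. f b \<in> Z}"
proof (rule closed_subspaceI)
  have "{b \<in> A. f b \<in> Z} = A \<inter> f -` Z" by auto
  then show "subspace {b \<in> A. f b \<in> Z}"
    using subspace_inter[OF subspace_A linear_subspace_vimage[OF seq_contD(1)[OF f] closed_subspaceD(1)[OF Z]]]
    by simp
next
  fix X z assume X: "\<And>n::nat. X n \<in> {b \<in> A. f b \<in> Z}" and z: "z \<in> A"
    and lim: "wlim X z"
  have "f z \<in> Z"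
    by (rule closed_subspaceD(3)[OF Z _ seq_contD(2)[OF f z] seq_contD(3)[OF f _ z lim]]) (use X in auto)
  then show "z \<in> {b \<in> A. f b \<in> Z}" using z by simp
qed auto

lemma closed_subspace_eq:
  assumes f: "seq_cont f" and g: "seq_cont g"
  shows "closed_subspace {b \<in> A. f b = g b}"
proof -
  have "seq_cont (\<lambda>b. f b - g b)"
    unfolding seq_cont_def
  proof (intro conjI allI impI)
    show "linear (\<lambda>b. f b - g b)" by (intro linear_compose_sub seq_contD(1) f g)
    show "(\<lambda>b. f b - g b) ` A \<subseteq> A" using seq_contD(2)[OF f] seq_contD(2)[OF g] by auto
    fix X x assume *: "\<forall>n. X n \<in> A" "x \<in> A" "wlim X x"
    then show "wlim (\<lambda>n. f (X n) - g (X n)) (f x - g x)"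
      using seq_contD(3)[OF f, of X x] seq_contD(3)[OF g, of X x]
      by (auto simp: wlim_def state_diff intro!: tendsto_diff)
  qed
  moreover have "closed_subspace {0}"
  proof (rule closed_subspaceI)
    fix X z assume X: "\<And>n::nat. X n \<in> {0}" and z: "z \<in> A" and lim: "wlim X z"
    have "\<phi> z = 0" if "\<phi> \<in> S" for \<phi>
      using lim X that LIMSEQ_unique[of "\<lambda>n. \<phi> (X n)" "\<phi> z" 0] by (simp add: wlim_def)
    then show "z \<in> {0}" using separating[OF z] by blast
  qed (auto simp: subspace_single_0)
  ultimately have "closed_subspace {b \<in> A. f b - g b \<in> {0}}" by (rule closed_subspace_vimage)
  then show ?thesis by simp
qed

text \<open>Only separate continuity is at hand, so there are two rounds: first one factor is a
  power of \<open>x\<close>, then it is arbitrary.\<close>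

lemma gen_mult:
  assumes x: "x \<in> A" and a: "a \<in> gen x" and b: "b \<in> gen x"
  shows "a \<odot> b \<in> gen x"
proof -
  have *: "c \<odot> y \<in> gen x" if "c \<in> powers x" "y \<in> gen x" for c y
  proof -
    have cA: "c \<in> A" using that power_mem by (auto simp: powers_def)
    have "gen x \<subseteq> {b \<in> A. c \<odot> b \<in> gen x}"
      by (rule gen_subset[OF closed_subspace_vimage[OF seq_cont_mult[OF cA] closed_subspace_gen]])
        (use that gen_power power_mem x in \<open>auto simp: powers_def power_assoc\<close>)
    then show ?thesis using that by auto
  qed
  have "gen x \<subseteq> {c \<in> A. b \<odot> c \<in> gen x}"
    by (rule gen_subset[OF closed_subspace_vimage[OF seq_cont_mult[OF gen_mem[OF b]] closed_subspace_gen]])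
      (use *[OF _ b] power_mem in \<open>auto simp: powers_def comm[of b "((\<odot>) x ^^ _) u"]\<close>)
  then have "b \<odot> a \<in> gen x" using a by auto
  then show ?thesis by (simp only: comm[of a b])
qed

text \<open>For powers this is power-associativity. The three arguments are then extended to
  \<open>gen x\<close> one at a time; commutativity rewrites each round so that the argument being
  extended is the innermost right factor, where the expressions are continuous.\<close>

lemma gen_left_commute:
  assumes x: "x \<in> A" and a: "a \<in> gen x" and b: "b \<in> gen x" and c: "c \<in> gen x"
  shows "a \<odot> (b \<odot> c) = b \<odot> (a \<odot> c)"
proof -
  have pA: "p \<in> A" if "p \<in> powers x" for p using that power_mem by (auto simp: powers_def)
  have 1: "p \<odot> (q \<odot> r) = q \<odot> (p \<odot> r)" if "p \<in> powers x" "q \<in> powers x" "r \<in> powers x" for p q r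
    using that x by (clarsimp simp: powers_def power_assoc) (simp only: add.left_commute)
  have 2: "p \<odot> (q \<odot> c) = q \<odot> (p \<odot> c)" if p: "p \<in> powers x" and q: "q \<in> powers x" for p q
  proof -
    have "gen x \<subseteq> {r \<in> A. p \<odot> (q \<odot> r) = q \<odot> (p \<odot> r)}"
      by (rule gen_subset[OF closed_subspace_eq[OF seq_cont_compose[OF seq_cont_mult seq_cont_mult]
              seq_cont_compose[OF seq_cont_mult seq_cont_mult]]])
        (use p q pA 1 in auto)
    then show ?thesis using c by auto
  qed
  have 3: "p \<odot> (b \<odot> c) = b \<odot> (p \<odot> c)" if p: "p \<in> powers x" for p
  proof -
    have "p \<odot> (c \<odot> q) = (p \<odot> c) \<odot> q" if "q \<in> powers x" for q
      using 2[OF p that] by (simp only: comm[of c q] comm[of "p \<odot> c" q])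
    then have "gen x \<subseteq> {q \<in> A. p \<odot> (c \<odot> q) = (p \<odot> c) \<odot> q}"
      by (intro gen_subset[OF closed_subspace_eq[OF seq_cont_compose[OF seq_cont_mult seq_cont_mult] seq_cont_mult]])
        (use p pA gen_mem[OF c] in auto)
    then have "p \<odot> (c \<odot> b) = (p \<odot> c) \<odot> b" using b by auto
    then show ?thesis by (simp only: comm[of c b] comm[of "p \<odot> c" b])
  qed
  have "(b \<odot> c) \<odot> p = b \<odot> (c \<odot> p)" if "p \<in> powers x" for p
    using 3[OF that] by (simp only: comm[of "b \<odot> c" p] comm[of c p])
  then have "gen x \<subseteq> {p \<in> A. (b \<odot> c) \<odot> p = b \<odot> (c \<odot> p)}"
    by (intro gen_subset[OF closed_subspace_eq[OF seq_cont_mult seq_cont_compose[OF seq_cont_mult seq_cont_mult]]])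
      (use pA gen_mem[OF b] gen_mem[OF c] in auto)
  then have "(b \<odot> c) \<odot> a = b \<odot> (c \<odot> a)" using a by auto
  then show ?thesis by (simp only: comm[of "b \<odot> c" a] comm[of c a])
qed

lemma gen_assoc:
  assumes x: "x \<in> A" and a: "a \<in> gen x" and b: "b \<in> gen x" and c: "c \<in> gen x"
  shows "(a \<odot> b) \<odot> c = a \<odot> (b \<odot> c)"
  using gen_left_commute[OF x c a b] by (simp add: comm[of "a \<odot> b" c] comm[of b c])

lemma gen_square_mult:
  assumes x: "x \<in> A" and a: "a \<in> gen x" and b: "b \<in> gen x"
  shows "(a \<odot> b) \<odot> (a \<odot> b) = (a \<odot> a) \<odot> (b \<odot> b)"
proof -
  have "(a \<odot> b) \<odot> (a \<odot> b) = a \<odot> (b \<odot> (a \<odot> b))" by (rule gen_assoc[OF x a b gen_mult[OF x a b]])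
  also have "b \<odot> (a \<odot> b) = a \<odot> (b \<odot> b)" by (rule gen_left_commute[OF x b a b])
  also have "a \<odot> (a \<odot> (b \<odot> b)) = (a \<odot> a) \<odot> (b \<odot> b)" by (rule gen_assoc[OF x a a gen_mult[OF x b b], symmetric])
  finally show ?thesis .
qed

text \<open>The iteration \<open>v \<mapsto> (c + v^2) / 2\<close> with \<open>c = u - b\<close> has
  a limit \<open>w\<close> with \<open>w = (c + w^2) / 2\<close>, that is,
  \<open>(u - w)^2 = b\<close>.\<close>

lemma gen_sqrt:
  assumes x: "x \<in> A" and b: "b \<in> gen x" and b01: "\<And>\<phi>. \<phi> \<in> S \<Longrightarrow> 0 \<le> \<phi> b \<and> \<phi> b \<le> 1"
  obtains d where "d \<in> gen x" "d \<odot> d = b" "\<And>\<phi>. \<phi> \<in> S \<Longrightarrow> 0 \<le> \<phi> d \<and> \<phi> d \<le> 1"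
proof -
  define c where "c = u - b"
  have c: "c \<in> gen x" "\<And>\<phi>. \<phi> \<in> S \<Longrightarrow> \<bar>\<phi> c\<bar> \<le> 1"
    using b b01 by (auto simp: c_def gen_diff gen_unit state_lin)
  define v where "v = rec_nat 0 (\<lambda>_ w. (1/2) *\<^sub>R (c + w \<odot> w))"
  \<comment> \<open>The same iteration for the number 1 in place of \<open>c\<close>. It is monotone
    and bounded, and its increments majorise those of \<open>v\<close> at every state, which gives
    convergence of \<open>v\<close> uniformly in the state.\<close>
  define r :: "nat \<Rightarrow> real" where "r = rec_nat 0 (\<lambda>_ t. (1 + t * t) / 2)"
  have v0: "v 0 = 0" "\<And>n. v (Suc n) = (1/2) *\<^sub>R (c + v n \<odot> v n)" by (simp_all add: v_def)
  have r0: "r 0 = 0" "\<And>n. r (Suc n) = (1 + r n * r n) / 2" by (simp_all add: r_def)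
  have vW: "v n \<in> gen x" for n
    by (induction n) (auto simp: v0 gen_zero intro!: gen_scale gen_add c gen_mult x)
  then have vA: "v n \<in> A" for n by (rule gen_mem)
  have cA: "c \<in> A" using c gen_mem by blast
  have r01: "0 \<le> r n \<and> r n \<le> 1" for n
    by (induction n) (auto simp: r0 mult_le_one)
  have vr: "\<bar>\<phi> (v n)\<bar> \<le> r n" if "\<phi> \<in> S" for n \<phi>
    using that
  proof (induction n arbitrary: \<phi>)
    case (Suc n)
    have "\<bar>\<phi> (v n \<odot> v n)\<bar> \<le> r n * r n" by (rule submult[OF vA vA]) (use Suc in auto)
    then show ?case using c(2)[OF Suc.prems] Suc.prems by (simp add: v0 r0 state_lin)
  qed (simp add: v0 r0)
  have step: "\<bar>\<phi> (v (Suc n) - v n)\<bar> \<le> r (Suc n) - r n" if "\<phi> \<in> S" for n \<phi>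
    using that
  proof (induction n arbitrary: \<phi>)
    case (Suc n)
    have "v (Suc (Suc n)) - v (Suc n) = (1/2) *\<^sub>R ((v (Suc n) - v n) \<odot> (v (Suc n) + v n))"
    proof -
      have "v (Suc (Suc n)) - v (Suc n)
          = (1/2) *\<^sub>R (c + v (Suc n) \<odot> v (Suc n)) - (1/2) *\<^sub>R (c + v n \<odot> v n)"
        by (rule arg_cong2[where f = minus]) (rule v0(2))+
      then show ?thesis by (simp add: bilin comm[of "v n" "v (Suc n)"] algebra_simps)
    qed
    moreover have "\<bar>\<phi> ((v (Suc n) - v n) \<odot> (v (Suc n) + v n))\<bar> \<le> (r (Suc n) - r n) * (r (Suc n) + r n)"
    proof (rule submult)
      show "\<bar>\<psi> (v (Suc n) + v n)\<bar> \<le> r (Suc n) + r n" if "\<psi> \<in> S" for \<psi>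
        using vr[OF that, of n] vr[OF that, of "Suc n"] that by (simp add: state_lin)
    qed (use Suc vA in auto)
    moreover have "(r (Suc n) - r n) * (r (Suc n) + r n) = 2 * (r (Suc (Suc n)) - r (Suc n))"
      unfolding r0(2)[of "Suc n"] by (subst (5) r0(2)) (simp add: algebra_simps)
    ultimately show ?case using Suc.prems by (simp add: state_scale)
  qed (use c in \<open>auto simp: v0 r0 state_lin\<close>)
  have r_mono: "r n \<le> r (Suc n)" for n
    using sum_squares_bound[of "r n" 1] by (simp add: r0 power2_eq_square)
  have diff: "\<bar>\<phi> (v (n + m) - v n)\<bar> \<le> r (n + m) - r n" if "\<phi> \<in> S" for n m \<phi>
  proof (induction m)
    case (Suc m)
    show ?case using step[OF that, of "n + m"] Suc that by (simp add: state_lin)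
  qed (use that in simp)
  have "convergent r"
    using r01 r_mono by (intro Bseq_monoseq_convergent BseqI'[of _ 1])
      (auto simp: monoseq_Suc)
  then obtain l where l: "r \<longlonglongrightarrow> l" by (auto simp: convergent_def)
  have conv: "convergent (\<lambda>n. \<phi> (v n))" if \<phi>: "\<phi> \<in> S" for \<phi>
  proof -
    have "Cauchy (\<lambda>n. \<phi> (v n))"
    proof (rule metric_CauchyI)
      fix e :: real assume e: "e > 0"
      obtain M where M: "\<And>m n. m \<ge> M \<Longrightarrow> n \<ge> M \<Longrightarrow> dist (r m) (r n) < e"
        using metric_CauchyD[OF LIMSEQ_imp_Cauchy[OF l] e] by blast
      have *: "dist (\<phi> (v m)) (\<phi> (v n)) < e" if "m \<ge> M" "n \<ge> m" for m n
      proof -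
        have "\<bar>\<phi> (v n) - \<phi> (v m)\<bar> \<le> r n - r m"
          using diff[OF \<phi>, of m "n - m"] that \<phi> by (simp add: state_lin)
        also have "\<dots> < e" using M[of n m] that by (simp add: dist_real_def)
        finally show ?thesis by (simp add: dist_real_def abs_minus_commute)
      qed
      show "\<exists>M. \<forall>m\<ge>M. \<forall>n\<ge>M. dist (\<phi> (v m)) (\<phi> (v n)) < e"
      proof (intro exI allI impI)
        fix m n assume "M \<le> m" "M \<le> n"
        then show "dist (\<phi> (v m)) (\<phi> (v n)) < e"
          using *[of m n] *[of n m] by (cases "m \<le> n") (auto simp: dist_commute)
      qed
    qed
    then show ?thesis by (simp add: Cauchy_convergent_iff)
  qed
  have v1: "\<bar>\<phi> (v n)\<bar> \<le> 1" if "\<phi> \<in> S" for n \<phi> using vr[OF that, of n] r01[of n] by linarith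
  obtain w where w: "w \<in> A" "\<And>\<phi>. \<phi> \<in> S \<Longrightarrow> (\<lambda>n. \<phi> (v n)) \<longlonglongrightarrow> \<phi> w"
    using seq_complete[of v 1] vA v1 conv by blast
  have wW: "w \<in> gen x" by (rule gen_limit[OF vW w(1)]) (use w(2) in \<open>auto simp: wlim_def\<close>)
  have w1: "\<bar>\<phi> w\<bar> \<le> 1" if "\<phi> \<in> S" for \<phi>
    by (rule LIMSEQ_le_const2[OF tendsto_rabs[OF w(2)[OF that]]]) (use v1 that in auto)
  have wv: "\<bar>\<phi> (w - v n)\<bar> \<le> l - r n" if \<phi>: "\<phi> \<in> S" for n \<phi>
  proof (rule LIMSEQ_le)
    show "(\<lambda>m. \<bar>\<phi> (v (m + n)) - \<phi> (v n)\<bar>) \<longlonglongrightarrow> \<bar>\<phi> (w - v n)\<bar>"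
      unfolding state_diff[OF \<phi>] by (intro tendsto_intros LIMSEQ_ignore_initial_segment w \<phi>)
    show "(\<lambda>m. r (m + n) - r n) \<longlonglongrightarrow> l - r n"
      by (intro tendsto_intros LIMSEQ_ignore_initial_segment l)
    show "\<exists>N. \<forall>m\<ge>N. \<bar>\<phi> (v (m + n)) - \<phi> (v n)\<bar> \<le> r (m + n) - r n"
      using diff[OF \<phi>, of n] \<phi> by (auto simp: state_lin add.commute)
  qed
  have ww: "w = (1/2) *\<^sub>R (c + w \<odot> w)"
  proof (rule A_eqI)
    fix \<phi> assume \<phi>: "\<phi> \<in> S"
    \<comment> \<open>The estimate \<open>wv\<close> is uniform in the state, so
      \<open>submult\<close> applies to the factorisation
      \<open>w^2 - v^2 = (w - v) (w + v)\<close>.\<close>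
    have sq: "(\<lambda>n. \<phi> (v n \<odot> v n)) \<longlonglongrightarrow> \<phi> (w \<odot> w)"
    proof (rule Lim_null_comparison[THEN LIM_zero_cancel])
      show "\<forall>\<^sub>F n in sequentially. norm (\<phi> (v n \<odot> v n) - \<phi> (w \<odot> w)) \<le> (l - r n) * 2"
      proof (rule always_eventually, rule allI)
        fix n
        have "w \<odot> w - v n \<odot> v n = (w - v n) \<odot> (w + v n)" by (simp add: bilin comm[of w "v n"])
        moreover have "\<bar>\<phi> ((w - v n) \<odot> (w + v n))\<bar> \<le> (l - r n) * 2"
        proof (rule submult)
          show "\<bar>\<psi> (w + v n)\<bar> \<le> 2" if "\<psi> \<in> S" for \<psi>
            using w1[OF that] v1[OF that, of n] that by (simp add: state_lin)
        qed (use w vA wv \<phi> in auto)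
        ultimately show "norm (\<phi> (v n \<odot> v n) - \<phi> (w \<odot> w)) \<le> (l - r n) * 2"
          using state_diff[OF \<phi>, of "w \<odot> w" "v n \<odot> v n"]
          by (simp add: abs_minus_commute[of "\<phi> (v n \<odot> v n)"])
      qed
      have "(\<lambda>n. (l - r n) * 2) \<longlonglongrightarrow> (l - l) * 2" by (intro tendsto_intros l)
      then show "(\<lambda>n. (l - r n) * 2) \<longlonglongrightarrow> 0" by simp
    qed
    have "(\<lambda>n. (\<phi> c + \<phi> (v n \<odot> v n)) / 2) \<longlonglongrightarrow> (\<phi> c + \<phi> (w \<odot> w)) / 2"
      by (intro tendsto_intros sq) simp
    moreover have "(\<lambda>n. (\<phi> c + \<phi> (v n \<odot> v n)) / 2) = (\<lambda>n. \<phi> (v (Suc n)))"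
      using \<phi> by (simp add: v0 state_lin)
    ultimately have "(\<lambda>n. \<phi> (v (Suc n))) \<longlonglongrightarrow> (\<phi> c + \<phi> (w \<odot> w)) / 2" by simp
    moreover have "(\<lambda>n. \<phi> (v (Suc n))) \<longlonglongrightarrow> \<phi> w" by (rule LIMSEQ_Suc[OF w(2)[OF \<phi>]])
    ultimately show "\<phi> w = \<phi> ((1/2) *\<^sub>R (c + w \<odot> w))"
      using \<phi> LIMSEQ_unique by (fastforce simp: state_lin)
  qed (use w cA in auto)
  have d2: "(u - w) \<odot> (u - w) = b"
  proof (rule A_eqI)
    fix \<phi> assume \<phi>: "\<phi> \<in> S"
    show "\<phi> ((u - w) \<odot> (u - w)) = \<phi> b"
      using arg_cong[OF ww, of \<phi>] \<phi> w by (simp add: bilin state_lin c_def)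
  qed (use b gen_mem in auto)
  show thesis
  proof (rule that)
    show "u - w \<in> gen x" by (simp add: gen_diff gen_unit wW)
    show "(u - w) \<odot> (u - w) = b" by (rule d2)
    fix \<phi> assume \<phi>: "\<phi> \<in> S"
    have "(\<phi> (u - w))\<^sup>2 \<le> 1"
      using state_square_le[OF \<phi>, of "u - w"] w b01[OF \<phi>] d2 by simp
    then show "0 \<le> \<phi> (u - w) \<and> \<phi> (u - w) \<le> 1"
      using w1[OF \<phi>] \<phi> by (auto simp: state_lin power2_le_iff_abs_le abs_square_le_1)
  qed
qed

text \<open>The witness is the sign of \<open>y\<close>, with the value \<open>1\<close> at \<open>0\<close>. With \<open>d = \<bar>y\<bar>\<close>, the powers of
  \<open>1 - ((d + y) / 2)\<^sup>2\<close> decrease to the spectral idempotent \<open>r\<close> of \<open>y \<le> 0\<close>, and the sign is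
  \<open>1 - 2 r\<close>.\<close>

lemma gen_sign:
  assumes x: "x \<in> A" and y: "y \<in> gen x" and y1: "\<And>\<phi>. \<phi> \<in> S \<Longrightarrow> \<bar>\<phi> y\<bar> \<le> 1"
  obtains s where "s \<in> gen x" "s \<odot> s = u" "\<And>\<phi>. \<phi> \<in> S \<Longrightarrow> \<bar>\<phi> (2 *\<^sub>R y - s)\<bar> \<le> 1"
proof -
  have yA: "y \<in> A" by (rule gen_mem[OF y])
  have yy: "0 \<le> \<phi> (y \<odot> y) \<and> \<phi> (y \<odot> y) \<le> 1" if "\<phi> \<in> S" for \<phi>
    using submult[OF yA yA, of 1 1 \<phi>] y1 that square_nonneg[OF that, of y] by simp
  obtain d where d: "d \<in> gen x" "d \<odot> d = y \<odot> y" "\<And>\<phi>. \<phi> \<in> S \<Longrightarrow> 0 \<le> \<phi> d \<and> \<phi> d \<le> 1"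
    using gen_sqrt[OF x gen_mult[OF x y y]] yy by metis
  have dA: "d \<in> A" by (rule gen_mem[OF d(1)])
  \<comment> \<open>Here \<open>d\<close> is the absolute value of \<open>y\<close>, so
    \<open>g\<close> and \<open>h\<close> are its positive and negative parts.\<close>
  define g where "g = (1/2) *\<^sub>R (d + y)"
  define h where "h = (1/2) *\<^sub>R (d - y)"
  have gh: "g \<in> gen x" "h \<in> gen x" unfolding g_def h_def by (intro gen_scale gen_add gen_diff d y)+
  then have ghA: "g \<in> A" "h \<in> A" by (auto intro: gen_mem)
  have gh0: "g \<odot> h = 0" by (simp add: g_def h_def bilin d(2) comm[of y d])
  have g1: "\<bar>\<phi> g\<bar> \<le> 1" if "\<phi> \<in> S" for \<phi>
    proof -
    have "\<bar>\<phi> d + \<phi> y\<bar> \<le> 2" using d(3)[OF that] y1[OF that] by linarith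
    then show ?thesis using that by (simp add: g_def state_lin)
  qed
  define a where "a = u - g \<odot> g"
  have a: "a \<in> gen x" unfolding a_def by (intro gen_diff gen_unit gen_mult x gh)
  then have aA: "a \<in> A" by (rule gen_mem)
  have a01: "0 \<le> \<phi> a \<and> \<phi> a \<le> 1" if "\<phi> \<in> S" for \<phi>
    using submult[OF ghA(1) ghA(1), of 1 1 \<phi>] g1 square_nonneg[OF that, of g] that
    by (simp add: a_def state_lin)
  \<comment> \<open>With a square root of \<open>a\<close>, every power of \<open>a\<close> times a
    square is again a square inside \<open>gen x\<close>; this is where positivity of such products
    comes from.\<close>
  obtain k where k: "k \<in> gen x" "k \<odot> k = a" using gen_sqrt[OF x a] a01 by metis
  define X where "X n = ((\<odot>) a ^^ n) u" for n
  have X0: "X 0 = u" "\<And>n. X (Suc n) = a \<odot> X n" by (simp_all add: X_def)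
  have XW: "X n \<in> gen x" for n by (induction n) (auto simp: X0 gen_unit intro: gen_mult x a)
  then have XA: "X n \<in> A" for n by (rule gen_mem)
  have square: "\<exists>q\<in>gen x. X n \<odot> (w \<odot> w) = q \<odot> q" if w: "w \<in> gen x" for n w
  proof (induction n)
    case 0
    then show ?case using w by (auto simp: X0)
  next
    case (Suc n)
    then obtain q where q: "q \<in> gen x" "X n \<odot> (w \<odot> w) = q \<odot> q" by blast
    have "X (Suc n) \<odot> (w \<odot> w) = a \<odot> (X n \<odot> (w \<odot> w))"
      unfolding X0 by (rule gen_assoc[OF x a XW gen_mult[OF x w w]])
    also have "\<dots> = (k \<odot> q) \<odot> (k \<odot> q)" unfolding q k(2)[symmetric] by (rule gen_square_mult[OF x k(1) q(1), symmetric])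
    finally show ?case using gen_mult[OF x k(1) q(1)] by blast
  qed
  have Xg: "0 \<le> \<phi> (X n \<odot> (g \<odot> g))" "0 \<le> \<phi> (X n)" if "\<phi> \<in> S" for n \<phi>
  proof -
    show "0 \<le> \<phi> (X n \<odot> (g \<odot> g))" using square[OF gh(1), of n] square_nonneg[OF that] by auto
    show "0 \<le> \<phi> (X n)" using square[OF gen_unit, of n] square_nonneg[OF that] XA by auto
  qed
  have X_Suc: "X (Suc n) = X n - X n \<odot> (g \<odot> g)" for n
    using XA[of n] by (simp add: X0 a_def bilin comm[of "g \<odot> g"])
  have X_dec: "\<phi> (X (Suc n)) \<le> \<phi> (X n)" if "\<phi> \<in> S" for n \<phi>
    using Xg[OF that, of n] that by (simp add: X_Suc state_lin)
  have X1: "\<bar>\<phi> (X n)\<bar> \<le> 1" if \<phi>: "\<phi> \<in> S" for n \<phi>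
  proof -
    have "\<phi> (X n) \<le> 1" by (induction n) (use X_dec[OF \<phi>] \<phi> in \<open>auto simp: X0(1) intro: order_trans\<close>)
    then show ?thesis using Xg(2)[OF \<phi>, of n] by simp
  qed
  have conv: "convergent (\<lambda>n. \<phi> (X n))" if \<phi>: "\<phi> \<in> S" for \<phi>
    by (intro Bseq_monoseq_convergent BseqI'[of _ 1]) (use X1[OF \<phi>] X_dec[OF \<phi>] in \<open>auto simp: monoseq_Suc\<close>)
  obtain r where r: "r \<in> A" "wlim X r"
    using seq_complete[of X 1] XA X1 conv unfolding wlim_def by blast
  have rW: "r \<in> gen x" by (rule gen_limit[OF XW r])
  have wlim_unique: "v = w" if "v \<in> A" "w \<in> A" "wlim Y v" "wlim Y w" for Y v w
    using that by (intro A_eqI) (auto simp: wlim_def intro: LIMSEQ_unique)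
  have ar: "a \<odot> r = r"
  proof (rule wlim_unique)
    show "wlim (\<lambda>n. X (Suc n)) r" using r by (auto simp: wlim_def intro: LIMSEQ_Suc)
    show "wlim (\<lambda>n. X (Suc n)) (a \<odot> r)" unfolding X0 by (rule wlim_mult[OF XA r aA])
  qed (use r in auto)
  have "X n \<odot> r = r" for n
  proof (induction n)
    case (Suc n)
    have "X (Suc n) \<odot> r = a \<odot> (X n \<odot> r)" unfolding X0 by (rule gen_assoc[OF x a XW rW])
    then show ?case using Suc ar by simp
  qed (use r X0 in simp)
  then have rX: "r \<odot> X n = r" for n by (simp only: comm[of r])
  have rr: "r \<odot> r = r"
    by (rule wlim_unique[of _ _ "\<lambda>n. r \<odot> X n"]) (use wlim_mult[OF XA r r(1)] r in \<open>auto simp: rX wlim_def\<close>)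
  have "(g \<odot> g) \<odot> r = 0" using ar r by (simp add: a_def bilin)
  then have "(g \<odot> r) \<odot> (g \<odot> r) = 0" by (simp add: gen_square_mult[OF x gh(1) rW] rr)
  then have gr: "g \<odot> r = 0" by (rule square_eq_0[OF prd_mem])
  have "X n \<odot> h = h" for n
  proof (induction n)
    case (Suc n)
    have "(X n \<odot> (g \<odot> g)) \<odot> h = X n \<odot> (g \<odot> (g \<odot> h))"
      using gen_assoc[OF x XW gen_mult[OF x gh(1) gh(1)] gh(2), of n] gen_assoc[OF x gh(1) gh(1) gh(2)] by simp
    then show ?case using Suc gh0 by (simp add: X_Suc bilin)
  qed (use ghA X0 in simp)
  then have hX: "h \<odot> X n = h" for n by (simp only: comm[of h])
  have hr: "h \<odot> r = h"
    by (rule wlim_unique[of _ _ "\<lambda>n. h \<odot> X n"]) (use wlim_mult[OF XA r ghA(2)] ghA in \<open>auto simp: hX wlim_def\<close>)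
  define s where "s = u - 2 *\<^sub>R r"
  have sW: "s \<in> gen x" unfolding s_def by (intro gen_diff gen_unit gen_scale rW)
  have sA: "s \<in> A" by (rule gen_mem[OF sW])
  have s2: "s \<odot> s = u" by (rule A_eqI) (use r in \<open>auto simp: s_def bilin rr state_lin\<close>)
  have y_gh: "y = g - h" "d = g + h"
    by (simp_all add: g_def h_def algebra_simps flip: scaleR_left.add)
  \<comment> \<open>The idempotent \<open>r\<close> annihilates \<open>g\<close> and fixes
    \<open>h\<close>, so \<open>s\<close> turns \<open>g - h\<close> into
    \<open>g + h\<close>.\<close>
  have sy: "s \<odot> y = d" by (rule A_eqI)
    (use ghA r in \<open>auto simp: s_def bilin state_lin y_gh comm[of r] gr hr\<close>)
  \<comment> \<open>Both squares are \<open>4 y^2 - 4 d + u\<close>. Because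
    \<open>0 \<le> d \<le> 1\<close>, the element \<open>2 d - u\<close> has norm at most 1, and
    equality of the squares carries this bound over to \<open>2 y - s\<close>.\<close>
  have sq: "(2 *\<^sub>R y - s) \<odot> (2 *\<^sub>R y - s) = (2 *\<^sub>R d - u) \<odot> (2 *\<^sub>R d - u)"
    using dA sA yA by (simp add: bilin d(2) s2 sy comm[of y s])
  show thesis
  proof (rule that[OF sW s2])
    fix \<phi> assume \<phi>: "\<phi> \<in> S"
    have b: "\<bar>\<psi> (2 *\<^sub>R d - u)\<bar> \<le> 1" if "\<psi> \<in> S" for \<psi> using d(3)[OF that] that by (simp add: state_lin abs_le_iff)
    have "(\<phi> (2 *\<^sub>R y - s))\<^sup>2 \<le> \<phi> ((2 *\<^sub>R y - s) \<odot> (2 *\<^sub>R y - s))"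
      using sA yA by (intro state_square_le[OF \<phi>]) auto
    also have "\<dots> \<le> 1 * 1" unfolding sq using submult[of "2 *\<^sub>R d - u" "2 *\<^sub>R d - u" 1 1 \<phi>] b dA \<phi> by (simp add: abs_le_iff)
    finally show "\<bar>\<phi> (2 *\<^sub>R y - s)\<bar> \<le> 1" by (simp add: abs_square_le_1)
  qed
qed

text \<open>With \<open>m = p \<odot> q\<close>, the elements \<open>p - m\<close>,
  \<open>m\<close>, \<open>q - m\<close> are mutually orthogonal idempotents, by associativity in
  \<open>gen x\<close>. Bilinearity then reduces the claim to orthogonal and equal pairs.\<close>

lemma jordan_form_gen_idem:
  assumes x: "x \<in> A" and p: "p \<in> gen x" "p \<odot> p = p" and q: "q \<in> gen x" "q \<odot> q = q"
    and z: "z \<in> A" and w: "w \<in> A"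
  shows "jordan_form p q z w = 0"
proof -
  define m where "m = p \<odot> q"
  have A: "p \<in> A" "q \<in> A" "m \<in> A" using p q gen_mem by (auto simp: m_def)
  have pm: "p \<odot> m = m" unfolding m_def using gen_assoc[OF x p(1) p(1) q(1)] p by simp
  have mq: "m \<odot> q = m" unfolding m_def using gen_assoc[OF x p(1) q(1) q(1)] q by simp
  have mm: "m \<odot> m = m" using gen_square_mult[OF x p(1) q(1)] p q by (simp add: m_def)
  have pq: "p \<odot> q = m" by (simp add: m_def)
  have i: "idem m" "idem (p - m)" "idem (q - m)" "idem ((p - m) + m)" "idem (m + (q - m))" "idem ((p - m) + (q - m))"
    using A p q by (auto simp: idem_def bilin mm pm mq pq comm[of m p] comm[of q m] comm[of q p])
  have "jordan_form p q z w = jordan_form (p - m) (q - m) z w + jordan_form (p - m) m z w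
      + jordan_form m (q - m) z w + jordan_form m m z w"
    by (simp add: jordan_form_lin)
  then show ?thesis
    by (simp add: jordan_form_orthogonal[OF i(2,3,6) z w] jordan_form_orthogonal[OF i(2,1,4) z w]
        jordan_form_orthogonal[OF i(1,3,5) z w] jordan_form_idem[OF i(1) z w])
qed

section \<open>Approximation by symmetries and the Jordan identity\<close>

definition symmetries :: "'a \<Rightarrow> 'a set"
  where "symmetries x = {s \<in> gen x. s \<odot> s = u}"

lemma jordan_form_symmetries:
  assumes x: "x \<in> A" and s: "s \<in> symmetries x" and t: "t \<in> symmetries x" and z: "z \<in> A" and w: "w \<in> A"
  shows "jordan_form s t z w = 0"
proof -
  have st: "s \<in> gen x" "t \<in> gen x" "s \<odot> s = u" "t \<odot> t = u" using s t by (auto simp: symmetries_def)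
  then have A: "s \<in> A" "t \<in> A" by (auto intro: gen_mem)
  define p where "p = (1/2) *\<^sub>R (u + s)"
  define q where "q = (1/2) *\<^sub>R (u + t)"
  have pW: "p \<in> gen x" "q \<in> gen x" unfolding p_def q_def by (intro gen_scale gen_add gen_unit st)+
  have pp: "p \<odot> p = p" "q \<odot> q = q"
    by (rule A_eqI; use A in \<open>auto simp: p_def q_def bilin state_lin st field_simps\<close>)+
  have st_pq: "s = 2 *\<^sub>R p - u" "t = 2 *\<^sub>R q - u" by (auto simp: p_def q_def)
  have "jordan_form s t z w = 4 *\<^sub>R jordan_form p q z w - 2 *\<^sub>R jordan_form p u z w
      - 2 *\<^sub>R jordan_form u q z w + jordan_form u u z w"
    unfolding st_pq by (simp add: jordan_form_lin scaleR_diff_right)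
  then show ?thesis
    using jordan_form_gen_idem[OF x pW(1) pp(1) pW(2) pp(2) z w] pW gen_mem
    by (simp add: jordan_form_sym[of p u] jordan_form_unit z w)
qed

lemma jordan_form_span_symmetries:
  assumes x: "x \<in> A" and a: "a \<in> span (symmetries x)" and z: "z \<in> A" and w: "w \<in> A"
  shows "jordan_form a a z w = 0"
proof -
  have lin: "linear (\<lambda>a. jordan_form a b z w)" for b
    by (rule linearI) (simp_all add: jordan_form_lin)
  have 1: "jordan_form b t z w = 0" if "t \<in> symmetries x" "b \<in> span (symmetries x)" for b t
    by (rule linear_eq_0_on_span[OF lin _ that(2)]) (rule jordan_form_symmetries[OF x _ that(1) z w])
  show ?thesis
    by (rule linear_eq_0_on_span[OF lin _ a]) (use 1[OF _ a] in \<open>simp add: jordan_form_sym[of _ a]\<close>)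
qed

text \<open>A binary expansion with the digits \<open>s\<close> given by signs:
  \<open>y = s / 2 + (2 y - s) / 2\<close>, where the remainder \<open>2 y - s\<close> is again
  bounded by 1 and can be expanded further.\<close>

lemma dyadic_approximation:
  assumes x: "x \<in> A"
  shows "y \<in> gen x \<Longrightarrow> (\<And>\<phi>. \<phi> \<in> S \<Longrightarrow> \<bar>\<phi> y\<bar> \<le> 1) \<Longrightarrow>
    \<exists>a\<in>span (symmetries x). \<exists>b\<in>gen x. (\<forall>\<phi>\<in>S. \<bar>\<phi> b\<bar> \<le> 1) \<and> y = a + (1 / 2 ^ n) *\<^sub>R b"
proof (induction n arbitrary: y)
  case 0
  then show ?case by (intro bexI[of _ 0] bexI[of _ y]) (auto simp: span_zero)
next
  case (Suc n)
  obtain s where s: "s \<in> gen x" "s \<odot> s = u" "\<And>\<phi>. \<phi> \<in> S \<Longrightarrow> \<bar>\<phi> (2 *\<^sub>R y - s)\<bar> \<le> 1"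
    using gen_sign[OF x Suc.prems(1)] Suc.prems(2) by metis
  have "2 *\<^sub>R y - s \<in> gen x" by (intro gen_diff gen_scale s Suc.prems)
  with Suc.IH[of "2 *\<^sub>R y - s"] s(3) obtain a b where ab: "a \<in> span (symmetries x)" "b \<in> gen x"
    "\<forall>\<phi>\<in>S. \<bar>\<phi> b\<bar> \<le> 1" "2 *\<^sub>R y - s = a + (1 / 2 ^ n) *\<^sub>R b" by blast
  have "y = (1/2) *\<^sub>R (s + (2 *\<^sub>R y - s))" by simp
  also have "\<dots> = (1/2) *\<^sub>R (s + a) + (1 / 2 ^ Suc n) *\<^sub>R b" unfolding ab(4) by (simp add: algebra_simps)
  finally have y: "y = (1/2) *\<^sub>R (s + a) + (1 / 2 ^ Suc n) *\<^sub>R b" .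
  have "s \<in> symmetries x" using s by (simp add: symmetries_def)
  then have "(1/2) *\<^sub>R (s + a) \<in> span (symmetries x)" using ab(1) by (intro span_scale span_add[OF span_base])
  then show ?case using ab(2,3) y by blast
qed

lemma symmetries_subset: "span (symmetries x) \<subseteq> A"
  by (rule span_minimal) (auto simp: symmetries_def subspace_A gen_mem)

lemma jordan_form_diag:
  assumes x: "x \<in> A" and z: "z \<in> A" and w: "w \<in> A"
  shows "jordan_form x x z w = 0"
proof (rule separating)
  fix \<phi> assume \<phi>: "\<phi> \<in> S"
  obtain k where k: "0 < k" "\<And>\<phi>. \<phi> \<in> S \<Longrightarrow> \<bar>\<phi> x\<bar> \<le> k" using bounded_on_states_pos[OF x] by metis
  obtain c where c: "0 < c" "\<And>\<phi>. \<phi> \<in> S \<Longrightarrow> \<bar>\<phi> z\<bar> \<le> c" using bounded_on_states_pos[OF z] by metis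
  obtain d where d: "0 < d" "\<And>\<phi>. \<phi> \<in> S \<Longrightarrow> \<bar>\<phi> w\<bar> \<le> d" using bounded_on_states_pos[OF w] by metis
  define y where "y = (1 / k) *\<^sub>R x"
  have y: "y \<in> gen x" unfolding y_def by (intro gen_scale gen_self x)
  have yA: "y \<in> A" by (rule gen_mem[OF y])
  have y1: "\<bar>\<psi> y\<bar> \<le> 1" if "\<psi> \<in> S" for \<psi> using k(1) k(2)[OF that] that by (simp add: y_def state_lin abs_mult)
  have "\<bar>\<phi> (jordan_form y y z w)\<bar> \<le> (18 * (c * d)) * (1 / 2) ^ n" for n
  proof -
    obtain a b where ab: "a \<in> span (symmetries x)" "b \<in> gen x" "\<forall>\<phi>\<in>S. \<bar>\<phi> b\<bar> \<le> 1" "y = a + (1 / 2 ^ n) *\<^sub>R b"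
      using dyadic_approximation[OF x y, of n] y1 by blast
    have bA: "b \<in> A" by (rule gen_mem[OF ab(2)])
    have aA: "a \<in> A" using ab(1) symmetries_subset by blast
    define e where "e = (1 / 2 ^ n) *\<^sub>R b"
    have a: "a = y - e" using ab(4) by (simp add: e_def)
    \<comment> \<open>With \<open>a = y - e\<close>, bilinearity and symmetry turn the difference of
      the two diagonal values into a value that is linear in the small element \<open>e\<close>. Its
      other argument has norm at most 3, and with the six terms of the form this accounts for the
      constant 18.\<close>
    then have "jordan_form y y z w - jordan_form a a z w = jordan_form (e) (2 *\<^sub>R y - e) z w"
      by (simp add: a jordan_form_lin jordan_form_sym[of y e] scaleR_2)
    then have "jordan_form y y z w = jordan_form (e) (2 *\<^sub>R y - e) z w"
      by (simp add: jordan_form_span_symmetries[OF x ab(1) z w])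
    moreover have "\<bar>\<phi> (jordan_form (e) (2 *\<^sub>R y - e) z w)\<bar> \<le> 6 * (1 / 2 ^ n * 3 * c * d)"
    proof (rule jordan_form_bound)
      show e1: "\<bar>\<psi> e\<bar> \<le> 1 / 2 ^ n" if "\<psi> \<in> S" for \<psi>
        using ab(3) that by (simp add: e_def state_lin abs_mult divide_right_mono)
      have "1 / 2 ^ n \<le> (1::real)" by simp
      then show "\<bar>\<psi> (2 *\<^sub>R y - e)\<bar> \<le> 3" if "\<psi> \<in> S" for \<psi>
        using e1[OF that] y1[OF that] state_diff[OF that, of "2 *\<^sub>R y" e] state_scale[OF that, of 2 y] by linarith
    qed (use yA bA e_def z w c d \<phi> in auto)
    ultimately show ?thesis by (simp add: power_one_over field_simps)
  qed
  moreover have "(\<lambda>n. (18 * (c * d)) * (1 / 2) ^ n) \<longlonglongrightarrow> (18 * (c * d)) * 0"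
    by (intro tendsto_mult tendsto_const LIMSEQ_power_zero) simp
  ultimately have "\<bar>\<phi> (jordan_form y y z w)\<bar> \<le> 0"
    by (intro LIMSEQ_le_const[of "\<lambda>n. (18 * (c * d)) * (1 / 2) ^ n"]) auto
  then have "\<phi> (jordan_form y y z w) = 0" by simp
  then show "\<phi> (jordan_form x x z w) = 0"
    using k(1) \<phi> by (simp add: y_def jordan_form_lin state_scale)
qed simp

lemma jordan_identity:
  assumes x: "x \<in> A" and w: "w \<in> A"
  shows "x \<odot> ((x \<odot> x) \<odot> w) = (x \<odot> x) \<odot> (x \<odot> w)"
proof -
  have "3 *\<^sub>R (x \<odot> ((x \<odot> x) \<odot> w) - (x \<odot> x) \<odot> (x \<odot> w)) = jordan_form x x x w"
    by (rule A_eqI) (auto simp: jordan_form_def state_lin)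
  then show ?thesis using jordan_form_diag[OF x x w] by simp
qed

end

section \<open>Conditioning on the state space\<close>

locale hahn_jordan_ucp =
  fixes E :: "'e qlogic"
  assumes ucp: "ucp_space E" and hj: "eps_hahn_jordan E"
begin

abbreviation "cp \<equiv> compl E"
abbreviation "one \<equiv> qone E"

lemma quantum_logic: "quantum_logic E"
  using ucp by (simp add: ucp_space_def)

lemma ex1_cond_prob: "\<mu> \<in> states E \<Longrightarrow> 0 < \<mu> e \<Longrightarrow> \<exists>!\<nu>. is_cond_prob E \<mu> e \<nu>"
  by (rule ucp[unfolded ucp_space_def, THEN conjunct2, THEN conjunct2, rule_format])

section \<open>Orthogonality and complements\<close>

lemmas axioms = quantum_logic[unfolded quantum_logic_def]

lemma orth_sym: "orth E e f \<Longrightarrow> orth E f e"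
  by (rule axioms[THEN conjunct1, rule_format])

lemma osum_comm: "orth E e f \<Longrightarrow> osum E e f = osum E f e"
  by (rule axioms[THEN conjunct2, THEN conjunct1, rule_format])

lemma orth3:
  assumes "orth E g e" "orth E g f" "orth E e f"
  shows "orth E g (osum E e f)" "osum E g (osum E e f) = osum E (osum E g e) f"
  using axioms[THEN conjunct2, THEN conjunct2, THEN conjunct1, rule_format, of g e f] assms by simp_all

lemma orth_zero: "orth E (qzero E) e" and osum_zero: "osum E e (qzero E) = e"
  using axioms[THEN conjunct2, THEN conjunct2, THEN conjunct2, THEN conjunct1, rule_format, of e] by simp_all

lemma ex1_compl: "\<exists>!d. orth E e d \<and> osum E e d = one"
  by (rule axioms[THEN conjunct2, THEN conjunct2, THEN conjunct2, THEN conjunct2, THEN conjunct1, rule_format])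

lemma le_iff: "(\<exists>d. orth E e d \<and> osum E e d = f) \<longleftrightarrow> orth E e (cp f)"
  by (rule axioms[THEN conjunct2, THEN conjunct2, THEN conjunct2, THEN conjunct2, THEN conjunct2, rule_format])

lemma orth_compl: "orth E e (cp e)" and osum_compl: "osum E e (cp e) = one"
  using theI'[OF ex1_compl[of e]] by (simp_all add: compl_def)

lemma compl_eqI: "orth E e d \<Longrightarrow> osum E e d = one \<Longrightarrow> cp e = d"
  using ex1_compl[of e] orth_compl[of e] osum_compl[of e] by blast

lemma compl_compl [simp]: "cp (cp e) = e"
  using compl_eqI[of "cp e" e] osum_comm[OF orth_compl[of e]] orth_sym[OF orth_compl[of e]] osum_compl[of e] by simp

lemma compl_zero [simp]: "cp (qzero E) = one"
  using compl_eqI[OF orth_zero[of one]] osum_comm[OF orth_zero[of one]] osum_zero[of one] by simp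

lemma compl_one [simp]: "cp one = qzero E"
  using compl_compl[of "qzero E"] by simp

lemma compl_osum:
  assumes "orth E e f"
  defines "g \<equiv> cp (osum E e f)"
  shows "orth E f g" "orth E e g" "osum E f g = cp e" "osum E e g = cp f" "osum E (osum E e f) g = one"
proof -
  have fe: "orth E f e" using assms orth_sym by blast
  show eg: "orth E e g" using le_iff[of e "osum E e f"] assms by (auto simp: g_def)
  show fg: "orth E f g" using le_iff[of f "osum E e f"] fe osum_comm[OF assms(1)] by (auto simp: g_def)
  show *: "osum E (osum E e f) g = one" by (simp add: g_def osum_compl)
  show "osum E f g = cp e"
    using compl_eqI[OF orth3(1)[OF assms(1) eg fg]] orth3(2)[OF assms(1) eg fg] * by simp
  show "osum E e g = cp f"
    using compl_eqI[OF orth3(1)[OF fe fg eg]] orth3(2)[OF fe fg eg] * osum_comm[OF assms(1)] by simp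
qed

text \<open>The nonnegative multiples of states. Conditioning is additive and positively homogeneous
  only without normalisation, so it is studied on this cone.\<close>

definition pcone :: "('e \<Rightarrow> real) set"
  where "pcone = {\<phi>. orth_additive E \<phi> \<and> (\<forall>e. 0 \<le> \<phi> e)}"

lemma cone_add: "\<phi> \<in> pcone \<Longrightarrow> \<psi> \<in> pcone \<Longrightarrow> \<phi> + \<psi> \<in> pcone"
  and cone_zero: "0 \<in> pcone"
  and cone_scale: "0 \<le> c \<Longrightarrow> \<phi> \<in> pcone \<Longrightarrow> c *\<^sub>R \<phi> \<in> pcone"
  by (auto simp: pcone_def orth_additive_def distrib_left)

lemma cone_nonneg: "\<phi> \<in> pcone \<Longrightarrow> 0 \<le> \<phi> e"
  by (simp add: pcone_def)

lemma cone_osum: "\<phi> \<in> pcone \<Longrightarrow> orth E e f \<Longrightarrow> \<phi> (osum E e f) = \<phi> e + \<phi> f"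
  by (simp add: pcone_def orth_additive_def)

lemma cone_compl: "\<phi> \<in> pcone \<Longrightarrow> \<phi> (cp e) = \<phi> one - \<phi> e"
  using cone_osum[of \<phi> e "cp e"] by (simp add: orth_compl osum_compl)

lemma cone_le_one: "\<phi> \<in> pcone \<Longrightarrow> \<phi> e \<le> \<phi> one"
  using cone_compl[of \<phi> e] cone_nonneg[of \<phi> "cp e"] by simp

lemma cone_mono: "\<phi> \<in> pcone \<Longrightarrow> orth E f (cp e) \<Longrightarrow> \<phi> f \<le> \<phi> e"
  using le_iff[of f e] cone_osum cone_nonneg by fastforce

lemma cone_eq_0: "\<phi> \<in> pcone \<Longrightarrow> \<phi> one = 0 \<Longrightarrow> \<phi> = 0"
  using cone_le_one cone_nonneg by (fastforce intro!: ext simp: antisym)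

lemma states_subset_cone: "states E \<subseteq> pcone"
  by (auto simp: states_def pcone_def)

lemma state_one: "\<mu> \<in> states E \<Longrightarrow> \<mu> one = 1"
  by (simp add: states_def)

lemma cone_normalise: "\<phi> \<in> pcone \<Longrightarrow> 0 < \<phi> one \<Longrightarrow> (1 / \<phi> one) *\<^sub>R \<phi> \<in> states E"
  using cone_scale[of "1 / \<phi> one" \<phi>] cone_le_one[of \<phi>]
  by (auto simp: states_def pcone_def divide_le_eq_1)

lemma states_nonempty: "states E \<noteq> {}"
proof -
  have "bounded (range (0 :: 'e \<Rightarrow> real)) \<and> orth_additive E 0"
    by (auto simp: orth_additive_def bounded_iff)
  then show ?thesis using hj unfolding eps_hahn_jordan_def by (metis empty_iff zero_less_one)
qed

lemma coneE:
  assumes "\<phi> \<in> pcone"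
  obtains \<mu> where "\<mu> \<in> states E" "\<phi> = \<phi> one *\<^sub>R \<mu>"
proof (cases "\<phi> one = 0")
  case True
  obtain \<mu> where "\<mu> \<in> states E" using states_nonempty by blast
  then show ?thesis using that cone_eq_0[OF assms True] by auto
next
  case False
  then have "0 < \<phi> one" using cone_nonneg[OF assms, of one] by simp
  then show ?thesis using that[OF cone_normalise[OF assms]] by (simp add: fun_eq_iff)
qed

lemma Vspace_iff: "\<rho> \<in> Vspace E \<longleftrightarrow> (\<exists>\<phi>\<in>pcone. \<exists>\<psi>\<in>pcone. \<rho> = \<phi> - \<psi>)"
proof
  assume "\<rho> \<in> Vspace E"
  then show "\<exists>\<phi>\<in>pcone. \<exists>\<psi>\<in>pcone. \<rho> = \<phi> - \<psi>"
    unfolding Vspace_def using states_subset_cone cone_scale by blast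
next
  assume "\<exists>\<phi>\<in>pcone. \<exists>\<psi>\<in>pcone. \<rho> = \<phi> - \<psi>"
  then obtain \<phi> \<psi> where *: "\<phi> \<in> pcone" "\<psi> \<in> pcone" "\<rho> = \<phi> - \<psi>" by blast
  obtain \<mu> where "\<mu> \<in> states E" "\<phi> = \<phi> one *\<^sub>R \<mu>" using coneE[OF *(1)] by blast
  moreover obtain \<nu> where "\<nu> \<in> states E" "\<psi> = \<psi> one *\<^sub>R \<nu>" using coneE[OF *(2)] by blast
  ultimately show "\<rho> \<in> Vspace E"
    unfolding Vspace_def using * cone_nonneg[OF *(1), of one] cone_nonneg[OF *(2), of one]
    by (intro CollectI exI[of _ "\<phi> one"] exI[of _ "\<psi> one"] exI[of _ \<mu>] exI[of _ \<nu>]) simp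
qed

lemma cone_subset_V: "pcone \<subseteq> Vspace E"
proof
  fix \<phi> assume "\<phi> \<in> pcone"
  then show "\<phi> \<in> Vspace E" unfolding Vspace_iff by (intro bexI[of _ \<phi>] bexI[of _ 0]) (auto simp: cone_zero)
qed

lemma states_subset_V: "states E \<subseteq> Vspace E"
  using cone_subset_V states_subset_cone by blast

lemma V_add: "\<rho> \<in> Vspace E \<Longrightarrow> \<sigma> \<in> Vspace E \<Longrightarrow> \<rho> + \<sigma> \<in> Vspace E"
proof -
  assume "\<rho> \<in> Vspace E" "\<sigma> \<in> Vspace E"
  then obtain a b c d where "a \<in> pcone" "b \<in> pcone" "c \<in> pcone" "d \<in> pcone" "\<rho> = a - b" "\<sigma> = c - d"
    unfolding Vspace_iff by blast
  then show ?thesis unfolding Vspace_iff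
    by (intro bexI[of _ "a + c"] bexI[of _ "b + d"]) (auto simp: cone_add)
qed

lemma V_scale: "\<rho> \<in> Vspace E \<Longrightarrow> c *\<^sub>R \<rho> \<in> Vspace E"
proof -
  assume "\<rho> \<in> Vspace E"
  then obtain a b where ab: "a \<in> pcone" "b \<in> pcone" "\<rho> = a - b" unfolding Vspace_iff by blast
  show ?thesis
  proof (cases "0 \<le> c")
    case True
    then show ?thesis unfolding Vspace_iff
      by (intro bexI[of _ "c *\<^sub>R a"] bexI[of _ "c *\<^sub>R b"]) (auto simp: ab cone_scale scaleR_diff_right)
  next
    case False
    then show ?thesis unfolding Vspace_iff
      by (intro bexI[of _ "(- c) *\<^sub>R b"] bexI[of _ "(- c) *\<^sub>R a"])
        (use cone_scale[of "- c"] in \<open>auto simp: ab algebra_simps\<close>)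
  qed
qed

lemma subspace_V: "subspace (Vspace E)"
  using cone_zero cone_subset_V by (auto simp: subspace_def V_add V_scale)

lemma V_diff: "\<rho> \<in> Vspace E \<Longrightarrow> \<sigma> \<in> Vspace E \<Longrightarrow> \<rho> - \<sigma> \<in> Vspace E"
  and V_zero: "0 \<in> Vspace E"
  using subspace_V by (auto simp: subspace_diff subspace_0)

lemma V_orth_additive: "\<rho> \<in> Vspace E \<Longrightarrow> orth_additive E \<rho>"
  unfolding Vspace_iff by (auto simp: orth_additive_def cone_osum)

lemma V_bounded: "\<rho> \<in> Vspace E \<Longrightarrow> bounded (range \<rho>)"
proof -
  assume "\<rho> \<in> Vspace E"
  then obtain a b where ab: "a \<in> pcone" "b \<in> pcone" "\<rho> = a - b" unfolding Vspace_iff by blast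
  have "\<bar>\<rho> e\<bar> \<le> a one + b one" for e
    using cone_le_one[OF ab(1), of e] cone_le_one[OF ab(2), of e] cone_nonneg[OF ab(1), of e] cone_nonneg[OF ab(2), of e]
    by (simp add: ab(3))
  then show ?thesis by (auto simp: bounded_iff)
qed

lemma V_compl: "\<rho> \<in> Vspace E \<Longrightarrow> \<rho> (cp e) = \<rho> one - \<rho> e"
  using V_orth_additive[of \<rho>] orth_compl[of e] osum_compl[of e] unfolding orth_additive_def by force

text \<open>With \<open>V_bounded\<close> and \<open>V_orth_additive\<close> this identifies
  \<open>V\<close> with all bounded orthogonally additive functions on the events.\<close>

lemma V_I: "bounded (range \<rho>) \<Longrightarrow> orth_additive E \<rho> \<Longrightarrow> \<rho> \<in> Vspace E"
  using hj unfolding eps_hahn_jordan_def Vspace_def by (simp, metis zero_less_one)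

text \<open>After division by \<open>\<psi> e\<close>, the first function is a state with value 1 at
  \<open>e\<close>, and both are conditional probabilities of this very state under
  \<open>e\<close>.\<close>

lemma cond_unique:
  assumes \<psi>: "\<psi> \<in> pcone" "\<psi>' \<in> pcone" and one: "\<psi> one = \<psi> e" "\<psi>' one = \<psi> e"
    and eq: "\<And>f. orth E f (cp e) \<Longrightarrow> \<psi> f = \<psi>' f"
  shows "\<psi> = \<psi>'"
proof (cases "\<psi> e = 0")
  case True
  then show ?thesis using cone_eq_0[OF \<psi>(1)] cone_eq_0[OF \<psi>(2)] one by simp
next
  case False
  let ?c = "\<psi> e"
  have c: "0 < ?c" using False cone_nonneg[OF \<psi>(1), of e] by simp
  define \<mu> where "\<mu> = (1 / ?c) *\<^sub>R \<psi>"
  define \<mu>' where "\<mu>' = (1 / ?c) *\<^sub>R \<psi>'"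
  have "\<mu> \<in> states E" "\<mu>' \<in> states E"
    using cone_normalise[OF \<psi>(1)] cone_normalise[OF \<psi>(2)] c one by (auto simp: \<mu>_def \<mu>'_def)
  moreover have "\<mu> e = 1" using c by (simp add: \<mu>_def)
  moreover have "\<mu> f = \<mu>' f" if "orth E f (cp e)" for f
    using eq[OF that] by (simp add: \<mu>_def \<mu>'_def)
  ultimately have "is_cond_prob E \<mu> e \<mu>" "is_cond_prob E \<mu> e \<mu>'" and "\<exists>!\<nu>. is_cond_prob E \<mu> e \<nu>"
    using ex1_cond_prob[of \<mu> e] by (auto simp: is_cond_prob_def)
  then have "\<mu> = \<mu>'" by blast
  then show ?thesis using c by (auto simp: \<mu>_def \<mu>'_def fun_eq_iff)
qed

text \<open>Unnormalised conditioning: for a state \<open>\<mu>\<close> the only solution is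
  \<open>\<mu> e\<close> times the conditional probability, or 0 if \<open>\<mu> e = 0\<close>. In
  this form the relation is compatible with sums and nonnegative multiples.\<close>

definition is_cond :: "'e \<Rightarrow> ('e \<Rightarrow> real) \<Rightarrow> ('e \<Rightarrow> real) \<Rightarrow> bool"
  where "is_cond e \<phi> \<psi> \<longleftrightarrow> \<psi> \<in> pcone \<and> (\<forall>f. orth E f (cp e) \<longrightarrow> \<psi> f = \<phi> f) \<and> \<psi> one = \<phi> e"

lemma is_cond_unique:
  assumes "is_cond e \<phi> \<psi>" "is_cond e \<phi> \<psi>'"
  shows "\<psi> = \<psi>'"
  by (rule cond_unique[of _ _ e]) (use assms orth_compl[of e] in \<open>auto simp: is_cond_def\<close>)

lemma is_cond_state:
  assumes "\<mu> \<in> states E"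
  shows "is_cond e \<mu> (if \<mu> e = 0 then 0 else \<mu> e *\<^sub>R cond_prob E \<mu> e)"
proof (cases "\<mu> e = 0")
  case True
  have "\<mu> f = 0" if "orth E f (cp e)" for f
    using cone_mono[of \<mu> f e] cone_nonneg[of \<mu> f] that True assms states_subset_cone by fastforce
  then show ?thesis using True by (auto simp: is_cond_def cone_zero)
next
  case False
  then have pos: "0 < \<mu> e" using assms cone_nonneg[of \<mu> e] states_subset_cone by fastforce
  have "is_cond_prob E \<mu> e (cond_prob E \<mu> e)"
    using theI'[OF ex1_cond_prob[OF assms pos]] by (simp add: cond_prob_def)
  then show ?thesis
    using pos by (auto simp: is_cond_def is_cond_prob_def state_one states_subset_cone[THEN subsetD] intro!: cone_scale)
qed

section \<open>Conditioning as a linear map on \<open>V\<close>\<close>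

definition rcond :: "'e \<Rightarrow> ('e \<Rightarrow> real) \<Rightarrow> 'e \<Rightarrow> real"
  where "rcond e \<phi> = (THE \<psi>. is_cond e \<phi> \<psi>)"

lemma rcond_eqI: "is_cond e \<phi> \<psi> \<Longrightarrow> rcond e \<phi> = \<psi>"
  unfolding rcond_def using is_cond_unique by blast

lemma is_cond_add: "is_cond e \<phi> \<psi> \<Longrightarrow> is_cond e \<phi>' \<psi>' \<Longrightarrow> is_cond e (\<phi> + \<phi>') (\<psi> + \<psi>')"
  and is_cond_scale: "0 \<le> c \<Longrightarrow> is_cond e \<phi> \<psi> \<Longrightarrow> is_cond e (c *\<^sub>R \<phi>) (c *\<^sub>R \<psi>)"
  by (auto simp: is_cond_def cone_add cone_scale)

lemma is_cond_rcond:
  assumes "\<phi> \<in> pcone"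
  shows "is_cond e \<phi> (rcond e \<phi>)"
proof -
  obtain \<mu> where \<mu>: "\<mu> \<in> states E" "\<phi> = \<phi> one *\<^sub>R \<mu>" using coneE[OF assms] by blast
  have "\<exists>\<psi>. is_cond e \<phi> \<psi>"
    using is_cond_scale[OF cone_nonneg[OF assms, of one] is_cond_state[OF \<mu>(1), of e]] \<mu>(2) by metis
  then show ?thesis using rcond_eqI by metis
qed

lemma rcond_add: "\<phi> \<in> pcone \<Longrightarrow> \<psi> \<in> pcone \<Longrightarrow> rcond e (\<phi> + \<psi>) = rcond e \<phi> + rcond e \<psi>"
  and rcond_scale: "0 \<le> c \<Longrightarrow> \<phi> \<in> pcone \<Longrightarrow> rcond e (c *\<^sub>R \<phi>) = c *\<^sub>R rcond e \<phi>"
  by (rule rcond_eqI, simp add: is_cond_add is_cond_scale is_cond_rcond)+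

lemma rcond_cone: "\<phi> \<in> pcone \<Longrightarrow> rcond e \<phi> \<in> pcone"
  and rcond_below: "\<phi> \<in> pcone \<Longrightarrow> orth E f (cp e) \<Longrightarrow> rcond e \<phi> f = \<phi> f"
  and rcond_one: "\<phi> \<in> pcone \<Longrightarrow> rcond e \<phi> one = \<phi> e"
  using is_cond_rcond[of \<phi> e] by (auto simp: is_cond_def)

lemma rcond_orth: 
  assumes "\<phi> \<in> pcone" "orth E f e"
  shows "rcond e \<phi> f = 0"
proof -
  have "rcond e \<phi> f \<le> rcond e \<phi> (cp e)"
    using assms by (intro cone_mono rcond_cone) auto
  also have "\<dots> = 0"
    using assms by (simp add: cone_compl rcond_cone rcond_one rcond_below orth_compl)
  finally show ?thesis using cone_nonneg[OF rcond_cone[OF assms(1)], of e f] by simp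
qed

text \<open>The linear extension of \<open>rcond e\<close> from the cone to \<open>V\<close>, and
  the preadjoint of \<open>U\<close> for the event \<open>e\<close>. The choice picks a
  decomposition; \<open>P_diff_cone\<close> shows that the value does not depend on it.\<close>

definition P :: "'e \<Rightarrow> ('e \<Rightarrow> real) \<Rightarrow> 'e \<Rightarrow> real"
  where "P e \<rho> = (SOME \<sigma>. \<exists>\<phi>\<in>pcone. \<exists>\<psi>\<in>pcone. \<rho> = \<phi> - \<psi> \<and> \<sigma> = rcond e \<phi> - rcond e \<psi>)"

lemma P_diff_cone:
  assumes "\<phi> \<in> pcone" "\<psi> \<in> pcone"
  shows "P e (\<phi> - \<psi>) = rcond e \<phi> - rcond e \<psi>"
proof -
  have "\<exists>\<sigma>. \<exists>\<phi>'\<in>pcone. \<exists>\<psi>'\<in>pcone. \<phi> - \<psi> = \<phi>' - \<psi>' \<and> \<sigma> = rcond e \<phi>' - rcond e \<psi>'"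
    using assms by blast
  from someI_ex[OF this] obtain \<phi>' \<psi>' where *: "\<phi>' \<in> pcone" "\<psi>' \<in> pcone" "\<phi> - \<psi> = \<phi>' - \<psi>'"
    "P e (\<phi> - \<psi>) = rcond e \<phi>' - rcond e \<psi>'" unfolding P_def by blast
  have "\<phi> + \<psi>' = \<phi>' + \<psi>" using *(3) by (simp add: algebra_simps)
  then have "rcond e \<phi> + rcond e \<psi>' = rcond e \<phi>' + rcond e \<psi>"
    using assms * by (metis rcond_add)
  then show ?thesis unfolding *(4) by (simp add: algebra_simps)
qed

lemma rcond_zero: "rcond e 0 = 0"
  using rcond_scale[of 0 0 e] cone_zero by simp

lemma P_cone: "\<phi> \<in> pcone \<Longrightarrow> P e \<phi> = rcond e \<phi>"
  using P_diff_cone[OF _ cone_zero, of \<phi> e] by (simp add: rcond_zero)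

lemma P_V: "\<rho> \<in> Vspace E \<Longrightarrow> P e \<rho> \<in> Vspace E"
proof -
  assume "\<rho> \<in> Vspace E"
  then obtain a b where ab: "a \<in> pcone" "b \<in> pcone" "\<rho> = a - b" unfolding Vspace_iff by blast
  then show ?thesis using cone_subset_V rcond_cone by (auto simp: P_diff_cone intro!: V_diff)
qed

lemma P_add: "\<rho> \<in> Vspace E \<Longrightarrow> \<sigma> \<in> Vspace E \<Longrightarrow> P e (\<rho> + \<sigma>) = P e \<rho> + P e \<sigma>"
proof -
  assume "\<rho> \<in> Vspace E" "\<sigma> \<in> Vspace E"
  then obtain a b c d where *: "a \<in> pcone" "b \<in> pcone" "c \<in> pcone" "d \<in> pcone" "\<rho> = a - b" "\<sigma> = c - d"
    unfolding Vspace_iff by blast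
  have "P e (\<rho> + \<sigma>) = P e ((a + c) - (b + d))" using * by (intro arg_cong[of _ _ "P e"]) simp
  also have "\<dots> = P e \<rho> + P e \<sigma>" using * by (subst P_diff_cone) (simp_all add: cone_add rcond_add P_diff_cone)
  finally show ?thesis .
qed

lemma P_scale: "\<rho> \<in> Vspace E \<Longrightarrow> P e (c *\<^sub>R \<rho>) = c *\<^sub>R P e \<rho>"
proof -
  assume "\<rho> \<in> Vspace E"
  then obtain a b where ab: "a \<in> pcone" "b \<in> pcone" "\<rho> = a - b" unfolding Vspace_iff by blast
  show ?thesis
  proof (cases "0 \<le> c")
    case True
    then show ?thesis using ab P_diff_cone[of "c *\<^sub>R a" "c *\<^sub>R b" e]
      by (simp add: P_diff_cone cone_scale rcond_scale scaleR_diff_right)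
  next
    case False
    then show ?thesis using ab P_diff_cone[of "(- c) *\<^sub>R b" "(- c) *\<^sub>R a" e] 
      using cone_scale[of "- c"] rcond_scale[of "- c"]
      by (simp add: P_diff_cone scaleR_diff_right)
  qed
qed

lemma P_below: "\<rho> \<in> Vspace E \<Longrightarrow> orth E f (cp e) \<Longrightarrow> P e \<rho> f = \<rho> f"
  unfolding Vspace_iff by (auto simp: P_diff_cone rcond_below)

lemma P_orth: "\<rho> \<in> Vspace E \<Longrightarrow> orth E f e \<Longrightarrow> P e \<rho> f = 0"
  unfolding Vspace_iff by (auto simp: P_diff_cone rcond_orth)

lemma P_one: "\<rho> \<in> Vspace E \<Longrightarrow> P one \<rho> = \<rho>"
  by (rule ext, rule P_below) (auto simp: orth_sym orth_zero)

lemma P_zero: "\<rho> \<in> Vspace E \<Longrightarrow> P (qzero E) \<rho> = 0"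
  by (rule ext) (simp add: P_orth orth_sym orth_zero)

lemma P_unit: "\<rho> \<in> Vspace E \<Longrightarrow> P e \<rho> one = \<rho> e"
  unfolding Vspace_iff by (auto simp: P_diff_cone rcond_one)

end

section \<open>The dual space and the operators of an event\<close>

context hahn_jordan_ucp
begin

definition bd :: "'e functional \<Rightarrow> real \<Rightarrow> bool"
  where "bd x k \<longleftrightarrow> (\<forall>\<mu>\<in>states E. \<bar>x \<mu>\<bar> \<le> k)"

lemma bd_nonneg: "bd x k \<Longrightarrow> 0 \<le> k"
  using states_nonempty unfolding bd_def by fastforce

lemma Vspace_cases:
  assumes "\<rho> \<in> Vspace E"
  obtains s t \<mu> \<nu> where "\<mu> \<in> states E" "\<nu> \<in> states E" "0 \<le> s" "0 \<le> t" "\<rho> = s *\<^sub>R \<mu> - t *\<^sub>R \<nu>"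
  using assms unfolding Vspace_def by blast

lemma linear_on_V_diff:
  assumes "linear_on (Vspace E) x" "\<mu> \<in> Vspace E" "\<nu> \<in> Vspace E"
  shows "x (s *\<^sub>R \<mu> - t *\<^sub>R \<nu>) = s * x \<mu> - t * x \<nu>"
proof -
  have "x (s *\<^sub>R \<mu> + (- t) *\<^sub>R \<nu>) = x (s *\<^sub>R \<mu>) + x ((- t) *\<^sub>R \<nu>)"
    using assms V_scale unfolding linear_on_def by blast
  also have "\<dots> = s *\<^sub>R x \<mu> + (- t) *\<^sub>R x \<nu>" using assms unfolding linear_on_def by metis
  finally show ?thesis by simp
qed

lemma Vnorm_set_nonempty:
  assumes "\<rho> \<in> Vspace E"
  shows "{r. 0 \<le> r \<and> \<rho> \<in> (\<lambda>\<sigma>. r *\<^sub>R \<sigma>) ` (convex hull (states E \<union> uminus ` states E))} \<noteq> {}"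
proof -
  obtain s t \<mu> \<nu> where *: "\<mu> \<in> states E" "\<nu> \<in> states E" "0 \<le> s" "0 \<le> t" "\<rho> = s *\<^sub>R \<mu> - t *\<^sub>R \<nu>"
    by (rule Vspace_cases[OF assms])
  let ?H = "convex hull (states E \<union> uminus ` states E)"
  have H: "\<mu> \<in> ?H" "- \<nu> \<in> ?H" using *(1,2) by (simp_all add: hull_inc)
  have "\<rho> \<in> (\<lambda>\<sigma>. (s + t) *\<^sub>R \<sigma>) ` ?H"
  proof (cases "s + t = 0")
    case True
    then have "s = 0" "t = 0" using *(3,4) by auto
    then show ?thesis using *(5) by (intro image_eqI[OF _ H(1)]) simp
  next
    case False
    then have st: "0 < s + t" using * by simp
    have "(s / (s + t)) *\<^sub>R \<mu> + (t / (s + t)) *\<^sub>R (- \<nu>) \<in> ?H"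
      using *(3,4) st by (intro convexD[OF convex_convex_hull] H) (simp_all flip: add_divide_distrib)
    moreover have "\<rho> = (s + t) *\<^sub>R ((s / (s + t)) *\<^sub>R \<mu> + (t / (s + t)) *\<^sub>R (- \<nu>))"
      using st by (simp add: *(5) scaleR_diff_right)
    ultimately show ?thesis by (intro image_eqI)
  qed
  then have "s + t \<in> {r. 0 \<le> r \<and> \<rho> \<in> (\<lambda>\<sigma>. r *\<^sub>R \<sigma>) ` ?H}" using *(3,4) by simp
  then show ?thesis by blast
qed

lemma Aspace_iff: "x \<in> Aspace E \<longleftrightarrow>
  linear_on (Vspace E) x \<and> (\<exists>k. bd x k) \<and> (\<forall>\<rho>. \<rho> \<notin> Vspace E \<longrightarrow> x \<rho> = 0)"
proof -
  let ?H = "convex hull (states E \<union> uminus ` states E)"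
  let ?R = "\<lambda>\<rho>. {r. 0 \<le> r \<and> \<rho> \<in> (\<lambda>\<sigma>. r *\<^sub>R \<sigma>) ` ?H}"
  have below: "bdd_below (?R \<rho>)" for \<rho> by (rule bdd_belowI[of _ 0]) simp
  have "(\<exists>K. \<forall>\<rho>\<in>Vspace E. \<bar>x \<rho>\<bar> \<le> K * Vnorm E \<rho>) \<longleftrightarrow> (\<exists>k. bd x k)" if lin: "linear_on (Vspace E) x"
  proof
    assume "\<exists>K. \<forall>\<rho>\<in>Vspace E. \<bar>x \<rho>\<bar> \<le> K * Vnorm E \<rho>"
    then obtain K where K: "\<And>\<rho>. \<rho> \<in> Vspace E \<Longrightarrow> \<bar>x \<rho>\<bar> \<le> K * Vnorm E \<rho>" by blast
    have "\<bar>x \<mu>\<bar> \<le> \<bar>K\<bar>" if \<mu>: "\<mu> \<in> states E" for \<mu>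
    proof -
      have "1 \<in> ?R \<mu>" using \<mu> by (auto intro: hull_inc)
      then have "Vnorm E \<mu> \<le> 1" unfolding Vnorm_def by (rule cInf_lower[OF _ below])
      moreover have "0 \<le> Vnorm E \<mu>" unfolding Vnorm_def
        using Vnorm_set_nonempty[of \<mu>] \<mu> states_subset_V by (intro cInf_greatest) auto
      ultimately have "\<bar>K\<bar> * Vnorm E \<mu> \<le> \<bar>K\<bar> * 1" by (intro mult_left_mono) auto
      moreover have "K * Vnorm E \<mu> \<le> \<bar>K\<bar> * Vnorm E \<mu>" using \<open>0 \<le> Vnorm E \<mu>\<close> by (intro mult_right_mono) auto
      ultimately show ?thesis using K[of \<mu>] \<mu> states_subset_V by fastforce
    qed
    then show "\<exists>k. bd x k" unfolding bd_def by blast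
  next
    assume "\<exists>k. bd x k"
    then obtain k where k: "bd x k" by blast
    have x_diff: "x (s *\<^sub>R \<mu> - t *\<^sub>R \<nu>) = s * x \<mu> - t * x \<nu>" if "\<mu> \<in> Vspace E" "\<nu> \<in> Vspace E" for s t \<mu> \<nu>
      by (rule linear_on_V_diff[OF lin that])
    let ?C = "{\<sigma> \<in> Vspace E. \<bar>x \<sigma>\<bar> \<le> k}"
    have "?H \<subseteq> ?C"
    proof (rule hull_minimal)
      have m: "- \<mu> \<in> ?C" if "\<mu> \<in> states E" for \<mu>
        using x_diff[OF V_zero, of \<mu> 0 1] V_diff[OF V_zero, of \<mu>] that k states_subset_V by (auto simp: bd_def)
      then show "states E \<union> uminus ` states E \<subseteq> ?C" using k states_subset_V by (auto simp: bd_def)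
      show "convex ?C"
      proof (rule convexI)
        fix \<sigma> \<tau> and a b :: real assume *: "\<sigma> \<in> ?C" "\<tau> \<in> ?C" "0 \<le> a" "0 \<le> b" "a + b = 1"
        have "x (a *\<^sub>R \<sigma> + b *\<^sub>R \<tau>) = a * x \<sigma> + b * x \<tau>"
          using x_diff[of \<sigma> \<tau> a "- b"] * by simp
        also have "\<bar>\<dots>\<bar> \<le> \<bar>a * x \<sigma>\<bar> + \<bar>b * x \<tau>\<bar>" by (rule abs_triangle_ineq)
        also have "\<dots> \<le> a * k + b * k" using * by (intro add_mono) (auto simp: abs_mult intro: mult_left_mono)
        finally show "a *\<^sub>R \<sigma> + b *\<^sub>R \<tau> \<in> ?C" using * by (auto simp: V_add V_scale distrib_right[symmetric])
      qed
    qed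
    then have H: "\<sigma> \<in> Vspace E \<and> \<bar>x \<sigma>\<bar> \<le> k" if "\<sigma> \<in> ?H" for \<sigma> using that by blast
    have k0: "0 \<le> k" by (rule bd_nonneg[OF k])
    have "\<bar>x \<rho>\<bar> \<le> k * Vnorm E \<rho>" if \<rho>: "\<rho> \<in> Vspace E" for \<rho>
    proof (cases "k = 0")
      case True
      obtain s t \<mu> \<nu> where *: "\<mu> \<in> states E" "\<nu> \<in> states E" "0 \<le> s" "0 \<le> t" "\<rho> = s *\<^sub>R \<mu> - t *\<^sub>R \<nu>"
        by (rule Vspace_cases[OF \<rho>])
      then show ?thesis using k True x_diff[of \<mu> \<nu> s t] states_subset_V by (auto simp: bd_def)
    next
      case False
      have "\<bar>x \<rho>\<bar> / k \<le> Vnorm E \<rho>" unfolding Vnorm_def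
      proof (rule cInf_greatest[OF Vnorm_set_nonempty[OF \<rho>]])
        fix r assume "r \<in> ?R \<rho>"
        then obtain \<sigma> where r: "0 \<le> r" "\<sigma> \<in> ?H" "\<rho> = r *\<^sub>R \<sigma>" by blast
        have "x \<rho> = r * x \<sigma>" using x_diff[of \<sigma> 0 r 0] H[OF r(2)] V_zero r(3) by simp
        then have "\<bar>x \<rho>\<bar> \<le> r * k" using H[OF r(2)] r(1) by (auto simp: abs_mult intro: mult_left_mono)
        then show "\<bar>x \<rho>\<bar> / k \<le> r" using False k0 by (simp add: field_simps)
      qed
      then show ?thesis using False k0 by (simp add: field_simps)
    qed
    then show "\<exists>K. \<forall>\<rho>\<in>Vspace E. \<bar>x \<rho>\<bar> \<le> K * Vnorm E \<rho>" by blast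
  qed
  then show ?thesis unfolding Aspace_def by auto
qed

lemma AspaceI:
  "linear_on (Vspace E) x \<Longrightarrow> bd x k \<Longrightarrow> (\<And>\<rho>. \<rho> \<notin> Vspace E \<Longrightarrow> x \<rho> = 0) \<Longrightarrow> x \<in> Aspace E"
  unfolding Aspace_iff by blast

lemma Aspace_linear: "x \<in> Aspace E \<Longrightarrow> linear_on (Vspace E) x"
  by (simp add: Aspace_iff)

lemma Aspace_add: "x \<in> Aspace E \<Longrightarrow> \<rho> \<in> Vspace E \<Longrightarrow> \<sigma> \<in> Vspace E \<Longrightarrow> x (\<rho> + \<sigma>) = x \<rho> + x \<sigma>"
  and Aspace_scale: "x \<in> Aspace E \<Longrightarrow> \<rho> \<in> Vspace E \<Longrightarrow> x (c *\<^sub>R \<rho>) = c * x \<rho>"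
  using Aspace_linear[of x] by (auto simp: linear_on_def)

lemma Aspace_diff: "x \<in> Aspace E \<Longrightarrow> \<rho> \<in> Vspace E \<Longrightarrow> \<sigma> \<in> Vspace E \<Longrightarrow> x (\<rho> - \<sigma>) = x \<rho> - x \<sigma>"
  using linear_on_V_diff[OF Aspace_linear, of x \<rho> \<sigma> 1 1] by simp

lemma Aspace_at_zero: "x \<in> Aspace E \<Longrightarrow> x 0 = 0"
  using Aspace_scale[of x 0 0] V_zero by simp

lemma Aspace_bd: "x \<in> Aspace E \<Longrightarrow> \<exists>k. bd x k"
  by (simp add: Aspace_iff)

lemma Aspace_outside: "x \<in> Aspace E \<Longrightarrow> \<rho> \<notin> Vspace E \<Longrightarrow> x \<rho> = 0"
  by (simp add: Aspace_iff)

lemma Aspace_eqI: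
  assumes "x \<in> Aspace E" "y \<in> Aspace E" "\<And>\<rho>. \<rho> \<in> Vspace E \<Longrightarrow> x \<rho> = y \<rho>"
  shows "x = y"
  using assms Aspace_outside by (intro ext) metis

lemma Aspace_states_eqI:
  assumes xy: "x \<in> Aspace E" "y \<in> Aspace E" and eq: "\<And>\<mu>. \<mu> \<in> states E \<Longrightarrow> x \<mu> = y \<mu>"
  shows "x = y"
proof (rule Aspace_eqI[OF xy])
  fix \<rho> assume "\<rho> \<in> Vspace E"
  then obtain s t \<mu> \<nu> where "\<mu> \<in> states E" "\<nu> \<in> states E" "\<rho> = s *\<^sub>R \<mu> - t *\<^sub>R \<nu>"
    by (rule Vspace_cases)
  then show "x \<rho> = y \<rho>"
    using linear_on_V_diff[OF Aspace_linear] xy eq states_subset_V by (metis subsetD)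
qed

lemma subspace_Aspace: "subspace (Aspace E)"
  unfolding subspace_def
proof (intro conjI ballI allI)
  show "0 \<in> Aspace E" by (rule AspaceI[of _ 0]) (auto simp: linear_on_def bd_def)
  fix x y assume xy: "x \<in> Aspace E" "y \<in> Aspace E"
  obtain k l where "bd x k" "bd y l" using Aspace_bd xy by blast
  then have "bd (x + y) (k + l)" unfolding bd_def by (fastforce intro: order_trans[OF abs_triangle_ineq])
  then show "x + y \<in> Aspace E"
    using xy by (intro AspaceI) (auto simp: linear_on_def Aspace_add Aspace_scale Aspace_outside distrib_left)
next
  fix c x assume x: "x \<in> Aspace E"
  obtain k where "bd x k" using Aspace_bd x by blast
  then have "bd (c *\<^sub>R x) (\<bar>c\<bar> * k)" unfolding bd_def by (auto simp: abs_mult intro: mult_left_mono)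
  then show "c *\<^sub>R x \<in> Aspace E"
    using x by (intro AspaceI) (auto simp: linear_on_def Aspace_add Aspace_scale Aspace_outside distrib_left)
qed

lemma emb_apply [simp]: "\<rho> \<in> Vspace E \<Longrightarrow> emb E e \<rho> = \<rho> e"
  by (simp add: emb_def)

lemma bd_emb: "bd (emb E e) 1"
  using states_subset_V by (auto simp: bd_def states_def)

lemma emb_mem [simp]: "emb E e \<in> Aspace E"
  by (rule AspaceI[OF _ bd_emb]) (auto simp: linear_on_def emb_def V_add V_scale)

lemma bd_cone:
  assumes "x \<in> Aspace E" "bd x k" "\<phi> \<in> pcone"
  shows "\<bar>x \<phi>\<bar> \<le> k * \<phi> one"
proof -
  obtain \<mu> where \<mu>: "\<mu> \<in> states E" "\<phi> = \<phi> one *\<^sub>R \<mu>" using coneE[OF assms(3)] by blast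
  have "x \<phi> = \<phi> one * x \<mu>"
    using Aspace_scale[OF assms(1), of \<mu> "\<phi> one"] \<mu> states_subset_V by auto
  then have "\<bar>x \<phi>\<bar> = \<phi> one * \<bar>x \<mu>\<bar>" using cone_nonneg[OF assms(3), of one] by (simp add: abs_mult)
  also have "\<dots> \<le> \<phi> one * k"
    using assms(2) \<mu>(1) cone_nonneg[OF assms(3), of one] by (intro mult_left_mono) (auto simp: bd_def)
  finally show ?thesis by (simp add: mult.commute)
qed

lemma P_state: "\<mu> \<in> states E \<Longrightarrow> P e \<mu> \<in> pcone"
  using states_subset_cone P_cone rcond_cone by (metis subsetD)

lemma bd_P: "x \<in> Aspace E \<Longrightarrow> bd x k \<Longrightarrow> \<mu> \<in> states E \<Longrightarrow> \<bar>x (P e \<mu>)\<bar> \<le> k * \<mu> e"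
  using bd_cone[of x k "P e \<mu>"] P_state[of \<mu> e] P_unit[of \<mu> e] states_subset_V by auto

lemma weighted_cond_eq:
  assumes "x \<in> Aspace E" "\<mu> \<in> states E"
  shows "weighted_cond E \<mu> e x = x (P e \<mu>)"
proof -
  have "P e \<mu> = (if \<mu> e = 0 then 0 else \<mu> e *\<^sub>R cond_prob E \<mu> e)"
    using assms(2) states_subset_cone P_cone[of \<mu> e] rcond_eqI[OF is_cond_state[OF assms(2), of e]] by auto
  moreover have "cond_prob E \<mu> e \<in> Vspace E" if "\<mu> e \<noteq> 0"
  proof -
    have "0 < \<mu> e" using that assms(2) states_subset_cone cone_nonneg[of \<mu> e] by fastforce
    from theI'[OF ex1_cond_prob[OF assms(2) this]] show ?thesis
      using states_subset_V by (auto simp: cond_prob_def is_cond_prob_def)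
  qed
  ultimately show ?thesis
    using assms(1) by (auto simp: weighted_cond_def Aspace_at_zero Aspace_scale)
qed

section \<open>The operators of an event as adjoints\<close>

definition Uad :: "'e \<Rightarrow> 'e functional \<Rightarrow> 'e functional"
  where "Uad e x = (\<lambda>\<rho>. if \<rho> \<in> Vspace E then x (P e \<rho>) else 0)"

lemma Uad_mem:
  assumes "x \<in> Aspace E"
  shows "Uad e x \<in> Aspace E"
proof -
  obtain k where k: "bd x k" using Aspace_bd[OF assms] by blast
  have "\<bar>x (P e \<mu>)\<bar> \<le> k" if "\<mu> \<in> states E" for \<mu>
  proof -
    have "k * \<mu> e \<le> k * 1" using bd_nonneg[OF k] that by (intro mult_left_mono) (auto simp: states_def)
    then show ?thesis using bd_P[OF assms k that, of e] by simp
  qed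
  then have "bd (Uad e x) k" using states_subset_V by (auto simp: bd_def Uad_def)
  then show ?thesis
    using assms by (intro AspaceI)
      (auto simp: Uad_def linear_on_def V_add V_scale P_add P_scale P_V Aspace_add Aspace_scale)
qed

lemma Uop_eq:
  assumes x: "x \<in> Aspace E"
  shows "Uop E e x = Uad e x"
  unfolding Uop_def
proof (rule the_equality)
  have *: "Uad e x (s *\<^sub>R \<mu> - t *\<^sub>R \<nu>) = s * weighted_cond E \<mu> e x - t * weighted_cond E \<nu> e x"
    if "\<mu> \<in> states E" "\<nu> \<in> states E" for \<mu> \<nu> s t
  proof -
    have V: "\<mu> \<in> Vspace E" "\<nu> \<in> Vspace E" using that states_subset_V by auto
    have "Uad e x (s *\<^sub>R \<mu> - t *\<^sub>R \<nu>) = s * Uad e x \<mu> - t * Uad e x \<nu>"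
      by (rule linear_on_V_diff[OF Aspace_linear[OF Uad_mem[OF x]] V])
    then show ?thesis using V that x by (simp add: weighted_cond_eq Uad_def)
  qed
  then show "Uad e x \<in> Aspace E \<and> (\<forall>\<mu>\<in>states E. \<forall>\<nu>\<in>states E. \<forall>s\<ge>0. \<forall>t\<ge>0.
       Uad e x (s *\<^sub>R \<mu> - t *\<^sub>R \<nu>) = s * weighted_cond E \<mu> e x - t * weighted_cond E \<nu> e x)"
    using Uad_mem[OF x] by blast
  fix y assume y: "y \<in> Aspace E \<and> (\<forall>\<mu>\<in>states E. \<forall>\<nu>\<in>states E. \<forall>s\<ge>0. \<forall>t\<ge>0.
       y (s *\<^sub>R \<mu> - t *\<^sub>R \<nu>) = s * weighted_cond E \<mu> e x - t * weighted_cond E \<nu> e x)"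
  show "y = Uad e x"
  proof (rule Aspace_states_eqI)
    fix \<mu> assume \<mu>: "\<mu> \<in> states E"
    have "y (1 *\<^sub>R \<mu> - 0 *\<^sub>R \<mu>) = 1 * weighted_cond E \<mu> e x - 0 * weighted_cond E \<mu> e x"
      using y \<mu> by (meson order.refl zero_le_one)
    then show "y \<mu> = Uad e x \<mu>" using *[OF \<mu> \<mu>, of 1 0] by simp
  qed (use y Uad_mem[OF x] in auto)
qed

lemma Uop_apply: "x \<in> Aspace E \<Longrightarrow> \<rho> \<in> Vspace E \<Longrightarrow> Uop E e x \<rho> = x (P e \<rho>)"
  by (simp add: Uop_eq Uad_def)

lemma Uop_mem: "x \<in> Aspace E \<Longrightarrow> Uop E e x \<in> Aspace E"
  by (simp add: Uop_eq Uad_mem)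

lemma Top_apply: "x \<in> Aspace E \<Longrightarrow> \<rho> \<in> Vspace E \<Longrightarrow>
    Top E e x \<rho> = (x \<rho> + x (P e \<rho>) - x (P (cp e) \<rho>)) / 2"
  by (simp add: Top_def Uop_apply)

lemma Top_mem: "x \<in> Aspace E \<Longrightarrow> Top E e x \<in> Aspace E"
  unfolding Top_def using subspace_Aspace
  by (intro subspace_scale subspace_diff subspace_add Uop_mem)

lemma Top_one: "x \<in> Aspace E \<Longrightarrow> Top E one x = x"
  by (rule Aspace_eqI) (auto simp: Top_mem Top_apply P_one P_zero Aspace_at_zero)

lemma Top_emb_one: "Top E e (emb E one) = emb E e"
proof (rule Aspace_eqI)
  fix \<rho> assume \<rho>: "\<rho> \<in> Vspace E"
  then show "Top E e (emb E one) \<rho> = emb E e \<rho>"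
    using V_compl[OF \<rho>, of e] by (simp add: Top_apply P_V P_unit)
qed (auto simp: Top_mem)

lemma Top_emb_below:
  assumes "orth E f (cp e)"
  shows "Top E e (emb E f) = emb E f"
  by (rule Aspace_eqI) (use assms in \<open>auto simp: Top_mem Top_apply P_V P_below P_orth\<close>)

text \<open>Together with \<open>Top_emb_below\<close>: the product of two comparable events is the
  smaller one in either order.\<close>

lemma Top_emb_above:
  assumes "orth E f (cp e)"
  shows "Top E f (emb E e) = emb E f"
proof (rule Aspace_eqI)
  fix \<rho> assume \<rho>: "\<rho> \<in> Vspace E"
  obtain g where g: "orth E f g" "osum E f g = e" using le_iff[of f e] assms by blast
  have add: "\<sigma> e = \<sigma> f + \<sigma> g" if "\<sigma> \<in> Vspace E" for \<sigma>
    using V_orth_additive[OF that] g by (auto simp: orth_additive_def)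
  have "P f \<rho> g = 0" by (rule P_orth[OF \<rho> orth_sym[OF g(1)]])
  moreover have "P (cp f) \<rho> f = 0" by (rule P_orth[OF \<rho> orth_compl])
  moreover have "P (cp f) \<rho> g = \<rho> g" by (rule P_below[OF \<rho>]) (use orth_sym[OF g(1)] in simp)
  moreover have "P f \<rho> f = \<rho> f" by (rule P_below[OF \<rho> orth_compl])
  ultimately show "Top E f (emb E e) \<rho> = emb E f \<rho>"
    using \<rho> by (simp add: Top_apply P_V add)
qed (auto simp: Top_mem)

text \<open>The state \<open>\<mu>\<close> is almost carried by the complement of \<open>e\<close>
  and \<open>\<nu>\<close> by \<open>e\<close>. Hence the symmetry \<open>cp e - e\<close> takes at
  \<open>\<rho>\<close> nearly the value \<open>s + t\<close>, which bounds the norm of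
  \<open>\<rho>\<close>.\<close>

lemma hahn_jordan_V:
  assumes \<rho>: "\<rho> \<in> Vspace E" and \<epsilon>: "0 < \<epsilon>"
  obtains s t \<mu> \<nu> e where "\<mu> \<in> states E" "\<nu> \<in> states E" "0 \<le> s" "0 \<le> t" "\<rho> = s *\<^sub>R \<mu> - t *\<^sub>R \<nu>"
    "\<mu> e < \<epsilon>" "\<nu> (cp e) < \<epsilon>" "(s + t) * (1 - 2 * \<epsilon>) \<le> \<rho> (cp e) - \<rho> e"
proof -
  have "\<exists>\<mu>\<in>states E. \<exists>\<nu>\<in>states E. \<exists>s t e. 0 \<le> s \<and> 0 \<le> t \<and>
         \<rho> = s *\<^sub>R \<mu> - t *\<^sub>R \<nu> \<and> \<mu> e < \<epsilon> \<and> \<nu> (cp e) < \<epsilon>"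
    using hj V_bounded[OF \<rho>] V_orth_additive[OF \<rho>] \<epsilon> by (simp add: eps_hahn_jordan_def)
  then obtain s t \<mu> \<nu> e where *: "\<mu> \<in> states E" "\<nu> \<in> states E" "0 \<le> s" "0 \<le> t" "\<rho> = s *\<^sub>R \<mu> - t *\<^sub>R \<nu>"
    "\<mu> e < \<epsilon>" "\<nu> (cp e) < \<epsilon>" by blast
  have c: "\<mu> (cp e) = 1 - \<mu> e" "\<nu> e = 1 - \<nu> (cp e)"
    using cone_compl[of \<mu> e] cone_compl[of \<nu> e] * states_subset_cone by (auto simp: state_one)
  have "\<rho> (cp e) - \<rho> e = s * (1 - 2 * \<mu> e) + t * (1 - 2 * \<nu> (cp e))"
    unfolding *(5) by (simp add: c algebra_simps)
  moreover have "s * (1 - 2 * \<epsilon>) \<le> s * (1 - 2 * \<mu> e)" "t * (1 - 2 * \<epsilon>) \<le> t * (1 - 2 * \<nu> (cp e))"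
    using * by (auto intro!: mult_left_mono)
  ultimately have "(s + t) * (1 - 2 * \<epsilon>) \<le> \<rho> (cp e) - \<rho> e" by (simp add: algebra_simps)
  then show thesis using that * by blast
qed

text \<open>In other words, the norm on \<open>V\<close> is attained in the supremum over the
  symmetries \<open>cp e - e\<close>. It serves for submultiplicativity and for passing from
  smallness on events to smallness on \<open>A\<close>.\<close>

lemma bd_V:
  assumes x: "x \<in> Aspace E" and k: "bd x k" and \<rho>: "\<rho> \<in> Vspace E"
    and m: "\<And>e. \<rho> (cp e) - \<rho> e \<le> m"
  shows "\<bar>x \<rho>\<bar> \<le> k * m"
proof (rule field_le_mult_one_interval)
  fix z :: real assume z: "0 < z" "z < 1"
  \<comment> \<open>The precision \<open>(1 - z) / 2\<close> makes the factor
    \<open>1 - 2 \<epsilon>\<close> equal to \<open>z\<close>.\<close>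
  obtain s t \<mu> \<nu> e where *: "\<mu> \<in> states E" "\<nu> \<in> states E" "0 \<le> s" "0 \<le> t" "\<rho> = s *\<^sub>R \<mu> - t *\<^sub>R \<nu>"
    "(s + t) * (1 - 2 * ((1 - z) / 2)) \<le> \<rho> (cp e) - \<rho> e"
    using hahn_jordan_V[OF \<rho>, of "(1 - z) / 2"] z by (metis diff_gt_0_iff_gt half_gt_zero)
  have "1 - 2 * ((1 - z) / 2) = z" by (simp add: field_simps)
  then have st: "(s + t) * z \<le> m" using *(6) m[of e] by simp
  have "x \<rho> = s * x \<mu> - t * x \<nu>"
    unfolding *(5) by (rule linear_on_V_diff[OF Aspace_linear[OF x]]) (use *(1,2) states_subset_V in auto)
  also have "\<bar>\<dots>\<bar> \<le> \<bar>s * x \<mu>\<bar> + \<bar>t * x \<nu>\<bar>" by (rule abs_triangle_ineq4)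
  also have "\<dots> \<le> s * k + t * k" using * k by (auto simp: abs_mult bd_def intro!: add_mono mult_left_mono)
  finally have "z * \<bar>x \<rho>\<bar> \<le> z * ((s + t) * k)" using z by (intro mult_left_mono) (auto simp: algebra_simps)
  also have "\<dots> = ((s + t) * z) * k" by (simp add: algebra_simps)
  also have "\<dots> \<le> m * k" using st bd_nonneg[OF k] by (rule mult_right_mono)
  finally show "z * \<bar>x \<rho>\<bar> \<le> k * m" by (simp add: mult.commute)
qed

end

section \<open>The product\<close>

text \<open>The induction step restricts the space to the kernel of the new evaluation, hence the
  generalisation over \<open>A\<close> and \<open>\<phi>\<close>.\<close>

lemma linear_on_kernel_finite:
  fixes A :: "('b \<Rightarrow> real) set" and \<phi> :: "('b \<Rightarrow> real) \<Rightarrow> real"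
  assumes "finite F" "subspace A" "linear_on A \<phi>"
    and "\<And>x. x \<in> A \<Longrightarrow> (\<forall>\<rho>\<in>F. x \<rho> = 0) \<Longrightarrow> \<phi> x = 0"
  shows "\<exists>c. \<forall>x\<in>A. \<phi> x = (\<Sum>\<rho>\<in>F. c \<rho> * x \<rho>)"
  using assms
proof (induction F arbitrary: A \<phi> rule: finite_induct)
  case empty
  then show ?case by simp
next
  case (insert \<tau> F)
  note [simp] = insert.hyps
  have add: "\<And>x y. x \<in> A \<Longrightarrow> y \<in> A \<Longrightarrow> \<phi> (x + y) = \<phi> x + \<phi> y"
    and scale: "\<And>x r. x \<in> A \<Longrightarrow> \<phi> (r *\<^sub>R x) = r * \<phi> x"
    using insert.prems(2) by (auto simp: linear_on_def)
  let ?A = "{x \<in> A. x \<tau> = 0}"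
  have "subspace ?A" using insert.prems(1) by (auto simp: subspace_def)
  moreover have "linear_on ?A \<phi>" using insert.prems(2) by (auto simp: linear_on_def)
  ultimately obtain c where c: "\<And>x. x \<in> A \<Longrightarrow> x \<tau> = 0 \<Longrightarrow> \<phi> x = (\<Sum>\<rho>\<in>F. c \<rho> * x \<rho>)"
    using insert.IH[of ?A \<phi>] insert.prems(3) by auto
  show ?case
  proof (cases "\<forall>x\<in>A. x \<tau> = 0")
    case True
    then show ?thesis using c by (intro exI[of _ c]) auto
  next
    case False
    then obtain a where a: "a \<in> A" "a \<tau> \<noteq> 0" by blast
    define d where "d = (\<phi> a - (\<Sum>\<rho>\<in>F. c \<rho> * a \<rho>)) / a \<tau>"
    have "\<phi> x = (\<Sum>\<rho>\<in>F. c \<rho> * x \<rho>) + d * x \<tau>" if x: "x \<in> A" for x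
    proof -
      define r where "r = x \<tau> / a \<tau>"
      define y where "y = x + (- r) *\<^sub>R a"
      have sa: "(- r) *\<^sub>R a \<in> A" using insert.prems(1) a by (intro subspace_scale)
      have "y \<in> A" unfolding y_def using insert.prems(1) x sa by (intro subspace_add)
      moreover have "y \<tau> = 0" using a by (simp add: y_def r_def)
      ultimately have "\<phi> y = (\<Sum>\<rho>\<in>F. c \<rho> * y \<rho>)" by (rule c)
      moreover have "\<phi> y = \<phi> x - r * \<phi> a" unfolding y_def add[OF x sa] scale[OF a(1)] by simp
      moreover have "(\<Sum>\<rho>\<in>F. c \<rho> * y \<rho>) = (\<Sum>\<rho>\<in>F. c \<rho> * x \<rho>) - r * (\<Sum>\<rho>\<in>F. c \<rho> * a \<rho>)"
        by (simp add: y_def algebra_simps sum_subtractf sum_distrib_left)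
      moreover have "d * x \<tau> = r * (\<phi> a - (\<Sum>\<rho>\<in>F. c \<rho> * a \<rho>))" by (simp add: d_def r_def)
      ultimately show ?thesis by (simp add: algebra_simps)
    qed
    moreover have "(\<Sum>\<rho>\<in>F. (c(\<tau> := d)) \<rho> * x \<rho>) = (\<Sum>\<rho>\<in>F. c \<rho> * x \<rho>)" for x :: "'b \<Rightarrow> real"
      by (rule sum.cong) auto
    ultimately show ?thesis by (intro exI[of _ "c(\<tau> := d)"]) (simp add: add.commute)
  qed
qed

context hahn_jordan_ucp
begin

section \<open>The weak-star topology and its continuous linear maps\<close>

lemma topspace_weak_star: "topspace (weak_star E) = Aspace E"
proof -
  have "Aspace E = {x \<in> Aspace E. x 0 \<in> UNIV}" by simp
  then have "Aspace E \<in> {{x \<in> Aspace E. x \<rho> \<in> G} |\<rho> G. \<rho> \<in> Vspace E \<and> open G}"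
    using V_zero open_UNIV by blast
  then show ?thesis unfolding weak_star_def topology_generated_by_topspace by blast
qed

lemma weak_star_nbhd:
  assumes "openin (weak_star E) T" "y \<in> T"
  shows "\<exists>F \<epsilon>. finite F \<and> F \<subseteq> Vspace E \<and> 0 < \<epsilon> \<and> {x \<in> Aspace E. \<forall>\<rho>\<in>F. \<bar>x \<rho> - y \<rho>\<bar> < \<epsilon>} \<subseteq> T"
proof -
  have "generate_topology_on {{x \<in> Aspace E. x \<rho> \<in> G} |\<rho> G. \<rho> \<in> Vspace E \<and> open G} T"
    using assms(1) unfolding weak_star_def by (rule openin_topology_generated_by)
  then show ?thesis using assms(2)
  proof (induction)
    case Empty
    then show ?case by simp
  next
    case (Int a b)
    then obtain F \<epsilon> G \<delta> where "finite F" "F \<subseteq> Vspace E" "0 < \<epsilon>" "{x \<in> Aspace E. \<forall>\<rho>\<in>F. \<bar>x \<rho> - y \<rho>\<bar> < \<epsilon>} \<subseteq> a"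
      "finite G" "G \<subseteq> Vspace E" "0 < \<delta>" "{x \<in> Aspace E. \<forall>\<rho>\<in>G. \<bar>x \<rho> - y \<rho>\<bar> < \<delta>} \<subseteq> b" by auto
    then show ?case by (intro exI[of _ "F \<union> G"] exI[of _ "min \<epsilon> \<delta>"]) auto
  next
    case (UN K)
    then obtain k where "k \<in> K" "y \<in> k" by blast
    with UN.IH[OF this] show ?case by (meson Union_upper order_trans)
  next
    case (Basis s)
    then obtain \<rho> G where s: "s = {x \<in> Aspace E. x \<rho> \<in> G}" "\<rho> \<in> Vspace E" "open G" by blast
    then obtain \<epsilon> where "0 < \<epsilon>" "\<And>t. \<bar>t - y \<rho>\<bar> < \<epsilon> \<Longrightarrow> t \<in> G"
      using Basis.prems open_real[of G] by (auto simp: open_dist dist_real_def)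
    then show ?case using s by (intro exI[of _ "{\<rho>}"] exI[of _ \<epsilon>]) auto
  qed
qed

lemma weak_star_continuousI:
  assumes "\<And>y. y \<in> Aspace E \<Longrightarrow> f y \<in> Aspace E"
    and "\<And>\<rho>. \<rho> \<in> Vspace E \<Longrightarrow> \<exists>\<sigma>\<in>Vspace E. \<forall>y\<in>Aspace E. f y \<rho> = y \<sigma>"
  shows "continuous_map (weak_star E) (weak_star E) f"
proof -
  let ?B = "{{x \<in> Aspace E. x \<rho> \<in> G} |\<rho> G. \<rho> \<in> Vspace E \<and> open G}"
  have B: "\<Union>?B = Aspace E"
    using topspace_weak_star unfolding weak_star_def topology_generated_by_topspace .
  have "continuous_map (weak_star E) (topology_generated_by ?B) f"
    unfolding continuous_on_generated_topo_iff topspace_weak_star B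
  proof (intro conjI allI impI)
    show "f ` Aspace E \<subseteq> Aspace E" using assms(1) by blast
    fix U assume "U \<in> ?B"
    then obtain \<rho> G where U: "U = {x \<in> Aspace E. x \<rho> \<in> G}" "\<rho> \<in> Vspace E" "open G" by blast
    obtain \<sigma> where \<sigma>: "\<sigma> \<in> Vspace E" "\<And>y. y \<in> Aspace E \<Longrightarrow> f y \<rho> = y \<sigma>" using assms(2)[OF U(2)] by blast
    have "f -` U \<inter> Aspace E = {x \<in> Aspace E. x \<sigma> \<in> G}" using U \<sigma> assms(1) by auto
    also have "openin (weak_star E) \<dots>"
      unfolding weak_star_def by (rule topology_generated_by_Basis) (use \<sigma> U in blast)
    finally show "openin (weak_star E) (f -` U \<inter> Aspace E)" .
  qed
  then show ?thesis by (simp add: weak_star_def)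
qed

text \<open>Existence of a preadjoint. Continuity at 0 bounds \<open>L x \<rho>\<close> by 1
  wherever finitely many evaluations of \<open>x\<close> vanish; this set is a subspace, so scaling
  makes \<open>L x \<rho>\<close> zero there, and \<open>L\<close> followed by evaluation at
  \<open>\<rho>\<close> is a combination of these evaluations.\<close>

lemma weak_star_functional:
  assumes L: "L \<in> Aspace E \<rightarrow> Aspace E" "linear_on (Aspace E) L" "continuous_map (weak_star E) (weak_star E) L"
    and \<rho>: "\<rho> \<in> Vspace E"
  shows "\<exists>\<sigma>\<in>Vspace E. \<forall>y\<in>Aspace E. L y \<rho> = y \<sigma>"
proof -
  have A0: "0 \<in> Aspace E" using subspace_Aspace by (rule subspace_0)
  have L_add: "L (x + y) = L x + L y" if "x \<in> Aspace E" "y \<in> Aspace E" for x y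
    using L(2) that by (simp add: linear_on_def)
  have L_scale: "L (c *\<^sub>R x) = c *\<^sub>R L x" if "x \<in> Aspace E" for x c
    using L(2) that by (simp add: linear_on_def)
  have L0: "L 0 = 0" using L_scale[OF A0, of 0] by simp
  let ?U = "{x \<in> Aspace E. x \<rho> \<in> {-1<..<1}}"
  have "openin (weak_star E) ?U"
    unfolding weak_star_def by (rule topology_generated_by_Basis) (use \<rho> open_greaterThanLessThan in blast)
  from openin_continuous_map_preimage[OF L(3) this]
  have "openin (weak_star E) {x \<in> Aspace E. L x \<in> ?U}" by (simp add: topspace_weak_star)
  moreover have "0 \<in> {x \<in> Aspace E. L x \<in> ?U}" using A0 L0 by simp
  ultimately obtain F \<epsilon> where F: "finite F" "F \<subseteq> Vspace E" "0 < \<epsilon>"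
    "{x \<in> Aspace E. \<forall>\<sigma>\<in>F. \<bar>x \<sigma> - (0 :: 'e functional) \<sigma>\<bar> < \<epsilon>} \<subseteq> {x \<in> Aspace E. L x \<in> ?U}"
    using weak_star_nbhd by meson
  have small: "\<bar>L x \<rho>\<bar> < 1" if "x \<in> Aspace E" "\<forall>\<sigma>\<in>F. x \<sigma> = 0" for x
    using F that by auto
  have "\<exists>c. \<forall>x\<in>Aspace E. L x \<rho> = (\<Sum>\<sigma>\<in>F. c \<sigma> * x \<sigma>)"
  proof (rule linear_on_kernel_finite[OF F(1) subspace_Aspace])
    show "linear_on (Aspace E) (\<lambda>x. L x \<rho>)" using L_add L_scale by (auto simp: linear_on_def)
    fix x assume x: "x \<in> Aspace E" "\<forall>\<sigma>\<in>F. x \<sigma> = 0"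
    show "L x \<rho> = 0"
    proof (rule ccontr)
      assume n: "L x \<rho> \<noteq> 0"
      let ?c = "1 / L x \<rho>"
      have "?c *\<^sub>R x \<in> Aspace E" using subspace_Aspace x(1) by (rule subspace_scale)
      then have "\<bar>L (?c *\<^sub>R x) \<rho>\<bar> < 1" using x(2) by (intro small) auto
      then show False using n by (simp add: L_scale[OF x(1)])
    qed
  qed
  then obtain c where c: "\<And>x. x \<in> Aspace E \<Longrightarrow> L x \<rho> = (\<Sum>\<sigma>\<in>F. c \<sigma> * x \<sigma>)" by blast
  define g where "g \<sigma> = c \<sigma> *\<^sub>R \<sigma>" for \<sigma> :: "'e \<Rightarrow> real"
  have g: "g \<sigma> \<in> Vspace E" "\<And>x. x \<in> Aspace E \<Longrightarrow> x (g \<sigma>) = c \<sigma> * x \<sigma>" if "\<sigma> \<in> F" for \<sigma>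
    unfolding g_def using that F(2) V_scale Aspace_scale by blast+
  have "sum g G \<in> Vspace E \<and> (\<forall>x\<in>Aspace E. x (sum g G) = (\<Sum>\<sigma>\<in>G. c \<sigma> * x \<sigma>))"
    if "finite G" "G \<subseteq> F" for G
    using that
  proof (induction rule: finite_induct)
    case empty
    show ?case unfolding sum.empty using V_zero Aspace_at_zero by blast
  next
    case (insert \<tau> G)
    then have IH: "sum g G \<in> Vspace E" "\<And>x. x \<in> Aspace E \<Longrightarrow> x (sum g G) = (\<Sum>\<sigma>\<in>G. c \<sigma> * x \<sigma>)" and \<tau>: "\<tau> \<in> F"
      by auto
    show ?case
      unfolding sum.insert[OF insert.hyps] using V_add[OF g(1)[OF \<tau>] IH(1)]
      by (auto simp only: Aspace_add[OF _ g(1)[OF \<tau>] IH(1)] g(2)[OF \<tau>] IH(2))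
  qed
  from this[OF F(1) order.refl] show ?thesis using c by (intro bexI[of _ "sum g F"]) auto
qed

text \<open>Elements of \<open>V\<close> are functions on the events, so agreement of two maps on
  events says that their preadjoints coincide.\<close>

lemma weak_star_linear_eqI:
  assumes L: "L \<in> Aspace E \<rightarrow>\<^sub>E Aspace E" "linear_on (Aspace E) L" "continuous_map (weak_star E) (weak_star E) L"
    and M: "M \<in> Aspace E \<rightarrow>\<^sub>E Aspace E" "linear_on (Aspace E) M" "continuous_map (weak_star E) (weak_star E) M"
    and eq: "\<And>e. L (emb E e) = M (emb E e)"
  shows "L = M"
proof (rule PiE_ext[OF L(1) M(1)])
  fix y assume y: "y \<in> Aspace E"
  show "L y = M y"
  proof (rule Aspace_eqI)
    fix \<rho> assume \<rho>: "\<rho> \<in> Vspace E"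
    obtain \<sigma> where \<sigma>: "\<sigma> \<in> Vspace E" "\<forall>y\<in>Aspace E. L y \<rho> = y \<sigma>"
      using weak_star_functional[OF _ L(2,3) \<rho>] L(1) by (auto simp: PiE_def)
    obtain \<tau> where \<tau>: "\<tau> \<in> Vspace E" "\<forall>y\<in>Aspace E. M y \<rho> = y \<tau>"
      using weak_star_functional[OF _ M(2,3) \<rho>] M(1) by (auto simp: PiE_def)
    have "\<sigma> e = \<tau> e" for e
      using \<sigma>(2)[rule_format, OF emb_mem, of e] \<tau>(2)[rule_format, OF emb_mem, of e] \<sigma>(1) \<tau>(1)
      by (simp add: eq)
    then have "\<sigma> = \<tau>" by blast
    then show "L y \<rho> = M y \<rho>" using \<sigma> \<tau> y by simp
  qed (use L M y in auto)
qed

end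

locale i3_ucp = hahn_jordan_ucp E for E :: "'e qlogic" +
  assumes I3_zero: "\<lbrakk>orth E e1 e2; orth E e2 e3; orth E e1 e3; x \<in> Aspace E\<rbrakk> \<Longrightarrow> I3 E e1 e2 e3 x = 0"
begin

text \<open>The vanishing of \<open>I3\<close> is applied to \<open>e\<close>, \<open>f\<close> and
  the complement \<open>g\<close> of their sum. Then all sums of two of them are complements of the
  third, and the total sum is the unit.\<close>

lemma Top_osum:
  assumes ef: "orth E e f" and x: "x \<in> Aspace E"
  shows "Top E (osum E e f) x = Top E e x + Top E f x"
proof -
  define g where "g = cp (osum E e f)"
  note c = compl_osum[OF ef, folded g_def]
  have "I3 E e f g x = 0" by (rule I3_zero[OF ef c(1) c(2) x])
  moreover have "Uop E one x = x"
    by (rule Aspace_eqI) (auto simp: Uop_mem Uop_apply P_one x)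
  ultimately have "x - Uop E (osum E e f) x - Uop E (cp e) x - Uop E (cp f) x + Uop E e x + Uop E f x + Uop E g x = 0"
    by (simp add: I3_def c(3-5))
  then have "Uop E (osum E e f) x - Uop E g x = x - Uop E (cp e) x - Uop E (cp f) x + Uop E e x + Uop E f x"
    by (simp add: algebra_simps)
  then have "x + Uop E (osum E e f) x - Uop E g x = (x + Uop E e x - Uop E (cp e) x) + (x + Uop E f x - Uop E (cp f) x)"
    by (simp add: algebra_simps)
  then show ?thesis unfolding Top_def g_def[symmetric] by (simp add: scaleR_add_right[symmetric])
qed

text \<open>The preadjoint of left multiplication on \<open>x\<close>, that is, of
  \<open>y \<mapsto> y \<odot> x\<close> for the given product. Once it lies in \<open>V\<close>,
  every \<open>y\<close> can be evaluated at it, which is the extension from events to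
  \<open>A\<close>.\<close>

definition \<theta> :: "'e functional \<Rightarrow> ('e \<Rightarrow> real) \<Rightarrow> 'e \<Rightarrow> real"
  where "\<theta> x \<rho> = (\<lambda>e. Top E e x \<rho>)"

lemma \<theta>_V:
  assumes x: "x \<in> Aspace E" and \<rho>: "\<rho> \<in> Vspace E"
  shows "\<theta> x \<rho> \<in> Vspace E"
proof (rule V_I)
  obtain k where k: "bd x k" using Aspace_bd[OF x] by blast
  obtain a b where ab: "a \<in> pcone" "b \<in> pcone" "\<rho> = a - b" using \<rho> by (auto simp: Vspace_iff)
  have V: "a \<in> Vspace E" "b \<in> Vspace E" using ab cone_subset_V by auto
  have Pb: "\<bar>x (P e \<phi>)\<bar> \<le> k * \<phi> one" if \<phi>: "\<phi> \<in> pcone" for e \<phi>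
  proof -
    have "\<bar>x (P e \<phi>)\<bar> \<le> k * P e \<phi> one" using \<phi> by (intro bd_cone[OF x k]) (simp add: P_cone rcond_cone)
    also have "P e \<phi> one = \<phi> e" using \<phi> cone_subset_V by (intro P_unit) auto
    also have "k * \<phi> e \<le> k * \<phi> one" using bd_nonneg[OF k] cone_le_one[OF \<phi>] by (rule mult_left_mono[rotated])
    finally show ?thesis .
  qed
  have "\<bar>\<theta> x \<rho> e\<bar> \<le> 2 * (k * a one + k * b one)" for e
  proof -
    have P: "x (P f \<rho>) = x (P f a) - x (P f b)" for f
      using V x P_diff_cone[OF ab(1,2), of f] by (simp add: ab P_cone[symmetric] Aspace_diff P_V)
    have "x \<rho> = x a - x b" using V x ab(3) by (simp add: Aspace_diff)
    then show ?thesis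
      using Pb[OF ab(1), of e] Pb[OF ab(2), of e] Pb[OF ab(1), of "cp e"] Pb[OF ab(2), of "cp e"]
        bd_cone[OF x k ab(1)] bd_cone[OF x k ab(2)]
      by (simp add: \<theta>_def Top_apply[OF x \<rho>] P abs_le_iff)
  qed
  then show "bounded (range (\<theta> x \<rho>))" unfolding bounded_iff by auto
  show "orth_additive E (\<theta> x \<rho>)" by (auto simp: orth_additive_def \<theta>_def Top_osum x)
qed

definition pr :: "'e functional \<Rightarrow> 'e functional \<Rightarrow> 'e functional"
  where "pr y x = (\<lambda>\<rho>. if \<rho> \<in> Vspace E then y (\<theta> x \<rho>) else 0)"

text \<open>The term \<open>x / 2\<close> cancels in the difference, and the two operators
  \<open>U\<close> contribute at most \<open>k * \<mu> (cp e)\<close> and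
  \<open>k * \<mu> e\<close>. This yields the constant 1 in the submultiplicativity.\<close>

lemma \<theta>_diff_le:
  assumes x: "x \<in> Aspace E" and k: "bd x k" and \<mu>: "\<mu> \<in> states E"
  shows "\<theta> x \<mu> (cp e) - \<theta> x \<mu> e \<le> k"
proof -
  have "\<theta> x \<mu> (cp e) - \<theta> x \<mu> e = x (P (cp e) \<mu>) - x (P e \<mu>)"
    using \<mu> states_subset_V by (auto simp: \<theta>_def Top_apply[OF x] field_simps)
  also have "\<dots> \<le> k * \<mu> (cp e) + k * \<mu> e"
    using bd_P[OF x k \<mu>, of e] bd_P[OF x k \<mu>, of "cp e"] by (simp add: abs_le_iff)
  also have "\<mu> (cp e) = 1 - \<mu> e"
    using cone_compl[OF subsetD[OF states_subset_cone \<mu>], of e] \<mu> by (simp add: state_one)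
  also have "k * (1 - \<mu> e) + k * \<mu> e = k" by (simp add: algebra_simps)
  finally show ?thesis .
qed

lemma bd_pr:
  assumes x: "x \<in> Aspace E" "bd x k" and y: "y \<in> Aspace E" "bd y l"
  shows "bd (pr y x) (l * k)"
  unfolding bd_def
proof
  fix \<mu> assume \<mu>: "\<mu> \<in> states E"
  then have \<mu>V: "\<mu> \<in> Vspace E" using states_subset_V by blast
  show "\<bar>pr y x \<mu>\<bar> \<le> l * k"
    using bd_V[OF y \<theta>_V[OF x(1) \<mu>V] \<theta>_diff_le[OF x \<mu>]] \<mu>V by (simp add: pr_def)
qed

lemma \<theta>_linear:
  assumes x: "x \<in> Aspace E" and V: "\<rho> \<in> Vspace E" "\<sigma> \<in> Vspace E"
  shows "\<theta> x (\<rho> + \<sigma>) = \<theta> x \<rho> + \<theta> x \<sigma>" "\<theta> x (c *\<^sub>R \<rho>) = c *\<^sub>R \<theta> x \<rho>"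
  using Top_mem[OF x] V by (auto simp: \<theta>_def fun_eq_iff Aspace_add Aspace_scale)

lemma pr_mem:
  assumes x: "x \<in> Aspace E" and y: "y \<in> Aspace E"
  shows "pr y x \<in> Aspace E"
proof -
  obtain k l where "bd x k" "bd y l" using Aspace_bd x y by blast
  then show ?thesis
    using bd_pr[OF x _ y, of k l] x y
    by (intro AspaceI[of _ "l * k"])
      (auto simp: linear_on_def pr_def V_add V_scale \<theta>_linear Aspace_add Aspace_scale \<theta>_V)
qed

lemma pr_emb:
  assumes x: "x \<in> Aspace E"
  shows "pr (emb E e) x = Top E e x"
proof (rule Aspace_eqI)
  fix \<rho> assume \<rho>: "\<rho> \<in> Vspace E"
  show "pr (emb E e) x \<rho> = Top E e x \<rho>"
    using emb_apply[OF \<theta>_V[OF x \<rho>]] \<rho> by (simp add: pr_def \<theta>_def)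
qed (simp_all add: pr_mem Top_mem x)

lemma Text_eq:
  assumes x: "x \<in> Aspace E"
  shows "Text E x = restrict (\<lambda>y. pr y x) (Aspace E)"
proof -
  let ?L = "restrict (\<lambda>y. pr y x) (Aspace E)"
  have lin: "linear_on (Aspace E) ?L"
    using subspace_Aspace by (auto simp: linear_on_def fun_eq_iff pr_def subspace_add subspace_scale)
  have cont: "continuous_map (weak_star E) (weak_star E) ?L"
  proof (rule weak_star_continuousI)
    show "\<exists>\<sigma>\<in>Vspace E. \<forall>y\<in>Aspace E. ?L y \<rho> = y \<sigma>" if "\<rho> \<in> Vspace E" for \<rho>
      using that \<theta>_V[OF x that] by (intro bexI[of _ "\<theta> x \<rho>"]) (auto simp: pr_def)
  qed (simp add: pr_mem x)
  have emb: "?L (emb E e) = Top E e x" for e by (simp add: pr_emb x)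
  show ?thesis unfolding Text_def
  proof (rule the_equality)
    show "?L \<in> Aspace E \<rightarrow>\<^sub>E Aspace E \<and> linear_on (Aspace E) ?L \<and>
      continuous_map (weak_star E) (weak_star E) ?L \<and> (\<forall>e. ?L (emb E e) = Top E e x)"
      using lin cont emb pr_mem[OF x] by auto
    show "L = ?L" if "L \<in> Aspace E \<rightarrow>\<^sub>E Aspace E \<and> linear_on (Aspace E) L \<and>
      continuous_map (weak_star E) (weak_star E) L \<and> (\<forall>e. L (emb E e) = Top E e x)" for L
      by (rule weak_star_linear_eqI) (use that lin cont emb pr_mem[OF x] in auto)
  qed
qed

lemma sqprod_eq: "x \<in> Aspace E \<Longrightarrow> y \<in> Aspace E \<Longrightarrow> sqprod E y x = pr y x"
  by (simp add: sqprod_def Text_eq)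

end

section \<open>Commutativity\<close>

context i3_ucp
begin

lemma A_add: "x \<in> Aspace E \<Longrightarrow> y \<in> Aspace E \<Longrightarrow> x + y \<in> Aspace E"
  and A_diff: "x \<in> Aspace E \<Longrightarrow> y \<in> Aspace E \<Longrightarrow> x - y \<in> Aspace E"
  and A_scale: "x \<in> Aspace E \<Longrightarrow> c *\<^sub>R x \<in> Aspace E"
  using subspace_Aspace by (auto intro: subspace_add subspace_diff subspace_scale)

lemma pr_apply: "\<rho> \<in> Vspace E \<Longrightarrow> pr y x \<rho> = y (\<theta> x \<rho>)"
  by (simp add: pr_def)

lemma pr_add_left: "pr (x + y) z = pr x z + pr y z"
  and pr_scale_left: "pr (c *\<^sub>R x) z = c *\<^sub>R pr x z"
  by (auto simp: pr_def fun_eq_iff)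

lemma pr_add_right:
  assumes "x \<in> Aspace E" "y \<in> Aspace E" "z \<in> Aspace E"
  shows "pr z (x + y) = pr z x + pr z y"
proof (rule Aspace_eqI)
  fix \<rho> assume \<rho>: "\<rho> \<in> Vspace E"
  have "\<theta> (x + y) \<rho> = \<theta> x \<rho> + \<theta> y \<rho>"
    using assms \<rho> by (auto simp: \<theta>_def fun_eq_iff Top_apply A_add field_simps)
  then have "pr z (x + y) \<rho> = z (\<theta> x \<rho> + \<theta> y \<rho>)" using \<rho> by (simp only: pr_apply)
  also have "\<dots> = pr z x \<rho> + pr z y \<rho>"
    using assms \<rho> by (simp only: pr_apply Aspace_add \<theta>_V)
  finally show "pr z (x + y) \<rho> = (pr z x + pr z y) \<rho>" by simp
qed (use assms in \<open>auto intro!: pr_mem A_add\<close>)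

lemma pr_scale_right:
  assumes "x \<in> Aspace E" "z \<in> Aspace E"
  shows "pr z (c *\<^sub>R x) = c *\<^sub>R pr z x"
proof (rule Aspace_eqI)
  fix \<rho> assume \<rho>: "\<rho> \<in> Vspace E"
  have "\<theta> (c *\<^sub>R x) \<rho> = c *\<^sub>R \<theta> x \<rho>"
    using assms \<rho> by (auto simp: \<theta>_def fun_eq_iff Top_apply A_scale field_simps)
  then have "pr z (c *\<^sub>R x) \<rho> = z (c *\<^sub>R \<theta> x \<rho>)" using \<rho> by (simp only: pr_apply)
  also have "\<dots> = c * pr z x \<rho>"
    using assms \<rho> by (simp only: pr_apply Aspace_scale \<theta>_V)
  finally show "pr z (c *\<^sub>R x) \<rho> = (c *\<^sub>R pr z x) \<rho>" by simp
qed (use assms in \<open>auto intro!: pr_mem A_scale\<close>)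

lemma pr_unit_left: "x \<in> Aspace E \<Longrightarrow> pr (emb E one) x = x"
  by (simp add: pr_emb Top_one)

lemma pr_unit_right:
  assumes x: "x \<in> Aspace E"
  shows "pr x (emb E one) = x"
proof (rule Aspace_eqI)
  fix \<rho> assume \<rho>: "\<rho> \<in> Vspace E"
  have "\<theta> (emb E one) \<rho> = \<rho>" using \<rho> by (simp add: \<theta>_def Top_emb_one)
  then show "pr x (emb E one) \<rho> = x \<rho>" using \<rho> by (simp add: pr_apply)
qed (simp_all add: pr_mem x)

text \<open>A purely algebraic projection onto \<open>A\<close>; no continuity is claimed or
  used.\<close>

definition proj :: "'e functional \<Rightarrow> 'e functional"
  where "proj = (SOME p. range p \<subseteq> Aspace E \<and> linear p \<and> (\<forall>x\<in>Aspace E. p x = x))"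

lemma proj: "range proj \<subseteq> Aspace E" "linear proj" "\<And>x. x \<in> Aspace E \<Longrightarrow> proj x = x"
proof -
  have "\<exists>p. range p \<subseteq> Aspace E \<and> linear p \<and> (\<forall>x\<in>Aspace E. p x = x)"
    using linear_exists_left_inverse_on[OF linear_id subspace_Aspace] by auto
  from someI_ex[OF this] show "range proj \<subseteq> Aspace E" "linear proj" "\<And>x. x \<in> Aspace E \<Longrightarrow> proj x = x"
    unfolding proj_def by blast+
qed

lemma proj_mem: "proj x \<in> Aspace E"
  using proj(1) by blast

text \<open>The symmetrised product, made total so that it is bilinear without side conditions.\<close>

definition sp :: "'e functional \<Rightarrow> 'e functional \<Rightarrow> 'e functional"
  where "sp x y = (1/2) *\<^sub>R (pr (proj x) (proj y) + pr (proj y) (proj x))"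

lemma sp_eq: "x \<in> Aspace E \<Longrightarrow> y \<in> Aspace E \<Longrightarrow> sp x y = (1/2) *\<^sub>R (pr x y + pr y x)"
  by (simp add: sp_def proj)

lemma sp_self: "sp x x = pr (proj x) (proj x)"
  by (simp add: sp_def flip: scaleR_2)

lemma sp_mem: "sp x y \<in> Aspace E"
  unfolding sp_def by (intro A_scale A_add pr_mem proj_mem)

end

locale positive_power_assoc_ucp = i3_ucp E for E :: "'e qlogic" +
  assumes power_assoc_E: "power_associative E"
    and square_pos: "x \<in> Aspace E \<Longrightarrow> nonneg E (sqprod E x x)"
begin

section \<open>The symmetrised product as a power-associative algebra\<close>

lemma sqpow_mem: "x \<in> Aspace E \<Longrightarrow> sqpow E x n \<in> Aspace E"
proof (induction n)
  case (Suc n)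
  then show ?case by (cases n) (simp_all add: sqprod_eq pr_mem)
qed simp

text \<open>Power-associativity makes the powers of one element commute, so symmetrising leaves
  their products unchanged.\<close>

lemma sp_sqpow:
  assumes x: "x \<in> Aspace E"
  shows "sp (sqpow E x n) (sqpow E x m) = sqpow E x (n + m)"
proof (cases "n = 0 \<or> m = 0")
  case True
  then show ?thesis
    using sqpow_mem[OF x, of n] sqpow_mem[OF x, of m]
    by (auto simp: sp_eq pr_unit_left pr_unit_right simp flip: scaleR_2)
next
  case False
  have "pr (sqpow E x i) (sqpow E x j) = sqpow E x (i + j)" if "1 \<le> i" "1 \<le> j" for i j
    using power_assoc_E that x sqpow_mem[OF x] by (simp add: power_associative_def flip: sqprod_eq)
  from this[of n m] this[of m n] show ?thesis
    using False sqpow_mem[OF x] by (simp add: sp_eq add.commute[of m n] flip: scaleR_2)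
qed

lemma sp_power:
  assumes x: "x \<in> Aspace E"
  shows "((sp x) ^^ n) (emb E one) = sqpow E x n"
proof (induction n)
  case (Suc n)
  have "sp x (sqpow E x n) = sqpow E x (Suc n)" using sp_sqpow[OF x, of 1 n] by simp
  then show ?case by (simp add: Suc)
qed simp

sublocale sp: power_assoc_algebra "Aspace E" "(\<lambda>\<mu> x. x \<mu>) ` states E" sp "emb E one"
proof (rule power_assoc_algebra.intro, goal_cases)
  case (1) show ?case by (rule subspace_Aspace)
next
  case (2 \<phi>)
  then obtain \<mu> where "\<phi> = (\<lambda>x. x \<mu>)" by blast
  then show ?case by (simp add: linearI)
next
  case (3 x y) show ?case by (rule sp_mem)
next
  case (4 x y z)
  show ?case unfolding sp_def linear_add[OF proj(2)]
    by (simp only: pr_add_left pr_add_right[OF proj_mem proj_mem proj_mem] scaleR_add_right ac_simps)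
next
  case (5 c x z)
  show ?case unfolding sp_def linear_cmul[OF proj(2)]
    by (simp only: pr_scale_left pr_scale_right[OF proj_mem proj_mem] scaleR_add_right scaleR_left_commute)
next
  case (6 x y) show ?case by (simp add: sp_def add.commute)
next
  case 7 show ?case by simp
next
  case (8 x) then show ?case by (simp add: sp_eq pr_unit_left pr_unit_right flip: scaleR_2)
next
  case (9 \<phi>) then show ?case using states_subset_V state_one by auto
next
  case (10 x)
  show ?case by (rule Aspace_states_eqI) (use 10 subspace_0[OF subspace_Aspace] in auto)
next
  case (11 x)
  then show ?case using Aspace_bd[of x] by (auto simp: bd_def)
next
  case (12 x y a b \<phi>)
  then obtain \<mu> where \<mu>: "\<mu> \<in> states E" "\<phi> = (\<lambda>x. x \<mu>)" by blast
  have bd: "bd x a" "bd y b" using 12 by (auto simp: bd_def)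
  have "\<bar>pr x y \<mu>\<bar> \<le> a * b" "\<bar>pr y x \<mu>\<bar> \<le> b * a"
    using bd_pr[OF 12(2) bd(2) 12(1) bd(1)] bd_pr[OF 12(1) bd(1) 12(2) bd(2)] \<mu>(1) by (auto simp: bd_def)
  then show ?case using 12(1,2) by (simp add: \<mu> sp_eq abs_le_iff mult.commute[of b a])
next
  case (13 \<phi> x)
  then show ?case using square_pos[OF proj_mem[of x]] by (auto simp: sp_self nonneg_def sqprod_eq proj_mem)
next
  case (14 x n m)
  then show ?case by (simp only: sp_power sp_sqpow)
qed

section \<open>Events commute\<close>

lemma sp_pos_iff: "sp.pos x \<longleftrightarrow> (\<forall>\<mu>\<in>states E. 0 \<le> x \<mu>)"
  by (simp add: sp.pos_def)

lemma idem_emb: "sp.idem (emb E e)"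
proof -
  have "pr (emb E e) (emb E e) = emb E e" by (simp add: pr_emb Top_emb_below orth_compl)
  then show ?thesis unfolding sp.idem_def by (simp add: sp_eq flip: scaleR_2)
qed

lemma emb_osum: "orth E e f \<Longrightarrow> emb E (osum E e f) = emb E e + emb E f"
  by (rule Aspace_eqI) (use V_orth_additive in \<open>auto simp: A_add orth_additive_def\<close>)

lemma emb_compl: "emb E (cp e) = emb E one - emb E e"
  by (rule Aspace_eqI) (auto simp: A_diff V_compl)

lemma emb_pos: "sp.pos (emb E e)"
  using sp.idem_pos[OF idem_emb] .

text \<open>The positivity of the Peirce projection makes it a conditional probability, so the uniqueness
  of conditional probabilities identifies it with \<open>U\<close> on events.\<close>

lemma P_eq_peirce1:
  assumes \<mu>: "\<mu> \<in> states E"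
  shows "P e \<mu> f = sp.peirce1 (emb E e) (emb E f) \<mu>"
proof -
  define \<phi> where "\<phi> f = sp.peirce1 (emb E e) (emb E f) \<mu>" for f
  have \<mu>V: "\<mu> \<in> Vspace E" using \<mu> states_subset_V by blast
  have pos: "0 \<le> \<phi> f" for f
    using sp.peirce1_pos[OF idem_emb emb_mem emb_pos, of e f] \<mu> by (simp add: sp_pos_iff \<phi>_def)
  have add: "orth_additive E \<phi>"
    by (auto simp: orth_additive_def \<phi>_def emb_osum linear_add[OF sp.linear_peirce1])
  have "sp.peirce1 (emb E e) (emb E one) = emb E e"
    using idem_emb[of e] by (simp add: sp.peirce1_def sp.idem_def scaleR_2)
  then have one: "\<phi> one = \<mu> e" using \<mu>V by (simp add: \<phi>_def)
  have below: "\<phi> f = \<mu> f" if f: "orth E f (cp e)" for f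
  proof -
    have "sp (emb E e) (emb E f) = emb E f"
      using f by (simp add: sp_eq pr_emb Top_emb_below Top_emb_above flip: scaleR_2)
    then have "sp.peirce1 (emb E e) (emb E f) = emb E f" by (simp add: sp.peirce1_def scaleR_2)
    then show ?thesis using \<mu>V by (simp add: \<phi>_def)
  qed
  have "is_cond e \<mu> \<phi>" using pos add one below by (simp add: is_cond_def pcone_def)
  then have "P e \<mu> = \<phi>" using P_cone[OF subsetD[OF states_subset_cone \<mu>]] rcond_eqI by metis
  then show ?thesis by (simp add: \<phi>_def)
qed

text \<open>With \<open>T\<close> the symmetrised multiplication by \<open>e\<close>, the Peirce
  projections are \<open>2 T^2 - T\<close> and \<open>1 - 3 T + 2 T^2\<close>, and half of the
  identity plus the first minus the second is \<open>T\<close>. So the given product of two events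
  is the symmetrised one.\<close>

lemma pr_emb_comm: "pr (emb E e) (emb E f) = pr (emb E f) (emb E e)"
proof -
  have "Top E e (emb E f) = sp (emb E e) (emb E f)"
  proof (rule Aspace_states_eqI)
    fix \<mu> assume \<mu>: "\<mu> \<in> states E"
    then have \<mu>V: "\<mu> \<in> Vspace E" using states_subset_V by blast
    have "P (cp e) \<mu> f = sp.peirce0 (emb E e) (emb E f) \<mu>"
      by (simp add: P_eq_peirce1[OF \<mu>] emb_compl sp.peirce1_compl)
    then show "Top E e (emb E f) \<mu> = sp (emb E e) (emb E f) \<mu>"
      using \<mu>V by (simp add: Top_apply P_V P_eq_peirce1[OF \<mu>] sp.peirce1_def sp.peirce0_def)
  qed (simp_all add: Top_mem sp_mem)
  then have eq: "pr (emb E e) (emb E f) = (1/2) *\<^sub>R (pr (emb E e) (emb E f) + pr (emb E f) (emb E e))"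
    by (simp add: pr_emb sp_eq)
  have "2 *\<^sub>R pr (emb E e) (emb E f) = pr (emb E e) (emb E f) + pr (emb E f) (emb E e)"
    by (subst eq) simp
  then show ?thesis by (simp add: scaleR_2)
qed

text \<open>By \<open>pr_emb_comm\<close> the functions \<open>\<theta> (emb E e) \<rho>\<close> and
  \<open>\<tau>\<close> agree on events and so are the same element of \<open>V\<close>; evaluating
  \<open>y\<close> at it gives the two products.\<close>

lemma pr_emb_comm_A:
  assumes y: "y \<in> Aspace E"
  shows "pr y (emb E e) = pr (emb E e) y"
proof (rule Aspace_eqI)
  fix \<rho> assume \<rho>: "\<rho> \<in> Vspace E"
  define \<tau> where "\<tau> = (1/2) *\<^sub>R (\<rho> + P e \<rho> - P (cp e) \<rho>)"
  have V: "\<rho> + P e \<rho> \<in> Vspace E" "P (cp e) \<rho> \<in> Vspace E" "\<rho> + P e \<rho> - P (cp e) \<rho> \<in> Vspace E" "P e \<rho> \<in> Vspace E"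
    using \<rho> by (auto intro!: V_add V_diff P_V)
  have "\<theta> (emb E e) \<rho> f = \<tau> f" for f
  proof -
    have "\<theta> (emb E e) \<rho> f = pr (emb E f) (emb E e) \<rho>" by (simp add: \<theta>_def pr_emb)
    also have "\<dots> = Top E e (emb E f) \<rho>" by (simp add: pr_emb_comm[of f e] pr_emb)
    also have "\<dots> = \<tau> f" using \<rho> V by (simp add: Top_apply \<tau>_def)
    finally show ?thesis .
  qed
  then have "\<theta> (emb E e) \<rho> = \<tau>" by blast
  then have "pr y (emb E e) \<rho> = y \<tau>" using \<rho> by (simp only: pr_apply)
  also have "\<dots> = (1/2) * (y \<rho> + y (P e \<rho>) - y (P (cp e) \<rho>))"
    unfolding \<tau>_def Aspace_scale[OF y V(3)] Aspace_diff[OF y V(1,2)] Aspace_add[OF y \<rho> V(4)] by (rule refl)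
  also have "\<dots> = pr (emb E e) y \<rho>" using \<rho> y by (simp add: pr_emb Top_apply)
  finally show "pr y (emb E e) \<rho> = pr (emb E e) y \<rho>" .
qed (simp_all add: pr_mem y)

lemma span_emb_subset: "span (range (emb E)) \<subseteq> Aspace E"
  by (rule span_minimal) (auto simp: subspace_Aspace)

lemma pr_span_comm:
  assumes y: "y \<in> Aspace E" and d: "d \<in> span (range (emb E))"
  shows "pr y d = pr d y"
proof -
  have "span (range (emb E)) \<subseteq> {d \<in> Aspace E. pr y d = pr d y}"
  proof (rule span_minimal)
    show "subspace {d \<in> Aspace E. pr y d = pr d y}"
      using subspace_0[OF subspace_Aspace] pr_scale_left[of 0 0 y] pr_scale_right[of 0 y 0] y
      by (auto simp: subspace_def A_add A_scale pr_add_left pr_scale_left pr_add_right pr_scale_right)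
  qed (auto simp: pr_emb_comm_A y)
  then show ?thesis using d by blast
qed

section \<open>Approximation by linear combinations of events\<close>

lemma sp_cauchy_schwarz:
  assumes "\<mu> \<in> states E"
  shows "(sp x y \<mu>)\<^sup>2 \<le> sp x x \<mu> * sp y y \<mu>"
  using sp.cauchy_schwarz[of "\<lambda>x. x \<mu>" x y] assms by simp

lemma sp_square_nonneg: "\<mu> \<in> states E \<Longrightarrow> 0 \<le> sp x x \<mu>"
  using sp.square_nonneg[of "\<lambda>x. x \<mu>" x] by simp

text \<open>For a near-minimiser \<open>d\<close> put \<open>w = y - d\<close>. Stationarity makes the functional
  \<open>\<kappa> = \<theta> w \<mu> + w \<rho> \<cdot> \<rho>\<close> in \<open>V\<close> small on all events, hence small at \<open>y\<close>; it is also small at \<open>d\<close>,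
  and \<open>\<kappa> y - \<kappa> d\<close> is the quantity that was minimised.\<close>

lemma span_emb_approx:
  assumes y: "y \<in> Aspace E" and \<mu>: "\<mu> \<in> states E" and \<rho>: "\<rho> \<in> Vspace E" and \<delta>: "0 < \<delta>"
  obtains d where "d \<in> span (range (emb E))" "sp (y - d) (y - d) \<mu> + ((y - d) \<rho>)\<^sup>2 < \<delta>"
proof -
  let ?M = "span (range (emb E))"
  have \<mu>V: "\<mu> \<in> Vspace E" using \<mu> states_subset_V by blast
  \<comment> \<open>The rank-one term controls the error at \<open>\<rho>\<close> as well;
    \<open>pr_comm\<close> needs this at \<open>\<theta> z \<mu>\<close>, which the seminorm of the
    squares does not control.\<close>
  define B where "B a b = sp a b \<mu> + a \<rho> * b \<rho>" for a b
  have B_nonneg: "0 \<le> B a a" for a using sp_square_nonneg[OF \<mu>] by (simp add: B_def)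
  have B_lin: "B (a + b) c = B a c + B b c" "B (r *\<^sub>R a) c = r * B a c" "B a b = B b a" for a b c r
    by (simp_all add: B_def sp.bilin sp.comm[of a b] algebra_simps)
  have B_lin_right: "B c (a + b) = B c a + B c b" "B c (r *\<^sub>R a) = r * B c a" for a b c r
    using B_lin by metis+
  have B_diff: "B (a - b) c = B a c - B b c" "B c (a - b) = B c a - B c b" for a b c
    using B_lin(1)[of a "(-1) *\<^sub>R b" c] B_lin(2)[of "-1" b c] B_lin_right(1)[of c a "(-1) *\<^sub>R b"] B_lin_right(2)[of c "-1" b]
    by simp_all
  obtain k where k: "bd y k" using Aspace_bd[OF y] by blast
  obtain R where R: "\<And>e. \<bar>\<rho> e\<bar> \<le> R" using V_bounded[OF \<rho>] by (auto simp: bounded_iff)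
  have R0: "0 \<le> R" using R[of one] by linarith
  \<comment> \<open>\<open>K^2\<close> bounds \<open>B\<close> on the diagonal at events, and
    \<open>L\<close> in the next line bounds it at the near-minimiser.\<close>
  define K where "K = 1 + R"
  define L where "L = 4 * B y y + 2"
  have L: "0 < L" using B_nonneg[of y] by (simp add: L_def)
  define J where "J d = B (y - d) (y - d)" for d
  define m where "m = (INF d\<in>?M. J d)"
  have bdd: "bdd_below (J ` ?M)" by (rule bdd_belowI2[of _ 0]) (simp add: J_def B_nonneg)
  have m_le: "m \<le> J d" if "d \<in> ?M" for d unfolding m_def by (rule cINF_lower[OF bdd that])
  have near: "\<exists>d\<in>?M. J d \<le> \<eta> * (2 * k * K + (L + 1))" if \<eta>: "0 < \<eta>" "\<eta> \<le> 1" for \<eta>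
  proof -
    have "\<exists>d\<in>?M. J d < m + \<eta>\<^sup>2"
      using cInf_lessD[of "J ` ?M" "m + \<eta>\<^sup>2"] \<eta> span_zero by (auto simp: m_def)
    then obtain d where d: "d \<in> ?M" "J d < m + \<eta>\<^sup>2" by blast
    define w where "w = y - d"
    have dA: "d \<in> Aspace E" using d(1) span_emb_subset by blast
    have wA: "w \<in> Aspace E" unfolding w_def by (rule A_diff[OF y dA])
    \<comment> \<open>Approximate orthogonality to the span: moving \<open>d\<close> along
      \<open>c\<close> lowers \<open>J\<close> by at most \<open>\<eta>^2\<close>, so the
      discriminant of the quadratic in \<open>t\<close> gives the bound.\<close>
    have stat: "(B c w)\<^sup>2 \<le> \<eta>\<^sup>2 * B c c" if c: "c \<in> ?M" for c
    proof -
      have q: "0 \<le> \<eta>\<^sup>2 - 2 * t * B c w + t\<^sup>2 * B c c" for t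
      proof -
        have "d + t *\<^sub>R c \<in> ?M" by (intro span_add span_scale d c)
        then have "m \<le> J (d + t *\<^sub>R c)" by (rule m_le)
        also have "J (d + t *\<^sub>R c) = B (w - t *\<^sub>R c) (w - t *\<^sub>R c)" by (simp add: J_def w_def diff_diff_eq)
        also have "\<dots> = B w w - 2 * t * B c w + t\<^sup>2 * B c c"
          by (simp add: B_diff B_lin B_lin_right B_lin(3)[of w c] power2_eq_square algebra_simps)
        finally show ?thesis using d(2) by (simp add: J_def w_def)
      qed
      show ?thesis
      proof (cases "B c c = 0")
        case True
        have "B c w = 0"
        proof (rule ccontr)
          assume n: "B c w \<noteq> 0"
          have "0 \<le> \<eta>\<^sup>2 - 2 * ((\<eta>\<^sup>2 + 1) / (2 * B c w)) * B c w" using q[of "(\<eta>\<^sup>2 + 1) / (2 * B c w)"] True by simp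
          then show False using n by (simp add: field_simps)
        qed
        then show ?thesis using B_nonneg[of c] by simp
      next
        case False
        then have cc: "0 < B c c" using B_nonneg[of c] by simp
        have "0 \<le> B c c * (\<eta>\<^sup>2 - 2 * (B c w / B c c) * B c w + (B c w / B c c)\<^sup>2 * B c c)"
          using q[of "B c w / B c c"] cc by (simp only: zero_le_mult_iff) simp
        also have "\<dots> = \<eta>\<^sup>2 * B c c - (B c w)\<^sup>2" using cc by (simp add: field_simps power2_eq_square)
        finally show ?thesis by simp
      qed
    qed
    define \<kappa> where "\<kappa> = \<theta> w \<mu> + w \<rho> *\<^sub>R \<rho>"
    have V: "\<theta> w \<mu> \<in> Vspace E" "w \<rho> *\<^sub>R \<rho> \<in> Vspace E" using wA \<mu>V \<rho> by (auto intro!: \<theta>_V V_scale)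
    have \<kappa>V: "\<kappa> \<in> Vspace E" unfolding \<kappa>_def by (rule V_add[OF V])
    have \<kappa>_at: "x \<kappa> = pr x w \<mu> + w \<rho> * x \<rho>" if x: "x \<in> Aspace E" for x
      unfolding \<kappa>_def Aspace_add[OF x V] Aspace_scale[OF x \<rho>] pr_apply[OF \<mu>V] by simp
    have \<kappa>_M: "c \<kappa> = B c w" if c: "c \<in> ?M" for c
    proof -
      have cA: "c \<in> Aspace E" using c span_emb_subset by blast
      \<comment> \<open>The functional \<open>\<kappa>\<close> evaluates the given product, whereas
        \<open>B\<close> uses the symmetrised one; on the span of the events they agree by
        \<open>pr_span_comm\<close>.\<close>
      have "sp c w = pr c w" using pr_span_comm[OF wA c] by (simp add: sp_eq[OF cA wA] flip: scaleR_2)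
      then show ?thesis by (simp add: \<kappa>_at[OF cA] B_def)
    qed
    have \<kappa>_small: "\<bar>\<kappa> e\<bar> \<le> \<eta> * K" for e
    proof -
      have c: "emb E e \<in> ?M" by (rule span_base) simp
      have e: "\<kappa> e = B (emb E e) w" using \<kappa>_M[OF c] \<kappa>V by simp
      have "sp (emb E e) (emb E e) = emb E e" using idem_emb[of e] by (simp add: sp.idem_def)
      then have "B (emb E e) (emb E e) = \<mu> e + (\<rho> e)\<^sup>2" using \<mu>V \<rho> by (simp add: B_def power2_eq_square)
      also have "\<dots> \<le> 1 + R\<^sup>2" using \<mu> R[of e] power_mono[of "\<bar>\<rho> e\<bar>" R 2] by (intro add_mono) (auto simp: states_def)
      also have "\<dots> \<le> K\<^sup>2" using R0 by (simp add: K_def power2_eq_square algebra_simps)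
      finally have "\<eta>\<^sup>2 * B (emb E e) (emb E e) \<le> \<eta>\<^sup>2 * K\<^sup>2" by (rule mult_left_mono) simp
      then have "(\<kappa> e)\<^sup>2 \<le> (\<eta> * K)\<^sup>2" using stat[OF c] e by (simp add: power_mult_distrib)
      then show ?thesis using R0 \<eta> by (simp add: K_def abs_le_square_iff[symmetric])
    qed
    have "\<bar>y \<kappa>\<bar> \<le> k * (2 * (\<eta> * K))"
    proof (rule bd_V[OF y k \<kappa>V])
      show "\<kappa> (cp e) - \<kappa> e \<le> 2 * (\<eta> * K)" for e using \<kappa>_small[of e] \<kappa>_small[of "cp e"] by linarith
    qed
    moreover have "\<bar>B d w\<bar> \<le> \<eta> * (L + 1)"
    proof -
      \<comment> \<open>The competitor 0 lies in the span, so the infimum is at most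
        \<open>B y y\<close>; the parallelogram identity below then bounds
        \<open>B d d\<close>.\<close>
      have "B w w \<le> B y y + \<eta>\<^sup>2" using d(2) m_le[OF span_zero] by (simp add: J_def w_def)
      moreover have "0 \<le> B (y + w) (y + w)" by (rule B_nonneg)
      moreover have "B d d + B (y + w) (y + w) = 2 * B y y + 2 * B w w"
      proof -
        have "d = y - w" by (simp add: w_def)
        then show ?thesis by (simp add: B_diff B_lin B_lin_right)
      qed
      moreover have "\<eta>\<^sup>2 \<le> 1" using \<eta> by (simp add: abs_square_le_1)
      ultimately have "B d d \<le> L" by (simp add: L_def)
      also have "\<dots> \<le> (L + 1)\<^sup>2" using L by (simp add: power2_eq_square algebra_simps)
      finally have "\<eta>\<^sup>2 * B d d \<le> \<eta>\<^sup>2 * (L + 1)\<^sup>2" by (rule mult_left_mono) simp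
      then have "(B d w)\<^sup>2 \<le> (\<eta> * (L + 1))\<^sup>2" using stat[OF d(1)] by (simp add: power_mult_distrib)
      then show ?thesis using L \<eta> by (simp add: abs_le_square_iff[symmetric])
    qed
    moreover have "J d = y \<kappa> - B d w"
    proof -
      have "y \<kappa> - d \<kappa> = w \<kappa>" by (simp add: w_def)
      also have "\<dots> = B w w" using wA by (simp add: \<kappa>_at B_def sp_eq flip: scaleR_2)
      finally show ?thesis using \<kappa>_M[OF d(1)] by (simp add: J_def w_def)
    qed
    ultimately have "J d \<le> k * (2 * (\<eta> * K)) + \<eta> * (L + 1)" by linarith
    then show ?thesis using d(1) by (intro bexI[of _ d]) (simp_all add: algebra_simps)
  qed
  define C where "C = 2 * k * K + (L + 1)"
  have C: "0 < C" using bd_nonneg[OF k] R0 L by (auto simp: C_def K_def intro!: add_nonneg_pos)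
  define \<eta> where "\<eta> = min 1 (\<delta> / (2 * C))"
  have \<eta>: "0 < \<eta>" "\<eta> \<le> 1" using C \<delta> by (auto simp: \<eta>_def)
  then obtain d where d: "d \<in> ?M" "J d \<le> \<eta> * C" using near[of \<eta>] by (auto simp: C_def)
  have "\<eta> * C \<le> (\<delta> / (2 * C)) * C" using C by (intro mult_right_mono) (auto simp: \<eta>_def)
  also have "\<dots> < \<delta>" using C \<delta> by simp
  finally have "J d < \<delta>" using d(2) by simp
  then show thesis using that[OF d(1)] by (simp add: J_def B_def power2_eq_square)
qed

text \<open>Let \<open>d\<close> be a combination of events close to \<open>y\<close>, and
  \<open>w = y - d\<close>. As \<open>d\<close> commutes with \<open>z\<close>, the commutator of
  \<open>y\<close> and \<open>z\<close> is that of \<open>w\<close> and \<open>z\<close>, namely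
  \<open>2 pr w z - 2 sp w z\<close>. The first term is \<open>w\<close> evaluated at
  \<open>\<theta> z \<mu>\<close>, the second is small by Cauchy-Schwarz, and
  \<open>span_emb_approx\<close> controls both at once.\<close>

lemma pr_comm:
  assumes y: "y \<in> Aspace E" and z: "z \<in> Aspace E"
  shows "pr y z = pr z y"
proof (rule Aspace_states_eqI)
  fix \<mu> assume \<mu>: "\<mu> \<in> states E"
  have \<mu>V: "\<mu> \<in> Vspace E" using \<mu> states_subset_V by blast
  define Z where "Z = sp z z \<mu>"
  have Z: "0 \<le> Z" by (simp add: Z_def sp_square_nonneg[OF \<mu>])
  define t where "t = pr y z \<mu> - pr z y \<mu>"
  have "t\<^sup>2 \<le> \<epsilon>" if \<epsilon>: "0 < \<epsilon>" for \<epsilon>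
  proof -
    obtain d where d: "d \<in> span (range (emb E))"
      "sp (y - d) (y - d) \<mu> + ((y - d) (\<theta> z \<mu>))\<^sup>2 < \<epsilon> / (8 * (1 + Z))"
      using span_emb_approx[OF y \<mu> \<theta>_V[OF z \<mu>V], of "\<epsilon> / (8 * (1 + Z))"] \<epsilon> Z by auto
    define w where "w = y - d"
    have dA: "d \<in> Aspace E" using d(1) span_emb_subset by blast
    have wA: "w \<in> Aspace E" unfolding w_def by (rule A_diff[OF y dA])
    have ywd: "y = w + d" by (simp add: w_def)
    have t: "t = 2 * pr w z \<mu> - 2 * sp w z \<mu>"
      using pr_span_comm[OF z d(1)]
      by (simp add: t_def ywd pr_add_left pr_add_right wA dA z sp_eq field_simps)
    have "t\<^sup>2 = 4 * (pr w z \<mu> - sp w z \<mu>)\<^sup>2" unfolding t by (simp add: power2_eq_square algebra_simps)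
    also have "\<dots> \<le> 8 * (pr w z \<mu>)\<^sup>2 + 8 * (sp w z \<mu>)\<^sup>2"
      using zero_le_power2[of "pr w z \<mu> + sp w z \<mu>"] by (simp add: power2_eq_square algebra_simps)
    also have "\<dots> \<le> 8 * (pr w z \<mu>)\<^sup>2 + 8 * (sp w w \<mu> * Z)"
      using sp_cauchy_schwarz[OF \<mu>, of w z] by (simp add: Z_def)
    also have "\<dots> \<le> 8 * (1 + Z) * (sp w w \<mu> + (pr w z \<mu>)\<^sup>2)"
      using Z sp_square_nonneg[OF \<mu>, of w] by (simp add: algebra_simps)
    also have "\<dots> \<le> 8 * (1 + Z) * (\<epsilon> / (8 * (1 + Z)))"
      using d(2) Z \<mu>V by (intro mult_left_mono) (auto simp: w_def pr_apply)
    also have "\<dots> = \<epsilon>" using Z by simp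
    finally show ?thesis .
  qed
  then have "t\<^sup>2 \<le> 0" by (rule field_le_epsilon[of _ 0, simplified])
  then show "pr y z \<mu> = pr z y \<mu>" by (simp add: t_def)
qed (simp_all add: pr_mem y z)

section \<open>Completeness and separate continuity\<close>

lemma sp_eq_pr: "x \<in> Aspace E \<Longrightarrow> y \<in> Aspace E \<Longrightarrow> sp x y = pr x y"
  by (simp add: sp_eq pr_comm[of y x] flip: scaleR_2)

lemma sp_apply: "x \<in> Aspace E \<Longrightarrow> y \<in> Aspace E \<Longrightarrow> \<rho> \<in> Vspace E \<Longrightarrow> sp y x \<rho> = x (\<theta> y \<rho>)"
  by (simp add: sp.comm[of y x] sp_eq_pr pr_apply)

lemma tendsto_V:
  assumes X: "\<And>n::nat. X n \<in> Aspace E" and x: "x \<in> Aspace E"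
    and lim: "\<And>\<mu>. \<mu> \<in> states E \<Longrightarrow> (\<lambda>n. X n \<mu>) \<longlonglongrightarrow> x \<mu>" and \<rho>: "\<rho> \<in> Vspace E"
  shows "(\<lambda>n. X n \<rho>) \<longlonglongrightarrow> x \<rho>"
proof -
  obtain s t \<mu> \<nu> where *: "\<mu> \<in> states E" "\<nu> \<in> states E" "\<rho> = s *\<^sub>R \<mu> - t *\<^sub>R \<nu>"
    by (rule Vspace_cases[OF \<rho>])
  then have V: "\<mu> \<in> Vspace E" "\<nu> \<in> Vspace E" using states_subset_V by auto
  show ?thesis
    unfolding *(3) linear_on_V_diff[OF Aspace_linear[OF X] V] linear_on_V_diff[OF Aspace_linear[OF x] V]
    by (intro tendsto_intros lim *)
qed

text \<open>Completeness holds because a pointwise limit of functionals with a common bound is again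
  one. By commutativity the value of \<open>sp y x\<close> at \<open>\<mu>\<close> is
  \<open>x\<close> evaluated at \<open>\<theta> y \<mu>\<close>, an element of \<open>V\<close>
  independent of \<open>x\<close>; this gives the continuity.\<close>

sublocale sp: complete_power_assoc_algebra "Aspace E" "(\<lambda>\<mu> x. x \<mu>) ` states E" sp "emb E one"
proof (rule complete_power_assoc_algebra.intro[OF sp.power_assoc_algebra_axioms
      complete_power_assoc_algebra_axioms.intro], goal_cases)
  case (1 X k)
  have conv: "convergent (\<lambda>n. X n \<rho>)" if \<rho>: "\<rho> \<in> Vspace E" for \<rho>
  proof -
    obtain s t \<mu> \<nu> where *: "\<mu> \<in> states E" "\<nu> \<in> states E" "\<rho> = s *\<^sub>R \<mu> - t *\<^sub>R \<nu>"
      by (rule Vspace_cases[OF \<rho>])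
    then have V: "\<mu> \<in> Vspace E" "\<nu> \<in> Vspace E" using states_subset_V by auto
    have "convergent (\<lambda>n. X n \<mu>)" "convergent (\<lambda>n. X n \<nu>)"
      using 1(3)[OF imageI[OF *(1)]] 1(3)[OF imageI[OF *(2)]] by simp_all
    then obtain a b where "(\<lambda>n. X n \<mu>) \<longlonglongrightarrow> a" "(\<lambda>n. X n \<nu>) \<longlonglongrightarrow> b"
      unfolding convergent_def by blast
    then have "(\<lambda>n. X n \<rho>) \<longlonglongrightarrow> s * a - t * b"
      unfolding *(3) linear_on_V_diff[OF Aspace_linear[OF 1(1)] V] by (intro tendsto_intros)
    then show ?thesis by (rule convergentI)
  qed
  define x where "x \<rho> = (if \<rho> \<in> Vspace E then lim (\<lambda>n. X n \<rho>) else 0)" for \<rho>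
  have lim: "(\<lambda>n. X n \<rho>) \<longlonglongrightarrow> x \<rho>" if "\<rho> \<in> Vspace E" for \<rho>
    using conv[OF that] that by (simp add: x_def convergent_LIMSEQ_iff)
  have "linear_on (Vspace E) x"
    unfolding linear_on_def
  proof (intro conjI ballI allI)
    fix \<rho> \<sigma> assume V: "\<rho> \<in> Vspace E" "\<sigma> \<in> Vspace E"
    have "(\<lambda>n. X n (\<rho> + \<sigma>)) \<longlonglongrightarrow> x \<rho> + x \<sigma>"
      unfolding Aspace_add[OF 1(1) V] by (intro tendsto_intros lim V)
    then show "x (\<rho> + \<sigma>) = x \<rho> + x \<sigma>" by (rule LIMSEQ_unique[OF lim[OF V_add[OF V]]])
  next
    fix c \<rho> assume V: "\<rho> \<in> Vspace E"
    have "(\<lambda>n. X n (c *\<^sub>R \<rho>)) \<longlonglongrightarrow> c * x \<rho>"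
      unfolding Aspace_scale[OF 1(1) V] by (intro tendsto_intros lim V)
    then have "x (c *\<^sub>R \<rho>) = c * x \<rho>" by (rule LIMSEQ_unique[OF lim[OF V_scale[OF V]]])
    then show "x (c *\<^sub>R \<rho>) = c *\<^sub>R x \<rho>" by simp
  qed
  moreover have "bd x k"
    unfolding bd_def
  proof
    fix \<mu> assume \<mu>: "\<mu> \<in> states E"
    show "\<bar>x \<mu>\<bar> \<le> k"
    proof (rule LIMSEQ_le_const2[OF tendsto_rabs[OF lim]])
      show "\<mu> \<in> Vspace E" using \<mu> states_subset_V by blast
      show "\<exists>N. \<forall>n\<ge>N. \<bar>X n \<mu>\<bar> \<le> k" using 1(2)[OF imageI[OF \<mu>]] by simp
    qed
  qed
  ultimately have "x \<in> Aspace E" by (rule AspaceI) (simp add: x_def)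
  moreover have "(\<lambda>n. X n \<mu>) \<longlonglongrightarrow> x \<mu>" if "\<mu> \<in> states E" for \<mu>
    by (rule lim) (use that states_subset_V in blast)
  ultimately show ?case by (intro bexI[of _ x]) simp_all
next
  case (2 X x y \<phi>)
  then obtain \<mu> where \<mu>: "\<mu> \<in> states E" "\<phi> = (\<lambda>x. x \<mu>)" by blast
  have \<mu>V: "\<mu> \<in> Vspace E" using \<mu> states_subset_V by blast
  have "(\<lambda>n. X n (\<theta> y \<mu>)) \<longlonglongrightarrow> x (\<theta> y \<mu>)"
    by (rule tendsto_V[OF 2(1,2) 2(3)[OF imageI] \<theta>_V[OF 2(4) \<mu>V]])
  then show ?case unfolding \<mu>(2) sp_apply[OF 2(1) 2(4) \<mu>V] sp_apply[OF 2(2) 2(4) \<mu>V] .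
qed

text \<open>Reduces a weak-star neighbourhood to a single seminorm
  \<open>x \<mapsto> sqrt (sp x x \<phi>)\<close>. For one evaluation at
  \<open>s \<mu> - t \<nu>\<close> the estimate \<open>(a - b)^2 \<le> 2 a^2 + 2 b^2\<close> and
  Cauchy-Schwarz suffice; finitely many are handled by adding.\<close>

lemma eval_square_dominated:
  assumes "finite F" "F \<subseteq> Vspace E"
  shows "\<exists>\<phi>\<in>pcone. \<forall>\<rho>\<in>F. \<forall>x\<in>Aspace E. (x \<rho>)\<^sup>2 \<le> sp x x \<phi>"
  using assms
proof (induction F rule: finite_induct)
  case empty
  then show ?case using cone_zero by blast
next
  case (insert \<rho> F)
  then obtain \<phi> where \<phi>: "\<phi> \<in> pcone" "\<And>\<rho> x. \<rho> \<in> F \<Longrightarrow> x \<in> Aspace E \<Longrightarrow> (x \<rho>)\<^sup>2 \<le> sp x x \<phi>" by auto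
  have \<rho>: "\<rho> \<in> Vspace E" using insert.prems by simp
  obtain s t \<mu> \<nu> where *: "\<mu> \<in> states E" "\<nu> \<in> states E" "\<rho> = s *\<^sub>R \<mu> - t *\<^sub>R \<nu>"
    by (rule Vspace_cases[OF \<rho>])
  then have V: "\<mu> \<in> Vspace E" "\<nu> \<in> Vspace E" using states_subset_V by auto
  define \<psi> where "\<psi> = (2 * s\<^sup>2) *\<^sub>R \<mu> + (2 * t\<^sup>2) *\<^sub>R \<nu>"
  have c: "(2 * s\<^sup>2) *\<^sub>R \<mu> \<in> pcone" "(2 * t\<^sup>2) *\<^sub>R \<nu> \<in> pcone"
    using * states_subset_cone by (auto intro: cone_scale)
  then have \<psi>: "\<psi> \<in> pcone" unfolding \<psi>_def by (rule cone_add)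
  have at_\<psi>: "sp x x \<psi> = 2 * s\<^sup>2 * sp x x \<mu> + 2 * t\<^sup>2 * sp x x \<nu>" for x
    unfolding \<psi>_def using c cone_subset_V V by (subst Aspace_add[OF sp_mem]) (auto simp: Aspace_scale[OF sp_mem])
  have nonneg: "0 \<le> sp x x \<psi>" "0 \<le> sp x x \<phi>" for x
  proof -
    show "0 \<le> sp x x \<psi>" unfolding at_\<psi> using sp_square_nonneg * by simp
    obtain \<tau> where \<tau>: "\<tau> \<in> states E" "\<phi> = \<phi> one *\<^sub>R \<tau>" using coneE[OF \<phi>(1)] by blast
    have "sp x x \<phi> = \<phi> one * sp x x \<tau>"
      using Aspace_scale[OF sp_mem, of \<tau> x x "\<phi> one"] \<tau> states_subset_V by auto
    then show "0 \<le> sp x x \<phi>" using sp_square_nonneg[OF \<tau>(1)] cone_nonneg[OF \<phi>(1), of one] by simp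
  qed
  have "(x \<rho>)\<^sup>2 \<le> sp x x \<psi>" if x: "x \<in> Aspace E" for x
  proof -
    have sq: "(x \<tau>)\<^sup>2 \<le> sp x x \<tau>" if "\<tau> \<in> states E" for \<tau>
      using sp.state_square_le[of "\<lambda>x. x \<tau>" x] that x by simp
    have x\<rho>: "x \<rho> = s * x \<mu> - t * x \<nu>" unfolding *(3) by (rule linear_on_V_diff[OF Aspace_linear[OF x] V])
    have "(x \<rho>)\<^sup>2 = 2 * (s\<^sup>2 * (x \<mu>)\<^sup>2) + 2 * (t\<^sup>2 * (x \<nu>)\<^sup>2) - (s * x \<mu> + t * x \<nu>)\<^sup>2"
      unfolding x\<rho> by (simp add: power2_eq_square algebra_simps)
    also have "\<dots> \<le> 2 * (s\<^sup>2 * sp x x \<mu>) + 2 * (t\<^sup>2 * sp x x \<nu>) - 0"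
      by (intro diff_mono add_mono mult_left_mono sq *) auto
    finally show ?thesis by (simp add: at_\<psi>)
  qed
  moreover have "sp x x (\<phi> + \<psi>) = sp x x \<phi> + sp x x \<psi>" for x
    using \<phi>(1) \<psi> cone_subset_V by (intro Aspace_add[OF sp_mem]) auto
  ultimately have "\<forall>\<sigma>\<in>insert \<rho> F. \<forall>x\<in>Aspace E. (x \<sigma>)\<^sup>2 \<le> sp x x (\<phi> + \<psi>)"
    using \<phi>(2) nonneg by (auto intro: add_increasing add_increasing2)
  then show ?case using cone_add[OF \<phi>(1) \<psi>] by blast
qed

text \<open>The functional \<open>\<tau> x = (2 p \<odot> x - x) \<phi>\<close> is maximal at \<open>p\<close> among the \<open>x\<close> with \<open>0 \<le> x \<le> 1\<close>, and
  \<open>\<tau> p - \<tau> f = ((f - p)\<^sup>2) \<phi>\<close> for an event \<open>f\<close>. A Hahn-Jordan decomposition of \<open>\<tau>\<close> yields an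
  event that nearly maximises \<open>\<tau>\<close>.\<close>

lemma idem_approx:
  assumes p: "sp.idem p" and \<phi>: "\<phi> \<in> pcone" and \<delta>: "0 < \<delta>"
  shows "\<exists>f. sp (emb E f - p) (emb E f - p) \<phi> < \<delta>"
proof -
  have pA: "p \<in> Aspace E" using p by simp
  have \<phi>V: "\<phi> \<in> Vspace E" using \<phi> cone_subset_V by blast
  define \<tau> where "\<tau> = 2 *\<^sub>R \<theta> p \<phi> - \<phi>"
  have V: "\<theta> p \<phi> \<in> Vspace E" "2 *\<^sub>R \<theta> p \<phi> \<in> Vspace E" using \<theta>_V[OF pA \<phi>V] V_scale by auto
  have \<tau>V: "\<tau> \<in> Vspace E" unfolding \<tau>_def by (rule V_diff[OF V(2) \<phi>V])
  have \<tau>_at: "x \<tau> = 2 * sp p x \<phi> - x \<phi>" if x: "x \<in> Aspace E" for x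
    unfolding \<tau>_def Aspace_diff[OF x V(2) \<phi>V] Aspace_scale[OF x V(1)] sp_apply[OF x pA \<phi>V] by (rule refl)
  obtain R where R: "\<And>e. \<bar>\<tau> e\<bar> \<le> R" using V_bounded[OF \<tau>V] by (auto simp: bounded_iff)
  have R0: "0 \<le> R" using R[of one] by linarith
  \<comment> \<open>The bound 1/4 keeps \<open>1 - 2 \<epsilon>\<close> at least 1/2, so that
    \<open>s + t \<le> 4 R\<close>; the other bound then makes the loss
    \<open>(s + t) \<epsilon>\<close> at most \<open>\<delta> / 2\<close>.\<close>
  define \<epsilon> where "\<epsilon> = min (1/4) (\<delta> / (8 * (R + 1)))"
  have \<epsilon>: "0 < \<epsilon>" "\<epsilon> \<le> 1/4"
    unfolding \<epsilon>_def by (use \<delta> R0 in simp, rule min.cobounded1)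
  obtain s t \<mu> \<nu> e where *: "\<mu> \<in> states E" "\<nu> \<in> states E" "0 \<le> s" "0 \<le> t" "\<tau> = s *\<^sub>R \<mu> - t *\<^sub>R \<nu>"
    "\<mu> e < \<epsilon>" "\<nu> (cp e) < \<epsilon>" "(s + t) * (1 - 2 * \<epsilon>) \<le> \<tau> (cp e) - \<tau> e"
    using hahn_jordan_V[OF \<tau>V \<epsilon>(1)] by metis
  have st: "s + t \<le> 4 * R"
  proof -
    have "(s + t) * (1 / 2) \<le> (s + t) * (1 - 2 * \<epsilon>)" using \<epsilon> * by (intro mult_left_mono) auto
    also have "\<dots> \<le> 2 * R" using *(8) R[of e] R[of "cp e"] by linarith
    finally show ?thesis by simp
  qed
  define f where "f = cp e"
  have p01: "0 \<le> p \<nu>" "p \<mu> \<le> 1"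
    using sp.idem_state[OF p, of "\<lambda>x. x \<mu>"] sp.idem_state[OF p, of "\<lambda>x. x \<nu>"] * by auto
  have f\<mu>: "\<mu> f = 1 - \<mu> e"
    using cone_compl[OF subsetD[OF states_subset_cone *(1)], of e] * by (simp add: f_def state_one)
  have "p \<tau> - \<tau> f = s * (p \<mu> - \<mu> f) - t * (p \<nu> - \<nu> f)"
  proof -
    have "p \<tau> = s * p \<mu> - t * p \<nu>"
      unfolding *(5) by (rule linear_on_V_diff[OF Aspace_linear[OF pA]]) (use * states_subset_V in auto)
    moreover have "\<tau> f = s * \<mu> f - t * \<nu> f" by (simp add: *(5))
    ultimately show ?thesis by (simp add: algebra_simps)
  qed
  also have "\<dots> \<le> s * \<epsilon> + t * \<epsilon>"
  proof -
    have "s * (p \<mu> - \<mu> f) \<le> s * \<epsilon>" using p01 f\<mu> * by (intro mult_left_mono) auto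
    moreover have "t * (\<nu> f - p \<nu>) \<le> t * \<epsilon>" using p01 * by (intro mult_left_mono) (auto simp: f_def)
    ultimately show ?thesis by (simp add: algebra_simps)
  qed
  also have "\<dots> = (s + t) * \<epsilon>" by (simp add: algebra_simps)
  also have "\<dots> \<le> (4 * R) * \<epsilon>" using st \<epsilon> by (intro mult_right_mono) auto
  also have "\<dots> \<le> (4 * (R + 1)) * (\<delta> / (8 * (R + 1)))" using R0 \<epsilon> by (intro mult_mono) (auto simp: \<epsilon>_def)
  also have "\<dots> = \<delta> / 2" using R0 by (simp add: field_simps)
  also have "\<dots> < \<delta>" using \<delta> by simp
  finally have "p \<tau> - \<tau> f < \<delta>" .
  moreover have "sp (emb E f - p) (emb E f - p) \<phi> = p \<tau> - \<tau> f"
  proof -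
    have "sp (emb E f - p) (emb E f - p) \<phi> = \<phi> f - 2 * sp p (emb E f) \<phi> + p \<phi>"
      using p idem_emb[of f] \<phi>V by (simp add: sp.bilin sp.idem_def sp.comm[of "emb E f" p])
    moreover have "p \<tau> = p \<phi>" using \<tau>_at[OF pA] p by (simp add: sp.idem_def)
    moreover have "\<tau> f = 2 * sp p (emb E f) \<phi> - \<phi> f" using \<tau>_at[OF emb_mem, of f] \<tau>V \<phi>V by simp
    ultimately show ?thesis by simp
  qed
  ultimately show ?thesis by (intro exI[of _ f]) simp
qed

lemma idem_in_closure:
  assumes p: "sp.idem p"
  shows "p \<in> weak_star E closure_of range (emb E)"
  unfolding in_closure_of topspace_weak_star
proof (intro conjI allI impI)
  show "p \<in> Aspace E" using p by simp
  fix T assume T: "p \<in> T \<and> openin (weak_star E) T"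
  then obtain F \<epsilon> where F: "finite F" "F \<subseteq> Vspace E" "0 < \<epsilon>"
    "{x \<in> Aspace E. \<forall>\<rho>\<in>F. \<bar>x \<rho> - p \<rho>\<bar> < \<epsilon>} \<subseteq> T"
    using weak_star_nbhd[of T p] by blast
  obtain \<phi> where \<phi>: "\<phi> \<in> pcone" "\<forall>\<rho>\<in>F. \<forall>x\<in>Aspace E. (x \<rho>)\<^sup>2 \<le> sp x x \<phi>"
    using eval_square_dominated[OF F(1,2)] by blast
  obtain f where f: "sp (emb E f - p) (emb E f - p) \<phi> < \<epsilon>\<^sup>2"
    using idem_approx[OF p \<phi>(1), of "\<epsilon>\<^sup>2"] F(3) by auto
  have "\<bar>emb E f \<rho> - p \<rho>\<bar> < \<epsilon>" if "\<rho> \<in> F" for \<rho>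
  proof -
    have "emb E f - p \<in> Aspace E" using p by (simp add: A_diff)
    then have "(emb E f \<rho> - p \<rho>)\<^sup>2 < \<epsilon>\<^sup>2" using \<phi>(2) that f by fastforce
    then show ?thesis using F(3) by (intro power2_less_imp_less[of "\<bar>emb E f \<rho> - p \<rho>\<bar>"]) simp_all
  qed
  then have "emb E f \<in> T" using F(4) by auto
  then show "\<exists>y. y \<in> range (emb E) \<and> y \<in> T" by blast
qed

lemma sqprod_sp: "x \<in> Aspace E \<Longrightarrow> y \<in> Aspace E \<Longrightarrow> sqprod E x y = sp x y"
  by (simp add: sqprod_eq sp_eq_pr)

lemma jordan_algebra: "jordan_algebra_on (Aspace E) (sqprod E)"
  unfolding jordan_algebra_on_def
  by (auto simp: subspace_Aspace sqprod_sp sp_mem linear_on_def A_add A_scale sp.bilin sp.jordan_identity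
      intro: sp.comm)

end

theorem theorem11p1:
  fixes E :: "'e qlogic"
  assumes "ucp_space E"
    and "eps_hahn_jordan E"
    and "\<And>e1 e2 e3 x. \<lbrakk>orth E e1 e2; orth E e2 e3; orth E e1 e3; x \<in> Aspace E\<rbrakk>
           \<Longrightarrow> I3 E e1 e2 e3 x = 0"
    and "power_associative E"
    and "\<And>x. x \<in> Aspace E \<Longrightarrow> nonneg E (sqprod E x x)"
  shows "(\<forall>x\<in>Aspace E. \<forall>y\<in>Aspace E. sqprod E x y = sqprod E y x)
    \<and> jordan_algebra_on (Aspace E) (sqprod E)
    \<and> range (emb E) \<subseteq> {y \<in> Aspace E. sqprod E y y = y}
    \<and> {y \<in> Aspace E. sqprod E y y = y} \<subseteq> weak_star E closure_of range (emb E)"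
proof -
  interpret positive_power_assoc_ucp E
    using assms by unfold_locales
  have idem: "{y \<in> Aspace E. sqprod E y y = y} = {y. sp.idem y}"
    by (auto simp: sp.idem_def sqprod_sp)
  show ?thesis
    unfolding idem using jordan_algebra idem_emb idem_in_closure
    by (auto simp: sqprod_sp intro: sp.comm)
qed

end
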